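(* For a finitary biframe $\mathcal L$, the following are equivalent. (1) The bispace $\mathsf{bpt}(\mathcal L)$ is bi-$T_D$. (2) The bispace $\mathsf{bpt}(\mathsf A(\mathcal L))\cong Sk(\mathsf{bpt}(\mathcal L))$ is patch-discrete. (3) The coframe $\mathsf{bisp}[\mathsf S(\mathcal L)]$ of bispatial biquotients of $\mathcal L$ is a Boolean algebra. (4) All the bisubspaces of $\mathsf{bpt}(\mathcal L)$ are bisober. (5) The map $\mathsf{bpt}:\mathsf{bisp}[\mathsf S(\mathcal L)]\to\mathcal P(\mathsf{bpt}(\mathcal L))$ is an isomorphism.
   Context: A biframe is a triple $\mathcal L=(L^+,L^-,L)$ of frames with injective frame maps $e_L^{\pm}:L^{\pm}\to L$ such that every element of $L$ (the main component) is a join of elements $e_L^+(x^+)\wedge e_L^-(x^-)$; we identify $x^{\pm}$ with $e_L^{\pm}(x^{\pm})$. A biframe map $(f^+,f^-):\mathcal L\to\mathcal M$ is a pair of frame maps $f^{\pm}:L^{\pm}\to M^{\pm}$ for which there is a (necessarily unique) frame map $f:L\to M$ with $f\circ e_L^{\pm}=e_M^{\pm}\circ f^{\pm}$. A relation $R$ on a frame is treated as a set of inequalities: the quotient by $R$ is the universal frame quotient $q$ with $q(a)\le q(b)$ for $(a,b)\in R$; the congruence generated by $R$ is the kernel of $q$. $\mathsf{fin}(L)\subseteq L$ is the set of finite joins of elements $x^+\wedge x^-$; a congruence on $L$ is finitary if generated by some $R\subseteq\mathsf{fin}(L)\times\mathsf{fin}(L)$. With $L^+\oplus L^-$ the frame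 coproduct and $C_L$ the kernel of the canonical surjection $L^+\oplus L^-\to L$, $\mathcal L$ is finitary if $C_L$ is a finitary congruence on $L^+\oplus L^-$ (the main component of $(L^+,L^-,L^+\oplus L^-)$). For a congruence $C$ on $L$, $\mathcal L/C=(L^+/C^+,L^-/C^-,L/C)$ with $C^{\pm}$ the restriction of $C$ to $L^{\pm}$. A biquotient of a finitary biframe $\mathcal L$ is a quotient $\mathcal L/C$ with $C$ a finitary congruence on $L$ (then $\mathcal L/C$ is again finitary); $\mathsf S(\mathcal L)$ is the coframe of biquotients, ordered by $\mathcal L/C\le\mathcal L/D$ iff $D\subseteq C$. A bispace is a set $X$ with two topologies $\Omega^+(X),\Omega^-(X)$; its patch topology is generated by $\Omega^+(X)\cup\Omega^-(X)$; $X$ is patch-discrete if the patch topology is discrete. A bisubspace is a subset with both subspace topologies. $X$ is bi-$T_D$ if every singleton is of the form $U^+\cap U^-\cap (X\setminus V^+)\cap(X\setminus V^-)$ with $U^+,V^+\in\Omega^+(X)$ and $U^-,V^-\in\Omega^-(X)$. $Sk(X)$ has the same points as $X$; its positive topology is generated by the positive opens and the negative closed sets of $X$, its negative topology by the negative opens and the positive closed sets of $X$. $\mathsf{bpt}(\mathcal L)$ is the bispace of biframe maps $\mathcal L\to(2,2,2)$ with positive opens $\varphi^+_{\mathcal L}(a^+)=\{f:f^+(a^+)=1\}$ and negative opens $\varphi^-_{\mathcal L}(a^-)=\{f:f^-(a^-)=1\}$. $\mathsf{b}\Omega_{\mathsf{fin}}(X)=(\Omega^+(X),\Omega^-(X),\Omega_{\mathsf{fin}}(X))$,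 with $\Omega_{\mathsf{fin}}(X)$ the quotient of $\Omega^+(X)\oplus\Omega^-(X)$ by $\{(U^+\wedge U^-,V^+\vee V^-):U^+\cap U^-\subseteq V^+\cup V^-\}$. $X$ is bisober if $X\to\mathsf{bpt}(\mathsf{b}\Omega_{\mathsf{fin}}(X))$, $x\mapsto(N_x^+,N_x^-)$ with $N_x^{\pm}(U)=1$ iff $x\in U$, is a bihomeomorphism (a bijection that is a homeomorphism for both topologies). A finitary biframe $\mathcal L$ is bispatial if $(\varphi^+_{\mathcal L},\varphi^-_{\mathcal L}):\mathcal L\to\mathsf{b}\Omega_{\mathsf{fin}}(\mathsf{bpt}(\mathcal L))$ is an isomorphism of biframes. $\mathsf{bisp}[\mathsf S(\mathcal L)]$ is the sub-poset of $\mathsf S(\mathcal L)$ of those biquotients that are bispatial. The map $\mathsf{bpt}:\mathsf S(\mathcal L)\to\mathcal P(\mathsf{bpt}(\mathcal L))$ (powerset) sends $\mathcal L/C$ to the set of bipoints of $\mathcal L$ that factor through the quotient map $\mathcal L\to\mathcal L/C$. $\mathsf A(L)$ is the frame of congruences on $L$ ordered by inclusion; $\nabla(a)=\{(x,y):x\vee a=y\vee a\}$, $\Delta(a)=\{(x,y):x\wedge a=y\wedge a\}$. The assembly of $\mathcal L$ is the biframe $\mathsf A(\mathcal L)$ whose positive, negative and main components are the subframes of $\mathsf A(L)$ generated respectively by $\{\nabla(a^+):a^+\in L^+\}\cup\{\Delta(a^-):a^-\in L^-\}$, by $\{\nabla(a^-):a^-\in L^-\}\cup\{\Delta(a^+):a^+\in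 L^+\}$, and by $\{\nabla(x):x\in L\}\cup\{\Delta(s):s\in\mathsf{fin}(L)\}$. The bihomeomorphism $Sk(\mathsf{bpt}(\mathcal L))\cong\mathsf{bpt}(\mathsf A(\mathcal L))$ in (2) sends a bipoint $f$ of $\mathcal L$ to the unique bipoint $\tilde f$ of $\mathsf A(\mathcal L)$ with $\tilde f(\nabla(a^{\pm}))=f^{\pm}(a^{\pm})$. *)

theory Defs
  imports "HOL-Algebra.Complete_Lattice" "HOL-Analysis.Abstract_Topology"
begin

section \<open>Frames\<close>

text \<open>Frames are carrier-based orders in the sense of HOL-Algebra, whose operations
  (joins, meets, top, bottom) are only meaningful on subsets of the carrier.\<close>

locale frame = complete_lattice L for L (structure) +
  assumes inf_Sup_distrib:
    "\<lbrakk>x \<in> carrier L; A \<subseteq> carrier L\<rbrakk> \<Longrightarrow> x \<sqinter> (\<Squnion>A) = \<Squnion>((\<lambda>y. x \<sqinter> y) ` A)"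

definition coframe :: "'a gorder \<Rightarrow> bool" where
  "coframe L \<longleftrightarrow> frame (inv_gorder L)"

definition is_boolean_algebra :: "'a gorder \<Rightarrow> bool" where
  "is_boolean_algebra L \<longleftrightarrow> bounded_lattice L \<and>
     (\<forall>x\<in>carrier L. \<forall>y\<in>carrier L. \<forall>z\<in>carrier L.
        x \<sqinter>\<^bsub>L\<^esub> (y \<squnion>\<^bsub>L\<^esub> z) = (x \<sqinter>\<^bsub>L\<^esub> y) \<squnion>\<^bsub>L\<^esub> (x \<sqinter>\<^bsub>L\<^esub> z)) \<and>
     (\<forall>x\<in>carrier L. \<exists>y\<in>carrier L. x \<sqinter>\<^bsub>L\<^esub> y = \<bottom>\<^bsub>L\<^esub> \<and> x \<squnion>\<^bsub>L\<^esub> y = \<top>\<^bsub>L\<^esub>)"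

definition order_iso :: "'a gorder \<Rightarrow> 'b gorder \<Rightarrow> ('a \<Rightarrow> 'b) \<Rightarrow> bool" where
  "order_iso P Q f \<longleftrightarrow> order_emb P Q f \<and> bij_betw f (carrier P) (carrier Q)"

definition inclusion_order :: "'a set set \<Rightarrow> 'a set gorder" where
  "inclusion_order S = \<lparr>carrier = S, eq = (=), le = (\<subseteq>)\<rparr>"

definition frame_map :: "'a gorder \<Rightarrow> 'b gorder \<Rightarrow> ('a \<Rightarrow> 'b) \<Rightarrow> bool" where
  "frame_map L M f \<longleftrightarrow> f \<in> carrier L \<rightarrow> carrier M \<and>
     f \<top>\<^bsub>L\<^esub> = \<top>\<^bsub>M\<^esub> \<and>
     (\<forall>x\<in>carrier L. \<forall>y\<in>carrier L. f (x \<sqinter>\<^bsub>L\<^esub> y) = f x \<sqinter>\<^bsub>M\<^esub> f y) \<and>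
     (\<forall>A. A \<subseteq> carrier L \<longrightarrow> f (\<Squnion>\<^bsub>L\<^esub>A) = \<Squnion>\<^bsub>M\<^esub>(f ` A))"

definition two :: "bool gorder" where
  "two = \<lparr>carrier = UNIV, eq = (=), le = (\<le>)\<rparr>"

text \<open>The subframe of \<open>L\<close> generated by \<open>S\<close>, with the order inherited from \<open>L\<close>.\<close>

definition subframe_carrier :: "'a gorder \<Rightarrow> 'a set \<Rightarrow> bool" where
  "subframe_carrier L T \<longleftrightarrow> T \<subseteq> carrier L \<and> \<top>\<^bsub>L\<^esub> \<in> T \<and>
     (\<forall>x\<in>T. \<forall>y\<in>T. x \<sqinter>\<^bsub>L\<^esub> y \<in> T) \<and> (\<forall>A. A \<subseteq> T \<longrightarrow> \<Squnion>\<^bsub>L\<^esub>A \<in> T)"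

definition subframe_generated :: "'a gorder \<Rightarrow> 'a set \<Rightarrow> 'a gorder" where
  "subframe_generated L S = L\<lparr>carrier := \<Inter>{T. subframe_carrier L T \<and> S \<subseteq> T}\<rparr>"


section \<open>Congruences and quotients of frames\<close>

text \<open>In the last clause \<open>S\<close> is a family of congruent pairs; it may be empty or infinite.\<close>

definition frame_congruence :: "'a gorder \<Rightarrow> ('a \<times> 'a) set \<Rightarrow> bool" where
  "frame_congruence L C \<longleftrightarrow> equiv (carrier L) C \<and>
     (\<forall>(x, x')\<in>C. \<forall>(y, y')\<in>C. (x \<sqinter>\<^bsub>L\<^esub> y, x' \<sqinter>\<^bsub>L\<^esub> y') \<in> C) \<and>
     (\<forall>S. S \<subseteq> C \<longrightarrow> (\<Squnion>\<^bsub>L\<^esub>(fst ` S), \<Squnion>\<^bsub>L\<^esub>(snd ` S)) \<in> C)"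

text \<open>The quotient map \<open>L \<rightarrow> L/C\<close> is \<open>x \<mapsto> C `` {x}\<close>.\<close>

definition quotient_frame :: "'a gorder \<Rightarrow> ('a \<times> 'a) set \<Rightarrow> 'a set gorder" where
  "quotient_frame L C = \<lparr>carrier = carrier L // C, eq = (=),
     le = (\<lambda>X Y. \<exists>x\<in>X. \<exists>y\<in>Y. (x \<sqinter>\<^bsub>L\<^esub> y, x) \<in> C)\<rparr>"

text \<open>The congruence generated by a relation \<open>R\<close>, read as a set of inequalities: the least
  congruence \<open>C\<close> such that \<open>[a] \<le> [b]\<close> in \<open>L/C\<close> for all \<open>(a, b) \<in> R\<close>. As frame quotients of
  \<open>L\<close> correspond to their kernels, it is the kernel of the universal such quotient of \<open>L\<close>.\<close>

definition generated_congruence :: "'a gorder \<Rightarrow> ('a \<times> 'a) set \<Rightarrow> ('a \<times> 'a) set" where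
  "generated_congruence L R = \<Inter>{C. frame_congruence L C \<and>
     (\<forall>(a, b)\<in>R. C `` {a} \<sqsubseteq>\<^bsub>quotient_frame L C\<^esub> C `` {b})}"

definition congruence_frame :: "'a gorder \<Rightarrow> ('a \<times> 'a) set gorder" where
  "congruence_frame L = inclusion_order {C. frame_congruence L C}"

definition nabla :: "'a gorder \<Rightarrow> 'a \<Rightarrow> ('a \<times> 'a) set" where
  "nabla L a = {(x, y) \<in> carrier L \<times> carrier L. x \<squnion>\<^bsub>L\<^esub> a = y \<squnion>\<^bsub>L\<^esub> a}"

definition delta :: "'a gorder \<Rightarrow> 'a \<Rightarrow> ('a \<times> 'a) set" where
  "delta L a = {(x, y) \<in> carrier L \<times> carrier L. x \<sqinter>\<^bsub>L\<^esub> a = y \<sqinter>\<^bsub>L\<^esub> a}"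


section \<open>Coproducts of two frames\<close>

text \<open>The usual model of the frame coproduct: down-sets \<open>D\<close> of \<open>L \<times> M\<close> that are closed under
  joins in each coordinate separately. The empty join is included, so every \<open>D\<close> contains all
  pairs with a bottom coordinate. The set \<open>D\<close> stands for the join of the elements
  \<open>a \<oplus> b\<close> (the meet of the images of \<open>a\<close> and \<open>b\<close>) with \<open>(a, b) \<in> D\<close>.\<close>

definition coprod_ideal :: "'p gorder \<Rightarrow> 'n gorder \<Rightarrow> ('p \<times> 'n) set \<Rightarrow> bool" where
  "coprod_ideal L M D \<longleftrightarrow> D \<subseteq> carrier L \<times> carrier M \<and>
     (\<forall>(a, b)\<in>D. \<forall>a'\<in>carrier L. \<forall>b'\<in>carrier M.
        a' \<sqsubseteq>\<^bsub>L\<^esub> a \<longrightarrow> b' \<sqsubseteq>\<^bsub>M\<^esub> b \<longrightarrow> (a', b') \<in> D) \<and>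
     (\<forall>A b. A \<subseteq> carrier L \<longrightarrow> b \<in> carrier M \<longrightarrow> A \<times> {b} \<subseteq> D \<longrightarrow> (\<Squnion>\<^bsub>L\<^esub>A, b) \<in> D) \<and>
     (\<forall>a B. a \<in> carrier L \<longrightarrow> B \<subseteq> carrier M \<longrightarrow> {a} \<times> B \<subseteq> D \<longrightarrow> (a, \<Squnion>\<^bsub>M\<^esub>B) \<in> D)"

definition coprod :: "'p gorder \<Rightarrow> 'n gorder \<Rightarrow> ('p \<times> 'n) set gorder" where
  "coprod L M = inclusion_order {D. coprod_ideal L M D}"

definition coprod_inl :: "'p gorder \<Rightarrow> 'n gorder \<Rightarrow> 'p \<Rightarrow> ('p \<times> 'n) set" where
  "coprod_inl L M x = {(a, b) \<in> carrier L \<times> carrier M. a \<sqsubseteq>\<^bsub>L\<^esub> x \<or> b = \<bottom>\<^bsub>M\<^esub>}"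

definition coprod_inr :: "'p gorder \<Rightarrow> 'n gorder \<Rightarrow> 'n \<Rightarrow> ('p \<times> 'n) set" where
  "coprod_inr L M y = {(a, b) \<in> carrier L \<times> carrier M. b \<sqsubseteq>\<^bsub>M\<^esub> y \<or> a = \<bottom>\<^bsub>L\<^esub>}"

text \<open>The frame map out of the coproduct induced by frame maps \<open>f : L \<rightarrow> K\<close> and \<open>g : M \<rightarrow> K\<close>.\<close>

definition copair :: "'k gorder \<Rightarrow> ('p \<Rightarrow> 'k) \<Rightarrow> ('n \<Rightarrow> 'k) \<Rightarrow> ('p \<times> 'n) set \<Rightarrow> 'k" where
  "copair K f g D = \<Squnion>\<^bsub>K\<^esub>((\<lambda>(a, b). f a \<sqinter>\<^bsub>K\<^esub> g b) ` D)"


section \<open>Biframes\<close>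

record ('p, 'n, 'a) biframe =
  pos :: "'p gorder"
  neg :: "'n gorder"
  main :: "'a gorder"
  epos :: "'p \<Rightarrow> 'a"
  eneg :: "'n \<Rightarrow> 'a"

definition rect :: "('p, 'n, 'a) biframe \<Rightarrow> 'p \<times> 'n \<Rightarrow> 'a" where
  "rect L = (\<lambda>(a, b). epos L a \<sqinter>\<^bsub>main L\<^esub> eneg L b)"

definition is_biframe :: "('p, 'n, 'a) biframe \<Rightarrow> bool" where
  "is_biframe L \<longleftrightarrow> frame (pos L) \<and> frame (neg L) \<and> frame (main L) \<and>
     frame_map (pos L) (main L) (epos L) \<and> inj_on (epos L) (carrier (pos L)) \<and>
     frame_map (neg L) (main L) (eneg L) \<and> inj_on (eneg L) (carrier (neg L)) \<and>
     (\<forall>x\<in>carrier (main L). \<exists>S \<subseteq> carrier (pos L) \<times> carrier (neg L).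
        x = \<Squnion>\<^bsub>main L\<^esub>(rect L ` S))"

definition biframe_map ::
  "('p, 'n, 'a) biframe \<Rightarrow> ('q, 'm, 'b) biframe \<Rightarrow> ('p \<Rightarrow> 'q) \<times> ('n \<Rightarrow> 'm) \<Rightarrow> bool" where
  "biframe_map L M f \<longleftrightarrow>
     frame_map (pos L) (pos M) (fst f) \<and> frame_map (neg L) (neg M) (snd f) \<and>
     (\<exists>h. frame_map (main L) (main M) h \<and>
        (\<forall>a\<in>carrier (pos L). h (epos L a) = epos M (fst f a)) \<and>
        (\<forall>b\<in>carrier (neg L). h (eneg L b) = eneg M (snd f b)))"

definition biframe_iso ::
  "('p, 'n, 'a) biframe \<Rightarrow> ('q, 'm, 'b) biframe \<Rightarrow> ('p \<Rightarrow> 'q) \<times> ('n \<Rightarrow> 'm) \<Rightarrow> bool" where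
  "biframe_iso L M f \<longleftrightarrow> biframe_map L M f \<and> (\<exists>g. biframe_map M L g \<and>
     (\<forall>a\<in>carrier (pos L). fst g (fst f a) = a) \<and> (\<forall>b\<in>carrier (neg L). snd g (snd f b) = b) \<and>
     (\<forall>a\<in>carrier (pos M). fst f (fst g a) = a) \<and> (\<forall>b\<in>carrier (neg M). snd f (snd g b) = b))"

definition fin :: "('p, 'n, 'a) biframe \<Rightarrow> 'a set" where
  "fin L = {\<Squnion>\<^bsub>main L\<^esub>(rect L ` S) | S. finite S \<and> S \<subseteq> carrier (pos L) \<times> carrier (neg L)}"

definition finitary_congruence :: "('p, 'n, 'a) biframe \<Rightarrow> ('a \<times> 'a) set \<Rightarrow> bool" where
  "finitary_congruence L C \<longleftrightarrow>
     (\<exists>R. R \<subseteq> fin L \<times> fin L \<and> C = generated_congruence (main L) R)"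

definition coprod_biframe :: "'p gorder \<Rightarrow> 'n gorder \<Rightarrow> ('p, 'n, ('p \<times> 'n) set) biframe" where
  "coprod_biframe P N = \<lparr>pos = P, neg = N, main = coprod P N,
     epos = coprod_inl P N, eneg = coprod_inr P N\<rparr>"

definition coprod_kernel :: "('p, 'n, 'a) biframe \<Rightarrow> (('p \<times> 'n) set \<times> ('p \<times> 'n) set) set" where
  "coprod_kernel L =
     {(D, E) \<in> carrier (coprod (pos L) (neg L)) \<times> carrier (coprod (pos L) (neg L)).
        copair (main L) (epos L) (eneg L) D = copair (main L) (epos L) (eneg L) E}"

definition finitary_biframe :: "('p, 'n, 'a) biframe \<Rightarrow> bool" where
  "finitary_biframe L \<longleftrightarrow> is_biframe L \<and>
     finitary_congruence (coprod_biframe (pos L) (neg L)) (coprod_kernel L)"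

text \<open>The quotient biframe by a congruence on the main component. The embedding
  \<open>L\<^sup>\<plusminus>/C\<^sup>\<plusminus> \<rightarrow> L/C\<close> sends the class of \<open>a\<close> to the class of \<open>e\<^sup>\<plusminus> a\<close>.\<close>

definition cong_pos :: "('p, 'n, 'a) biframe \<Rightarrow> ('a \<times> 'a) set \<Rightarrow> ('p \<times> 'p) set" where
  "cong_pos L C = {(a, b) \<in> carrier (pos L) \<times> carrier (pos L). (epos L a, epos L b) \<in> C}"

definition cong_neg :: "('p, 'n, 'a) biframe \<Rightarrow> ('a \<times> 'a) set \<Rightarrow> ('n \<times> 'n) set" where
  "cong_neg L C = {(a, b) \<in> carrier (neg L) \<times> carrier (neg L). (eneg L a, eneg L b) \<in> C}"

definition quotient_biframe ::
  "('p, 'n, 'a) biframe \<Rightarrow> ('a \<times> 'a) set \<Rightarrow> ('p set, 'n set, 'a set) biframe" where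
  "quotient_biframe L C =
     \<lparr>pos = quotient_frame (pos L) (cong_pos L C),
      neg = quotient_frame (neg L) (cong_neg L C),
      main = quotient_frame (main L) C,
      epos = (\<lambda>X. C `` (epos L ` X)), eneg = (\<lambda>X. C `` (eneg L ` X))\<rparr>"

text \<open>The coframe of biquotients. Since \<open>C\<close> can be recovered from \<open>L/C\<close>, the biquotient \<open>L/C\<close>
  is represented by the finitary congruence \<open>C\<close>; the order is reverse inclusion.\<close>

definition biquotients :: "('p, 'n, 'a) biframe \<Rightarrow> ('a \<times> 'a) set gorder" where
  "biquotients L = \<lparr>carrier = {C. finitary_congruence L C}, eq = (=), le = (\<lambda>C D. D \<subseteq> C)\<rparr>"

definition assembly ::
  "('p, 'n, 'a) biframe \<Rightarrow> (('a \<times> 'a) set, ('a \<times> 'a) set, ('a \<times> 'a) set) biframe" where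
  "assembly L = (let A = congruence_frame (main L);
       np = (\<lambda>a. nabla (main L) (epos L a)) ` carrier (pos L);
       nn = (\<lambda>a. nabla (main L) (eneg L a)) ` carrier (neg L);
       dp = (\<lambda>a. delta (main L) (epos L a)) ` carrier (pos L);
       dn = (\<lambda>a. delta (main L) (eneg L a)) ` carrier (neg L)
     in \<lparr>pos = subframe_generated A (np \<union> dn),
         neg = subframe_generated A (nn \<union> dp),
         main = subframe_generated A (nabla (main L) ` carrier (main L) \<union> delta (main L) ` fin L),
         epos = id, eneg = id\<rparr>)"


section \<open>Bispaces\<close>

record 'x bispace =
  ptop :: "'x topology"
  ntop :: "'x topology"

definition is_bispace :: "'x bispace \<Rightarrow> bool" where
  "is_bispace X \<longleftrightarrow> topspace (ptop X) = topspace (ntop X)"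

text \<open>For a bispace, the points are those of either topology.\<close>

definition points :: "'x bispace \<Rightarrow> 'x set" where
  "points X = topspace (ptop X)"

definition bihomeomorphism :: "'x bispace \<Rightarrow> 'y bispace \<Rightarrow> ('x \<Rightarrow> 'y) \<Rightarrow> bool" where
  "bihomeomorphism X Y f \<longleftrightarrow>
     homeomorphic_map (ptop X) (ptop Y) f \<and> homeomorphic_map (ntop X) (ntop Y) f"

definition bisubspace :: "'x bispace \<Rightarrow> 'x set \<Rightarrow> 'x bispace" where
  "bisubspace X A = \<lparr>ptop = subtopology (ptop X) A, ntop = subtopology (ntop X) A\<rparr>"

definition patch :: "'x bispace \<Rightarrow> 'x topology" where
  "patch X = topology_generated_by ({U. openin (ptop X) U} \<union> {U. openin (ntop X) U})"

definition patch_discrete :: "'x bispace \<Rightarrow> bool" where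
  "patch_discrete X \<longleftrightarrow> patch X = discrete_topology (points X)"

definition bi_TD :: "'x bispace \<Rightarrow> bool" where
  "bi_TD X \<longleftrightarrow> (\<forall>x\<in>points X. \<exists>U U' V V'.
     openin (ptop X) U \<and> openin (ntop X) U' \<and> openin (ptop X) V \<and> openin (ntop X) V' \<and>
     {x} = U \<inter> U' \<inter> (points X - V) \<inter> (points X - V'))"

definition Sk :: "'x bispace \<Rightarrow> 'x bispace" where
  "Sk X = \<lparr>ptop = topology_generated_by ({U. openin (ptop X) U} \<union> {K. closedin (ntop X) K}),
           ntop = topology_generated_by ({U. openin (ntop X) U} \<union> {K. closedin (ptop X) K})\<rparr>"


section \<open>Bipoints and bisobriety\<close>

definition two_biframe :: "(bool, bool, bool) biframe" where
  "two_biframe = \<lparr>pos = two, neg = two, main = two, epos = id, eneg = id\<rparr>"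

text \<open>Bipoints are extensional functions, so that two bipoints agreeing on the carriers are equal.\<close>

definition bipoints :: "('p, 'n, 'a) biframe \<Rightarrow> (('p \<Rightarrow> bool) \<times> ('n \<Rightarrow> bool)) set" where
  "bipoints L = {f. fst f \<in> extensional (carrier (pos L)) \<and> snd f \<in> extensional (carrier (neg L)) \<and>
     biframe_map L two_biframe f}"

definition phi_pos :: "('p, 'n, 'a) biframe \<Rightarrow> 'p \<Rightarrow> (('p \<Rightarrow> bool) \<times> ('n \<Rightarrow> bool)) set" where
  "phi_pos L a = {f \<in> bipoints L. fst f a}"

definition phi_neg :: "('p, 'n, 'a) biframe \<Rightarrow> 'n \<Rightarrow> (('p \<Rightarrow> bool) \<times> ('n \<Rightarrow> bool)) set" where
  "phi_neg L a = {f \<in> bipoints L. snd f a}"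

definition bpt :: "('p, 'n, 'a) biframe \<Rightarrow> (('p \<Rightarrow> bool) \<times> ('n \<Rightarrow> bool)) bispace" where
  "bpt L = \<lparr>ptop = topology (\<lambda>U. \<exists>a\<in>carrier (pos L). U = phi_pos L a),
            ntop = topology (\<lambda>U. \<exists>a\<in>carrier (neg L). U = phi_neg L a)\<rparr>"

definition opens_frame :: "'x topology \<Rightarrow> 'x set gorder" where
  "opens_frame T = inclusion_order {U. openin T U}"

definition bOmega_relation ::
  "'x bispace \<Rightarrow> (('x set \<times> 'x set) set \<times> ('x set \<times> 'x set) set) set" where
  "bOmega_relation X = (let P = opens_frame (ptop X); N = opens_frame (ntop X) in
     {(coprod_inl P N U \<sqinter>\<^bsub>coprod P N\<^esub> coprod_inr P N U',
       coprod_inl P N V \<squnion>\<^bsub>coprod P N\<^esub> coprod_inr P N V') | U U' V V'.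
        U \<in> carrier P \<and> U' \<in> carrier N \<and> V \<in> carrier P \<and> V' \<in> carrier N \<and>
        U \<inter> U' \<subseteq> V \<union> V'})"

definition bOmega_fin ::
  "'x bispace \<Rightarrow> ('x set, 'x set, ('x set \<times> 'x set) set set) biframe" where
  "bOmega_fin X = (let P = opens_frame (ptop X); N = opens_frame (ntop X);
       C = generated_congruence (coprod P N) (bOmega_relation X)
     in \<lparr>pos = P, neg = N, main = quotient_frame (coprod P N) C,
         epos = (\<lambda>U. C `` {coprod_inl P N U}), eneg = (\<lambda>U. C `` {coprod_inr P N U})\<rparr>)"

definition nbhd_point :: "'x bispace \<Rightarrow> 'x \<Rightarrow> ('x set \<Rightarrow> bool) \<times> ('x set \<Rightarrow> bool)" where
  "nbhd_point X x =
     (restrict (\<lambda>U. x \<in> U) {U. openin (ptop X) U}, restrict (\<lambda>U. x \<in> U) {U. openin (ntop X) U})"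

definition bisober :: "'x bispace \<Rightarrow> bool" where
  "bisober X \<longleftrightarrow> is_bispace X \<and> bihomeomorphism X (bpt (bOmega_fin X)) (nbhd_point X)"

definition bispatial :: "('p, 'n, 'a) biframe \<Rightarrow> bool" where
  "bispatial L \<longleftrightarrow> finitary_biframe L \<and>
     biframe_iso L (bOmega_fin (bpt L)) (phi_pos L, phi_neg L)"

definition bisp_biquotients :: "('p, 'n, 'a) biframe \<Rightarrow> ('a \<times> 'a) set gorder" where
  "bisp_biquotients L = (biquotients L)
     \<lparr>carrier := {C \<in> carrier (biquotients L). bispatial (quotient_biframe L C)}\<rparr>"

text \<open>The map \<open>S(L) \<rightarrow> P(bpt(L))\<close>: the bipoints \<open>f = g \<circ> q\<close>, where \<open>g\<close> is a bipoint of
  \<open>L/C\<close> and \<open>q\<close> is the quotient map.\<close>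

definition bpt_biquotient ::
  "('p, 'n, 'a) biframe \<Rightarrow> ('a \<times> 'a) set \<Rightarrow> (('p \<Rightarrow> bool) \<times> ('n \<Rightarrow> bool)) set" where
  "bpt_biquotient L C = {f \<in> bipoints L. \<exists>g\<in>bipoints (quotient_biframe L C).
     (\<forall>a\<in>carrier (pos L). fst f a = fst g (cong_pos L C `` {a})) \<and>
     (\<forall>a\<in>carrier (neg L). snd f a = snd g (cong_neg L C `` {a}))}"

text \<open>\<open>extends_to_assembly L f g\<close>: the bipoint \<open>g\<close> of the assembly extends the bipoint \<open>f\<close> of
  \<open>L\<close> along \<open>\<nabla>\<close>.\<close>

definition extends_to_assembly ::
  "('p, 'n, 'a) biframe \<Rightarrow> ('p \<Rightarrow> bool) \<times> ('n \<Rightarrow> bool)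
     \<Rightarrow> (('a \<times> 'a) set \<Rightarrow> bool) \<times> (('a \<times> 'a) set \<Rightarrow> bool) \<Rightarrow> bool" where
  "extends_to_assembly L f g \<longleftrightarrow>
     (\<forall>a\<in>carrier (pos L). fst g (nabla (main L) (epos L a)) = fst f a) \<and>
     (\<forall>a\<in>carrier (neg L). snd g (nabla (main L) (eneg L a)) = snd f a)"

definition assembly_point ::
  "('p, 'n, 'a) biframe \<Rightarrow> ('p \<Rightarrow> bool) \<times> ('n \<Rightarrow> bool)
     \<Rightarrow> (('a \<times> 'a) set \<Rightarrow> bool) \<times> (('a \<times> 'a) set \<Rightarrow> bool)" where
  "assembly_point L f = (THE g. g \<in> bipoints (assembly L) \<and> extends_to_assembly L f g)"

end

theory Submission
  imports Defs
begin

text \<open>Bipoints of \<open>\<L>\<close> are the same as frame maps \<open>L \<rightarrow> 2\<close>. A finitary relation is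
  equivalent to a set of inequalities \<open>a\<^sup>+ \<sqinter> b\<^sup>- \<sqsubseteq> c\<^sup>+ \<squnion> d\<^sup>-\<close>, because a finite join of rectangles is
  a finite meet of elements \<open>c\<^sup>+ \<squnion> d\<^sup>-\<close>. Hence the set of bipoints that factor through a
  finitary quotient is closed for the topology with basic opens
  \<open>\<phi>(a\<^sup>+) \<inter> \<phi>(b\<^sup>-) - \<phi>(c\<^sup>+) - \<phi>(d\<^sup>-)\<close>, the patch topology of the Skula bispace, and a
  biquotient is bispatial iff its congruence is generated by all such inequalities that hold on its
  bipoints. So the bispatial biquotients are order isomorphic to the closed sets of this topology,
  and a bisubspace is bisober iff it is closed in it. The topology is
  Hausdorff, so its closed sets form a Boolean algebra iff it is discrete, which is the condition
  bi-\<open>T\<^sub>D\<close>. Finally, the bipoint of the assembly that extends a point \<open>f\<close> of \<open>L\<close> sends a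
  congruence to \<open>1\<close> iff it is not contained in the kernel of \<open>f\<close>.\<close>

section \<open>Complete lattices, frames and frame maps\<close>

text \<open>Maps out of the main component come from one principle,
  \<open>finitary_extension\<close>: a pair of frame maps on the two parts extends as soon as it
  respects the inequalities \<open>a \<sqinter> b \<sqsubseteq> c \<squnion> d\<close> of
  \<open>L\<close>. It makes quotients by finitary congruences finitary again, so that bispatiality
  can be tested on them; it makes \<open>(phi_pos L, phi_neg L)\<close> a biframe map; and it turns
  a bipoint of the opens of a bisubspace into a point of \<open>L\<close>. Closed sets are handled
  through inequalities: a point lies in \<open>pclosure S\<close> iff it satisfies all basic
  inequalities valid on \<open>S\<close>. Two violated inequalities combine into one, so finite
  unions of closed sets are closed. Meets and joins of closed sets are thus intersections and
  unions, and the only possible complement of the closed set {f} is the set of all other points. For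
  the assembly, the kernel of a point is meet-prime among congruences, so that not being contained
  in it is compatible with binary meets. Uniqueness of the extension holds because
  \<open>nabla x\<close> and \<open>delta x\<close> are complements, and a map to \<open>two\<close>
  has no freedom on complements.\<close>

context partial_order
begin

text \<open>Suprema are defined by choice, so an equation for one rests on the uniqueness of least
  upper bounds. Stated for partial orders, it is available before completeness of a concrete order
  is known.\<close>

lemma sup_eqI:
  assumes "x \<in> carrier L" "A \<subseteq> carrier L" "\<And>a. a \<in> A \<Longrightarrow> a \<sqsubseteq> x"
    "\<And>y. y \<in> carrier L \<Longrightarrow> (\<And>a. a \<in> A \<Longrightarrow> a \<sqsubseteq> y) \<Longrightarrow> x \<sqsubseteq> y"
  shows "\<Squnion>A = x"
proof -
  have "least L x (Upper L A)"
    using assms by (intro least_UpperI) (auto simp: Upper_def subset_iff)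
  then show ?thesis
    unfolding sup_def by (intro some_equality) (auto intro: least_unique)
qed

lemma inf_eqI:
  assumes "x \<in> carrier L" "A \<subseteq> carrier L" "\<And>a. a \<in> A \<Longrightarrow> x \<sqsubseteq> a"
    "\<And>y. y \<in> carrier L \<Longrightarrow> (\<And>a. a \<in> A \<Longrightarrow> y \<sqsubseteq> a) \<Longrightarrow> y \<sqsubseteq> x"
  shows "\<Sqinter>A = x"
proof -
  have "greatest L x (Lower L A)"
    using assms by (intro greatest_LowerI) (auto simp: Lower_def subset_iff)
  then show ?thesis
    unfolding inf_def by (intro some_equality) (auto intro: greatest_unique)
qed

lemma meet_eqI:
  assumes "z \<in> carrier L" "x \<in> carrier L" "y \<in> carrier L" "z \<sqsubseteq> x" "z \<sqsubseteq> y"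
    "\<And>w. w \<in> carrier L \<Longrightarrow> w \<sqsubseteq> x \<Longrightarrow> w \<sqsubseteq> y \<Longrightarrow> w \<sqsubseteq> z"
  shows "x \<sqinter> y = z"
  unfolding meet_def by (rule inf_eqI) (use assms in auto)

lemma join_eqI:
  assumes "z \<in> carrier L" "x \<in> carrier L" "y \<in> carrier L" "x \<sqsubseteq> z" "y \<sqsubseteq> z"
    "\<And>w. w \<in> carrier L \<Longrightarrow> x \<sqsubseteq> w \<Longrightarrow> y \<sqsubseteq> w \<Longrightarrow> z \<sqsubseteq> w"
  shows "x \<squnion> y = z"
  unfolding join_def by (rule sup_eqI) (use assms in auto)

lemma top_eqI:
  assumes "x \<in> carrier L" "\<And>y. y \<in> carrier L \<Longrightarrow> y \<sqsubseteq> x"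
  shows "\<top> = x"
proof -
  have "greatest L x (carrier L)"
    using assms by (auto simp: greatest_def)
  then show ?thesis
    unfolding top_def by (intro some_equality) (auto intro: greatest_unique)
qed

lemma bottom_eqI:
  assumes "x \<in> carrier L" "\<And>y. y \<in> carrier L \<Longrightarrow> x \<sqsubseteq> y"
  shows "\<bottom> = x"
proof -
  have "least L x (carrier L)"
    using assms by (auto simp: least_def)
  then show ?thesis
    unfolding bottom_def by (intro some_equality) (auto intro: least_unique)
qed

end

lemma partial_orderI:
  assumes "eq L = (=)"
    and "\<And>x. x \<in> carrier L \<Longrightarrow> le L x x"
    and "\<And>x y. x \<in> carrier L \<Longrightarrow> y \<in> carrier L \<Longrightarrow> le L x y \<Longrightarrow> le L y x \<Longrightarrow> x = y"
    and "\<And>x y z. x \<in> carrier L \<Longrightarrow> y \<in> carrier L \<Longrightarrow> z \<in> carrier L \<Longrightarrow> le L x y \<Longrightarrow> le L y z \<Longrightarrow> le L x z"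
  shows "partial_order L"
  by unfold_locales (simp_all add: assms(1), (erule assms; assumption)+)

text \<open>Infima come for free: the infimum of \<open>A\<close> is the supremum of the set of its
  lower bounds.\<close>

lemma complete_latticeI_sup:
  assumes "partial_order L"
    and sups: "\<And>A. A \<subseteq> carrier L \<Longrightarrow> \<exists>s\<in>carrier L. (\<forall>a\<in>A. le L a s) \<and>
      (\<forall>y\<in>carrier L. (\<forall>a\<in>A. le L a y) \<longrightarrow> le L s y)"
  shows "complete_lattice L"
proof -
  interpret partial_order L by fact
  show ?thesis
  proof (rule complete_latticeI)
    fix A assume A: "A \<subseteq> carrier L"
    from sups[OF A] obtain s where "s \<in> carrier L" "\<forall>a\<in>A. le L a s"
      "\<forall>y\<in>carrier L. (\<forall>a\<in>A. le L a y) \<longrightarrow> le L s y" by blast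
    then have "least L s (Upper L A)" using A by (intro least_UpperI) (auto simp: Upper_def subset_iff)
    then show "\<exists>s. least L s (Upper L A)" ..
    have "Lower L A \<subseteq> carrier L" by auto
    from sups[OF this] obtain i where "i \<in> carrier L" "\<forall>a\<in>Lower L A. le L a i"
      "\<forall>y\<in>carrier L. (\<forall>a\<in>Lower L A. le L a y) \<longrightarrow> le L i y" by blast
    then have "greatest L i (Lower L A)" using A by (intro greatest_LowerI) auto
    then show "\<exists>i. greatest L i (Lower L A)" ..
  qed
qed

lemma complete_latticeI_inf:
  assumes "partial_order L"
    and infs: "\<And>A. A \<subseteq> carrier L \<Longrightarrow> \<exists>s\<in>carrier L. (\<forall>a\<in>A. le L s a) \<and>
      (\<forall>y\<in>carrier L. (\<forall>a\<in>A. le L y a) \<longrightarrow> le L y s)"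
  shows "complete_lattice L"
proof -
  interpret partial_order L by fact
  show ?thesis
  proof (rule complete_latticeI)
    fix A assume A: "A \<subseteq> carrier L"
    from infs[OF A] obtain s where "s \<in> carrier L" "\<forall>a\<in>A. le L s a"
      "\<forall>y\<in>carrier L. (\<forall>a\<in>A. le L y a) \<longrightarrow> le L y s" by blast
    then have "greatest L s (Lower L A)" using A by (intro greatest_LowerI) (auto simp: Lower_def subset_iff)
    then show "\<exists>s. greatest L s (Lower L A)" ..
    have "Upper L A \<subseteq> carrier L" by auto
    from infs[OF this] obtain i where "i \<in> carrier L" "\<forall>a\<in>Upper L A. le L i a"
      "\<forall>y\<in>carrier L. (\<forall>a\<in>Upper L A. le L y a) \<longrightarrow> le L y i" by blast
    then have "least L i (Upper L A)" using A by (intro least_UpperI) auto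
    then show "\<exists>i. least L i (Upper L A)" ..
  qed
qed

context complete_lattice
begin

sublocale bounded_lattice L ..

lemma sup_empty: "\<Squnion>{} = \<bottom>"
  using weak_sup_empty unfolding eq_is_equal .

lemma sup_le_iff:
  assumes "A \<subseteq> carrier L" "z \<in> carrier L"
  shows "\<Squnion>A \<sqsubseteq> z \<longleftrightarrow> (\<forall>a\<in>A. a \<sqsubseteq> z)"
  using assms by (meson le_trans sup_closed sup_least sup_upper subsetD)

lemma meet_le_iff:
  assumes "x \<in> carrier L" "y \<in> carrier L" "z \<in> carrier L"
  shows "z \<sqsubseteq> x \<sqinter> y \<longleftrightarrow> z \<sqsubseteq> x \<and> z \<sqsubseteq> y"
  using assms by (meson le_trans meet_closed meet_le meet_left meet_right)

lemma join_le_iff: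
  assumes "x \<in> carrier L" "y \<in> carrier L" "z \<in> carrier L"
  shows "x \<squnion> y \<sqsubseteq> z \<longleftrightarrow> x \<sqsubseteq> z \<and> y \<sqsubseteq> z"
  using assms by (meson le_trans join_closed join_le join_left join_right)

lemma meet_absorb_iff:
  assumes "x \<in> carrier L" "y \<in> carrier L"
  shows "x \<sqinter> y = x \<longleftrightarrow> x \<sqsubseteq> y"
  using assms le_iff_join by metis

lemma meet_mono:
  assumes "x \<in> carrier L" "y \<in> carrier L" "x' \<in> carrier L" "y' \<in> carrier L" "x \<sqsubseteq> x'" "y \<sqsubseteq> y'"
  shows "x \<sqinter> y \<sqsubseteq> x' \<sqinter> y'"
  using assms by (meson le_trans meet_closed meet_le meet_left meet_right)

lemma sup_insert:
  assumes "a \<in> carrier L" "A \<subseteq> carrier L"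
  shows "\<Squnion>(insert a A) = a \<squnion> \<Squnion>A"
  using weak_sup_insert[OF assms] unfolding eq_is_equal .

lemma top_meet_eq: "x \<in> carrier L \<Longrightarrow> \<top> \<sqinter> x = x"
  using top_meet unfolding eq_is_equal .

lemma meet_top_eq: "x \<in> carrier L \<Longrightarrow> x \<sqinter> \<top> = x"
  using top_meet_eq meet_comm by metis

lemma bottom_join_eq: "x \<in> carrier L \<Longrightarrow> \<bottom> \<squnion> x = x"
  using bottom_join unfolding eq_is_equal .

lemma join_bottom_eq: "x \<in> carrier L \<Longrightarrow> x \<squnion> \<bottom> = x"
  using bottom_join_eq join_comm by metis

lemma bottom_meet_eq: "x \<in> carrier L \<Longrightarrow> \<bottom> \<sqinter> x = \<bottom>"
  using bottom_meet unfolding eq_is_equal .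

lemma meet_bottom_eq: "x \<in> carrier L \<Longrightarrow> x \<sqinter> \<bottom> = \<bottom>"
  using bottom_meet_eq meet_comm by metis

lemma le_bottom_eq: "x \<in> carrier L \<Longrightarrow> x \<sqsubseteq> \<bottom> \<Longrightarrow> x = \<bottom>"
  by (meson bottom_closed bottom_lower le_antisym)

lemma meet_self: "x \<in> carrier L \<Longrightarrow> x \<sqinter> x = x"
  by (simp add: meet_absorb_iff)

end

context frame
begin

lemma meet_join_distrib:
  assumes "x \<in> carrier L" "y \<in> carrier L" "z \<in> carrier L"
  shows "x \<sqinter> (y \<squnion> z) = (x \<sqinter> y) \<squnion> (x \<sqinter> z)"
  using inf_Sup_distrib[of x "{y, z}"] assms by (simp add: join_def)

lemma join_meet_distrib2:
  assumes "x \<in> carrier L" "y \<in> carrier L" "z \<in> carrier L"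
  shows "(y \<squnion> z) \<sqinter> x = (y \<sqinter> x) \<squnion> (z \<sqinter> x)"
  using meet_join_distrib[OF assms] by (metis meet_comm)

lemma join_meet_distrib:
  assumes "x \<in> carrier L" "y \<in> carrier L" "z \<in> carrier L"
  shows "x \<squnion> (y \<sqinter> z) = (x \<squnion> y) \<sqinter> (x \<squnion> z)"
proof (rule le_antisym)
  show "x \<squnion> (y \<sqinter> z) \<sqsubseteq> (x \<squnion> y) \<sqinter> (x \<squnion> z)"
    using assms by (simp add: meet_le_iff join_le_iff join_left)
      (meson join_closed join_right le_trans meet_closed meet_left meet_right)
  have "(x \<squnion> y) \<sqinter> (x \<squnion> z) = (x \<sqinter> (x \<squnion> z)) \<squnion> (y \<sqinter> (x \<squnion> z))"
    using assms by (simp add: join_meet_distrib2)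
  also have "\<dots> = (x \<sqinter> (x \<squnion> z)) \<squnion> ((y \<sqinter> x) \<squnion> (y \<sqinter> z))"
    using assms by (simp add: meet_join_distrib[of y x z])
  also have "\<dots> \<sqsubseteq> x \<squnion> (y \<sqinter> z)"
    using assms by (simp add: join_le_iff join_right)
      (meson join_closed join_left le_trans meet_closed meet_left meet_right)
  finally show "(x \<squnion> y) \<sqinter> (x \<squnion> z) \<sqsubseteq> x \<squnion> (y \<sqinter> z)" .
qed (use assms in auto)

lemma Sup_inf_distrib:
  assumes "x \<in> carrier L" "A \<subseteq> carrier L"
  shows "(\<Squnion>A) \<sqinter> x = \<Squnion>((\<lambda>y. y \<sqinter> x) ` A)"
  using inf_Sup_distrib[OF assms] by (simp add: meet_comm)

end

text \<open>The other half of the distributive law holds in every complete lattice. Testing this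
  half against an arbitrary upper bound \<open>z\<close> avoids a description of the join on the
  right, which ideals and quotients do not offer directly.\<close>

lemma frameI:
  assumes "complete_lattice L"
    and "\<And>x A z. x \<in> carrier L \<Longrightarrow> A \<subseteq> carrier L \<Longrightarrow> z \<in> carrier L \<Longrightarrow>
      (\<And>a. a \<in> A \<Longrightarrow> le L (x \<sqinter>\<^bsub>L\<^esub> a) z) \<Longrightarrow> le L (x \<sqinter>\<^bsub>L\<^esub> \<Squnion>\<^bsub>L\<^esub>A) z"
  shows "frame L"
proof -
  interpret complete_lattice L by fact
  show ?thesis
  proof unfold_locales
    fix x A assume x: "x \<in> carrier L" and A: "A \<subseteq> carrier L"
    have img: "(\<lambda>y. x \<sqinter>\<^bsub>L\<^esub> y) ` A \<subseteq> carrier L" using x A by auto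
    show "x \<sqinter>\<^bsub>L\<^esub> \<Squnion>\<^bsub>L\<^esub>A = \<Squnion>\<^bsub>L\<^esub>((\<lambda>y. x \<sqinter>\<^bsub>L\<^esub> y) ` A)"
    proof (rule le_antisym)
      show "x \<sqinter>\<^bsub>L\<^esub> \<Squnion>\<^bsub>L\<^esub>A \<sqsubseteq>\<^bsub>L\<^esub> \<Squnion>\<^bsub>L\<^esub>((\<lambda>y. x \<sqinter>\<^bsub>L\<^esub> y) ` A)"
        using x A img by (intro assms(2)) (auto intro: sup_upper)
      show "\<Squnion>\<^bsub>L\<^esub>((\<lambda>y. x \<sqinter>\<^bsub>L\<^esub> y) ` A) \<sqsubseteq>\<^bsub>L\<^esub> x \<sqinter>\<^bsub>L\<^esub> \<Squnion>\<^bsub>L\<^esub>A"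
        using x A by (intro sup_least img) (auto intro!: meet_mono sup_upper)
    qed (use x A img in auto)
  qed
qed

lemma frame_imp_complete_lattice: "frame L \<Longrightarrow> complete_lattice L"
  by (rule frame.axioms)

lemma frame_mapI:
  assumes "\<And>x. x \<in> carrier L \<Longrightarrow> f x \<in> carrier M" "f \<top>\<^bsub>L\<^esub> = \<top>\<^bsub>M\<^esub>"
    "\<And>x y. x \<in> carrier L \<Longrightarrow> y \<in> carrier L \<Longrightarrow> f (x \<sqinter>\<^bsub>L\<^esub> y) = f x \<sqinter>\<^bsub>M\<^esub> f y"
    "\<And>A. A \<subseteq> carrier L \<Longrightarrow> f (\<Squnion>\<^bsub>L\<^esub>A) = \<Squnion>\<^bsub>M\<^esub>(f ` A)"
  shows "frame_map L M f"
  using assms by (auto simp: frame_map_def)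

lemma frame_map_closed: "frame_map L M f \<Longrightarrow> x \<in> carrier L \<Longrightarrow> f x \<in> carrier M"
  by (auto simp: frame_map_def)

lemma frame_map_top: "frame_map L M f \<Longrightarrow> f \<top>\<^bsub>L\<^esub> = \<top>\<^bsub>M\<^esub>"
  by (auto simp: frame_map_def)

lemma frame_map_meet:
  "frame_map L M f \<Longrightarrow> x \<in> carrier L \<Longrightarrow> y \<in> carrier L \<Longrightarrow> f (x \<sqinter>\<^bsub>L\<^esub> y) = f x \<sqinter>\<^bsub>M\<^esub> f y"
  by (auto simp: frame_map_def)

lemma frame_map_sup: "frame_map L M f \<Longrightarrow> A \<subseteq> carrier L \<Longrightarrow> f (\<Squnion>\<^bsub>L\<^esub>A) = \<Squnion>\<^bsub>M\<^esub>(f ` A)"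
  by (auto simp: frame_map_def)

lemma frame_map_join:
  "frame_map L M f \<Longrightarrow> x \<in> carrier L \<Longrightarrow> y \<in> carrier L \<Longrightarrow> f (x \<squnion>\<^bsub>L\<^esub> y) = f x \<squnion>\<^bsub>M\<^esub> f y"
  using frame_map_sup[of L M f "{x, y}"] by (simp add: join_def)

lemma frame_map_bottom:
  assumes "frame_map L M f" "complete_lattice L" "complete_lattice M"
  shows "f \<bottom>\<^bsub>L\<^esub> = \<bottom>\<^bsub>M\<^esub>"
  using frame_map_sup[OF assms(1), of "{}"] assms(2,3) by (simp add: complete_lattice.sup_empty)

lemma frame_map_mono:
  assumes f: "frame_map L M f" and L: "complete_lattice L" and M: "complete_lattice M"
    and x: "x \<in> carrier L" "y \<in> carrier L" "x \<sqsubseteq>\<^bsub>L\<^esub> y"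
  shows "f x \<sqsubseteq>\<^bsub>M\<^esub> f y"
  using frame_map_meet[OF f, of x y] x frame_map_closed[OF f]
  by (metis L M complete_lattice.meet_absorb_iff)

lemma frame_map_comp:
  assumes "frame_map L M f" "frame_map M N g"
  shows "frame_map L N (\<lambda>x. g (f x))"
proof (rule frame_mapI)
  fix A assume A: "A \<subseteq> carrier L"
  then have "f ` A \<subseteq> carrier M" using frame_map_closed[OF assms(1)] by auto
  then show "g (f (\<Squnion>\<^bsub>L\<^esub>A)) = \<Squnion>\<^bsub>N\<^esub>((\<lambda>x. g (f x)) ` A)"
    using frame_map_sup[OF assms(1) A] frame_map_sup[OF assms(2)] by (simp add: image_image)
qed (use assms in \<open>auto simp: frame_map_closed frame_map_top frame_map_meet\<close>)

text \<open>Needed because bipoints are extensional: a frame map may be altered off the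
  carrier.\<close>

lemma frame_map_cong:
  assumes "frame_map L M f" "complete_lattice L" "\<And>x. x \<in> carrier L \<Longrightarrow> f x = g x"
  shows "frame_map L M g"
proof -
  interpret complete_lattice L by fact
  show ?thesis
  proof (rule frame_mapI)
    fix A assume A: "A \<subseteq> carrier L"
    then have "g ` A = f ` A" using assms(3) by (intro image_cong) auto
    then show "g (\<Squnion>\<^bsub>L\<^esub>A) = \<Squnion>\<^bsub>M\<^esub>(g ` A)"
      using frame_map_sup[OF assms(1) A] assms(3)[of "\<Squnion>\<^bsub>L\<^esub>A"] A by simp
  qed (use assms(1) in \<open>auto simp: frame_map_closed frame_map_top frame_map_meet assms(3)[symmetric]\<close>)
qed

text \<open>The candidate sends \<open>z\<close> to \<open>h\<close> of a chosen preimage. The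
  kernel condition makes this independent of the choice, so each operation of \<open>Q\<close> can
  be computed on preimages in \<open>L\<close>. Allowing any surjection \<open>q\<close> lets it
  serve congruence quotients, the map from the coproduct to the main component, and the passage from
  elements to open sets.\<close>

lemma frame_map_factor:
  assumes q: "frame_map L Q q" and h: "frame_map L K h"
    and L: "complete_lattice L"
    and surj: "carrier Q \<subseteq> q ` carrier L"
    and ker: "\<And>x y. x \<in> carrier L \<Longrightarrow> y \<in> carrier L \<Longrightarrow> q x = q y \<Longrightarrow> h x = h y"
  obtains g where "frame_map Q K g" "\<And>x. x \<in> carrier L \<Longrightarrow> g (q x) = h x"
proof -
  interpret L: complete_lattice L by fact
  define s where "s = inv_into (carrier L) q"
  have s: "s z \<in> carrier L" "q (s z) = z" if "z \<in> carrier Q" for z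
    using that surj unfolding s_def by (meson inv_into_into f_inv_into_f subsetD)+
  have gq: "h (s (q x)) = h x" if "x \<in> carrier L" for x
    using that s[of "q x"] frame_map_closed[OF q] by (intro ker) auto
  have "frame_map Q K (\<lambda>z. h (s z))"
  proof (rule frame_mapI)
    show "h (s \<top>\<^bsub>Q\<^esub>) = \<top>\<^bsub>K\<^esub>"
      using gq[of "\<top>\<^bsub>L\<^esub>"] by (simp add: frame_map_top[OF q] frame_map_top[OF h])
    show "h (s (x \<sqinter>\<^bsub>Q\<^esub> y)) = h (s x) \<sqinter>\<^bsub>K\<^esub> h (s y)" if "x \<in> carrier Q" "y \<in> carrier Q" for x y
      using gq[of "s x \<sqinter>\<^bsub>L\<^esub> s y"] s[OF that(1)] s[OF that(2)]
      by (simp add: frame_map_meet[OF q] frame_map_meet[OF h])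
    show "h (s (\<Squnion>\<^bsub>Q\<^esub>A)) = \<Squnion>\<^bsub>K\<^esub>((\<lambda>z. h (s z)) ` A)" if "A \<subseteq> carrier Q" for A
    proof -
      have sA: "s ` A \<subseteq> carrier L" using that s by auto
      have "q ` s ` A = A" using that s by force
      then show ?thesis
        using gq[of "\<Squnion>\<^bsub>L\<^esub>(s ` A)"] sA
        by (simp add: frame_map_sup[OF q] frame_map_sup[OF h] image_image)
    qed
  qed (use s frame_map_closed[OF h] in auto)
  then show thesis using that gq by auto
qed

section \<open>Frames of sets and congruences\<close>

lemma carrier_inclusion_order [simp]: "carrier (inclusion_order S) = S"
  and le_inclusion_order [simp]: "le (inclusion_order S) = (\<subseteq>)"
  and eq_inclusion_order [simp]: "eq (inclusion_order S) = (=)"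
  by (simp_all add: inclusion_order_def)

lemma partial_order_inclusion_order: "partial_order (inclusion_order S)"
  by (rule partial_orderI) auto

text \<open>A closure system on \<open>U\<close>, where \<open>U\<close> itself stands for the empty
  intersection.\<close>

lemma complete_lattice_inclusion_order:
  assumes "U \<in> S" "S \<subseteq> Pow U" "\<And>A. A \<subseteq> S \<Longrightarrow> A \<noteq> {} \<Longrightarrow> \<Inter>A \<in> S"
  shows "complete_lattice (inclusion_order S)"
proof (rule complete_latticeI_inf[OF partial_order_inclusion_order])
  fix A assume A: "A \<subseteq> carrier (inclusion_order S)"
  show "\<exists>s\<in>carrier (inclusion_order S). (\<forall>a\<in>A. le (inclusion_order S) s a) \<and>
      (\<forall>y\<in>carrier (inclusion_order S). (\<forall>a\<in>A. le (inclusion_order S) y a) \<longrightarrow> le (inclusion_order S) y s)"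
  proof (cases "A = {}")
    case True then show ?thesis using assms(1,2) by auto
  next
    case False then show ?thesis using assms(3)[of A] A by (intro bexI[of _ "\<Inter>A"]) auto
  qed
qed

lemma meet_inclusion_order:
  "x \<in> S \<Longrightarrow> y \<in> S \<Longrightarrow> x \<inter> y \<in> S \<Longrightarrow> x \<sqinter>\<^bsub>inclusion_order S\<^esub> y = x \<inter> y"
  by (rule partial_order.meet_eqI[OF partial_order_inclusion_order]) auto

lemma join_inclusion_order:
  "x \<in> S \<Longrightarrow> y \<in> S \<Longrightarrow> x \<union> y \<in> S \<Longrightarrow> x \<squnion>\<^bsub>inclusion_order S\<^esub> y = x \<union> y"
  by (rule partial_order.join_eqI[OF partial_order_inclusion_order]) auto

lemma top_inclusion_order: "U \<in> S \<Longrightarrow> S \<subseteq> Pow U \<Longrightarrow> \<top>\<^bsub>inclusion_order S\<^esub> = U"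
  by (rule partial_order.top_eqI[OF partial_order_inclusion_order]) auto

lemma bottom_inclusion_order: "{} \<in> S \<Longrightarrow> \<bottom>\<^bsub>inclusion_order S\<^esub> = {}"
  by (rule partial_order.bottom_eqI[OF partial_order_inclusion_order]) auto

lemma sup_inclusion_order: "A \<subseteq> S \<Longrightarrow> \<Union>A \<in> S \<Longrightarrow> \<Squnion>\<^bsub>inclusion_order S\<^esub>A = \<Union>A"
  by (rule partial_order.sup_eqI[OF partial_order_inclusion_order]) auto

lemma frame_inclusion_order:
  assumes Un: "\<And>A. A \<subseteq> S \<Longrightarrow> \<Union>A \<in> S" and Int: "\<And>x y. x \<in> S \<Longrightarrow> y \<in> S \<Longrightarrow> x \<inter> y \<in> S"
  shows "frame (inclusion_order S)"
proof (rule frameI)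
  show "complete_lattice (inclusion_order S)"
  proof (rule complete_latticeI_sup[OF partial_order_inclusion_order])
    fix A assume "A \<subseteq> carrier (inclusion_order S)"
    then show "\<exists>s\<in>carrier (inclusion_order S). (\<forall>a\<in>A. le (inclusion_order S) a s) \<and>
      (\<forall>y\<in>carrier (inclusion_order S). (\<forall>a\<in>A. le (inclusion_order S) a y) \<longrightarrow> le (inclusion_order S) s y)"
      using Un[of A] by (intro bexI[of _ "\<Union>A"]) auto
  qed
  fix x A z assume a: "x \<in> carrier (inclusion_order S)" "A \<subseteq> carrier (inclusion_order S)"
    "\<And>a. a \<in> A \<Longrightarrow> le (inclusion_order S) (x \<sqinter>\<^bsub>inclusion_order S\<^esub> a) z"
  have "\<Union>A \<in> S" using Un a by auto
  moreover have "x \<inter> a \<subseteq> z" if "a \<in> A" for a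
    using a(3)[OF that] a(1,2) that Int[of x a] by (auto simp: meet_inclusion_order subset_iff)
  ultimately show "le (inclusion_order S) (x \<sqinter>\<^bsub>inclusion_order S\<^esub> \<Squnion>\<^bsub>inclusion_order S\<^esub>A) z"
    using a Int[of x "\<Union>A"] by (auto simp: meet_inclusion_order sup_inclusion_order)
qed

lemma carrier_opens_frame [simp]: "carrier (opens_frame T) = {U. openin T U}"
  and le_opens_frame [simp]: "le (opens_frame T) = (\<subseteq>)"
  by (simp_all add: opens_frame_def)

lemma frame_opens_frame: "frame (opens_frame T)"
  unfolding opens_frame_def by (rule frame_inclusion_order) auto

lemma opens_frame_simps:
  shows "openin T x \<Longrightarrow> openin T y \<Longrightarrow> x \<sqinter>\<^bsub>opens_frame T\<^esub> y = x \<inter> y"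
    and "openin T x \<Longrightarrow> openin T y \<Longrightarrow> x \<squnion>\<^bsub>opens_frame T\<^esub> y = x \<union> y"
    and "\<top>\<^bsub>opens_frame T\<^esub> = topspace T" and "\<bottom>\<^bsub>opens_frame T\<^esub> = {}"
    and "A \<subseteq> {U. openin T U} \<Longrightarrow> \<Squnion>\<^bsub>opens_frame T\<^esub>A = \<Union>A"
  unfolding opens_frame_def
  by (rule meet_inclusion_order join_inclusion_order sup_inclusion_order bottom_inclusion_order
      top_inclusion_order; auto dest: openin_subset)+

section \<open>The two-element frame\<close>

lemma carrier_two [simp]: "carrier two = UNIV" and le_two [simp]: "le two = (\<le>)"
  by (simp_all add: two_def)

lemma partial_order_two: "partial_order two"
  by (rule partial_orderI) (auto simp: two_def)

lemma two_simps [simp]: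
  shows "x \<sqinter>\<^bsub>two\<^esub> y \<longleftrightarrow> x \<and> y" and "x \<squnion>\<^bsub>two\<^esub> y \<longleftrightarrow> x \<or> y"
    and "\<top>\<^bsub>two\<^esub>" and "\<not> \<bottom>\<^bsub>two\<^esub>" and "\<Squnion>\<^bsub>two\<^esub>A \<longleftrightarrow> True \<in> A"
proof -
  interpret partial_order two by (rule partial_order_two)
  have "x \<sqinter>\<^bsub>two\<^esub> y = (x \<and> y)" by (rule meet_eqI) auto
  then show "x \<sqinter>\<^bsub>two\<^esub> y \<longleftrightarrow> x \<and> y" .
  have "x \<squnion>\<^bsub>two\<^esub> y = (x \<or> y)" by (rule join_eqI) auto
  then show "x \<squnion>\<^bsub>two\<^esub> y \<longleftrightarrow> x \<or> y" .
  have "\<top>\<^bsub>two\<^esub> = True" by (rule top_eqI) auto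
  then show "\<top>\<^bsub>two\<^esub>" by simp
  have "\<bottom>\<^bsub>two\<^esub> = False" by (rule bottom_eqI) auto
  then show "\<not> \<bottom>\<^bsub>two\<^esub>" by simp
  have "\<Squnion>\<^bsub>two\<^esub>A = (True \<in> A)" by (rule sup_eqI) (use True_or_False in \<open>fastforce simp: le_bool_def\<close>)+
  then show "\<Squnion>\<^bsub>two\<^esub>A \<longleftrightarrow> True \<in> A" .
qed

lemma frame_two: "frame two"
proof (rule frameI)
  show "complete_lattice two"
  proof (rule complete_latticeI_sup[OF partial_order_two])
    fix A :: "bool set"
    show "\<exists>s\<in>carrier two. (\<forall>a\<in>A. le two a s) \<and> (\<forall>y\<in>carrier two. (\<forall>a\<in>A. le two a y) \<longrightarrow> le two s y)"
      by (intro bexI[of _ "True \<in> A"]) (use True_or_False in \<open>fastforce simp: le_bool_def\<close>)+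
  qed
qed auto

lemma frame_map_two_iff:
  assumes "complete_lattice L"
  shows "frame_map L two h \<longleftrightarrow> h \<top>\<^bsub>L\<^esub> \<and>
    (\<forall>x\<in>carrier L. \<forall>y\<in>carrier L. h (x \<sqinter>\<^bsub>L\<^esub> y) \<longleftrightarrow> h x \<and> h y) \<and>
    (\<forall>A. A \<subseteq> carrier L \<longrightarrow> h (\<Squnion>\<^bsub>L\<^esub>A) = (\<exists>a\<in>A. h a))"
  by (auto simp: frame_map_def image_iff)

section \<open>Frame congruences and the quotient frame\<close>

locale frame_cong = frame L for L (structure) +
  fixes C
  assumes congr: "frame_congruence L C"
begin

lemma equiv: "equiv (carrier L) C"
  using congr by (simp add: frame_congruence_def)

lemma cong_closed: "(x, y) \<in> C \<Longrightarrow> x \<in> carrier L \<and> y \<in> carrier L"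
  using equiv by (auto simp: equiv_def refl_on_def)

lemma cong_refl: "x \<in> carrier L \<Longrightarrow> (x, x) \<in> C"
  using equiv by (auto simp: equiv_def refl_on_def)

lemma cong_sym: "(x, y) \<in> C \<Longrightarrow> (y, x) \<in> C"
  using equiv by (auto simp: equiv_def sym_def)

lemma cong_trans: "(x, y) \<in> C \<Longrightarrow> (y, z) \<in> C \<Longrightarrow> (x, z) \<in> C"
  using equiv unfolding equiv_def by (meson transE)

lemma cong_meet: "(x, x') \<in> C \<Longrightarrow> (y, y') \<in> C \<Longrightarrow> (x \<sqinter> y, x' \<sqinter> y') \<in> C"
  using congr unfolding frame_congruence_def by blast

lemma cong_sup:
  assumes "\<And>i. i \<in> I \<Longrightarrow> (f i, g i) \<in> C"
  shows "(\<Squnion>(f ` I), \<Squnion>(g ` I)) \<in> C"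
proof -
  let ?S = "(\<lambda>i. (f i, g i)) ` I"
  have "?S \<subseteq> C" using assms by auto
  then have "(\<Squnion>(fst ` ?S), \<Squnion>(snd ` ?S)) \<in> C"
    using congr unfolding frame_congruence_def by blast
  then show ?thesis by (simp add: image_image)
qed

abbreviation Q where "Q \<equiv> quotient_frame L C"
abbreviation q where "q \<equiv> \<lambda>x. C `` {x}"

lemma carrier_Q: "carrier Q = q ` carrier L"
  by (auto simp: quotient_frame_def quotient_def)

lemma q_closed: "x \<in> carrier L \<Longrightarrow> q x \<in> carrier Q"
  by (simp add: carrier_Q)

lemma q_eq_iff: "x \<in> carrier L \<Longrightarrow> y \<in> carrier L \<Longrightarrow> q x = q y \<longleftrightarrow> (x, y) \<in> C"
  using equiv by (simp add: eq_equiv_class_iff)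

text \<open>The order of the quotient asks for some representatives only; compatibility of
  \<open>C\<close> with meets carries the condition over to any others.\<close>

lemma q_le_iff:
  assumes "x \<in> carrier L" "y \<in> carrier L"
  shows "q x \<sqsubseteq>\<^bsub>Q\<^esub> q y \<longleftrightarrow> (x \<sqinter> y, x) \<in> C"
proof
  assume "q x \<sqsubseteq>\<^bsub>Q\<^esub> q y"
  then obtain x' y' where "(x, x') \<in> C" "(y, y') \<in> C" "(x' \<sqinter> y', x') \<in> C"
    by (auto simp: quotient_frame_def)
  then show "(x \<sqinter> y, x) \<in> C"
    by (meson cong_meet cong_trans cong_sym)
next
  assume "(x \<sqinter> y, x) \<in> C"
  moreover have "x \<in> q x" "y \<in> q y" using assms cong_refl by auto
  ultimately show "q x \<sqsubseteq>\<^bsub>Q\<^esub> q y" unfolding quotient_frame_def by auto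
qed

lemma q_mono: "x \<in> carrier L \<Longrightarrow> y \<in> carrier L \<Longrightarrow> x \<sqsubseteq> y \<Longrightarrow> q x \<sqsubseteq>\<^bsub>Q\<^esub> q y"
  using meet_absorb_iff[of x y] by (simp add: q_le_iff cong_refl)

lemma partial_order_Q: "partial_order Q"
proof (rule partial_orderI)
  show "eq Q = (=)" by (simp add: quotient_frame_def)
next
  fix X assume "X \<in> carrier Q"
  then show "X \<sqsubseteq>\<^bsub>Q\<^esub> X" by (auto simp: carrier_Q q_mono)
next
  fix X Y assume "X \<in> carrier Q" "Y \<in> carrier Q" "X \<sqsubseteq>\<^bsub>Q\<^esub> Y" "Y \<sqsubseteq>\<^bsub>Q\<^esub> X"
  then obtain x y where xy: "x \<in> carrier L" "y \<in> carrier L" "X = q x" "Y = q y"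
    "(x \<sqinter> y, x) \<in> C" "(y \<sqinter> x, y) \<in> C"
    by (auto simp: carrier_Q q_le_iff)
  then have "(x, y) \<in> C" using meet_comm[of L x y] cong_sym cong_trans by metis
  then show "X = Y" using xy by (simp add: q_eq_iff)
next
  fix X Y Z assume "X \<in> carrier Q" "Y \<in> carrier Q" "Z \<in> carrier Q" "X \<sqsubseteq>\<^bsub>Q\<^esub> Y" "Y \<sqsubseteq>\<^bsub>Q\<^esub> Z"
  then obtain x y z where xyz: "x \<in> carrier L" "y \<in> carrier L" "z \<in> carrier L"
    "X = q x" "Y = q y" "Z = q z" "(x \<sqinter> y, x) \<in> C" "(y \<sqinter> z, y) \<in> C"
    by (auto simp: carrier_Q q_le_iff)
  have "(x \<sqinter> z, (x \<sqinter> y) \<sqinter> z) \<in> C"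
    using xyz by (intro cong_meet cong_refl cong_sym[OF xyz(7)])
  moreover have "(x \<sqinter> y \<sqinter> z, x \<sqinter> y) \<in> C"
    using cong_meet[OF cong_refl[OF xyz(1)] xyz(8)] xyz by (simp add: meet_assoc)
  ultimately have "(x \<sqinter> z, x) \<in> C" using xyz(7) cong_trans by blast
  then show "X \<sqsubseteq>\<^bsub>Q\<^esub> Z" using xyz by (simp add: q_le_iff)
qed

text \<open>Each \<open>a\<close> in \<open>A\<close> is congruent to \<open>a \<sqinter> z\<close>.
  Joining these congruences and pulling \<open>z\<close> out by distributivity makes the join of
  \<open>A\<close> congruent to its meet with \<open>z\<close>. This is where the quotient needs
  \<open>L\<close> to be a frame.\<close>

lemma q_sup_least:
  assumes "A \<subseteq> carrier L" "z \<in> carrier L" "\<And>a. a \<in> A \<Longrightarrow> q a \<sqsubseteq>\<^bsub>Q\<^esub> q z"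
  shows "q (\<Squnion>A) \<sqsubseteq>\<^bsub>Q\<^esub> q z"
proof -
  have "(\<Squnion>((\<lambda>a. a \<sqinter> z) ` A), \<Squnion>((\<lambda>a. a) ` A)) \<in> C"
    using assms by (intro cong_sup) (auto simp: q_le_iff subset_iff)
  then show ?thesis
    using assms by (simp add: q_le_iff Sup_inf_distrib)
qed

lemma q_sup_upper: "A \<subseteq> carrier L \<Longrightarrow> a \<in> A \<Longrightarrow> q a \<sqsubseteq>\<^bsub>Q\<^esub> q (\<Squnion>A)"
  by (rule q_mono) (auto intro: sup_upper)

lemma subset_Q_obtain:
  assumes "B \<subseteq> carrier Q"
  obtains A where "A \<subseteq> carrier L" "B = q ` A"
  using assms unfolding carrier_Q by (metis subset_imageE)

lemma complete_lattice_Q: "complete_lattice Q"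
proof (rule complete_latticeI_sup[OF partial_order_Q])
  fix B assume "B \<subseteq> carrier Q"
  then obtain A where A: "A \<subseteq> carrier L" "B = q ` A" by (rule subset_Q_obtain)
  then show "\<exists>s\<in>carrier Q. (\<forall>a\<in>B. a \<sqsubseteq>\<^bsub>Q\<^esub> s) \<and> (\<forall>y\<in>carrier Q. (\<forall>a\<in>B. a \<sqsubseteq>\<^bsub>Q\<^esub> y) \<longrightarrow> s \<sqsubseteq>\<^bsub>Q\<^esub> y)"
    by (intro bexI[of _ "q (\<Squnion>A)"] conjI ballI impI)
      (auto simp: carrier_Q intro!: q_sup_upper q_sup_least)
qed

lemma q_sup:
  assumes "A \<subseteq> carrier L"
  shows "\<Squnion>\<^bsub>Q\<^esub>(q ` A) = q (\<Squnion>A)"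
  by (rule partial_order.sup_eqI[OF partial_order_Q])
    (use assms in \<open>auto simp: carrier_Q intro!: q_sup_upper q_sup_least\<close>)

lemma q_meet:
  assumes "x \<in> carrier L" "y \<in> carrier L"
  shows "q x \<sqinter>\<^bsub>Q\<^esub> q y = q (x \<sqinter> y)"
proof (rule partial_order.meet_eqI[OF partial_order_Q])
  fix W assume "W \<in> carrier Q" "W \<sqsubseteq>\<^bsub>Q\<^esub> q x" "W \<sqsubseteq>\<^bsub>Q\<^esub> q y"
  then obtain w where w: "w \<in> carrier L" "W = q w" "(w \<sqinter> x, w) \<in> C" "(w \<sqinter> y, w) \<in> C"
    using assms by (auto simp: carrier_Q q_le_iff)
  have "(w \<sqinter> x \<sqinter> y, w \<sqinter> y) \<in> C" using w assms by (intro cong_meet cong_refl)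
  then have "(w \<sqinter> (x \<sqinter> y), w) \<in> C" using w assms by (metis cong_trans meet_assoc)
  then show "W \<sqsubseteq>\<^bsub>Q\<^esub> q (x \<sqinter> y)" using w assms by (simp add: q_le_iff)
qed (use assms in \<open>auto simp: q_closed intro!: q_mono meet_left meet_right\<close>)

lemma q_top: "\<top>\<^bsub>Q\<^esub> = q \<top>"
  by (rule partial_order.top_eqI[OF partial_order_Q]) (auto simp: carrier_Q intro!: q_mono)

lemma frame_Q: "frame Q"
proof (rule frameI[OF complete_lattice_Q])
  fix X B Z assume "X \<in> carrier Q" "B \<subseteq> carrier Q" "Z \<in> carrier Q"
    and le: "\<And>a. a \<in> B \<Longrightarrow> X \<sqinter>\<^bsub>Q\<^esub> a \<sqsubseteq>\<^bsub>Q\<^esub> Z"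
  moreover from this obtain A where "A \<subseteq> carrier L" "B = q ` A" using subset_Q_obtain by metis
  ultimately obtain x z where A: "A \<subseteq> carrier L" "B = q ` A" "x \<in> carrier L" "X = q x" "z \<in> carrier L" "Z = q z"
    by (auto simp: carrier_Q)
  have le': "q x \<sqinter>\<^bsub>Q\<^esub> q a \<sqsubseteq>\<^bsub>Q\<^esub> q z" if "a \<in> A" for a using le[of "q a"] A that by auto
  have "q (\<Squnion>((\<lambda>a. x \<sqinter> a) ` A)) \<sqsubseteq>\<^bsub>Q\<^esub> q z"
    using A le' by (intro q_sup_least) (auto simp: q_meet subset_iff)
  then show "X \<sqinter>\<^bsub>Q\<^esub> \<Squnion>\<^bsub>Q\<^esub>B \<sqsubseteq>\<^bsub>Q\<^esub> Z"
    using A by (simp add: q_sup q_meet inf_Sup_distrib)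
qed

lemma frame_map_q: "frame_map L Q q"
  by (rule frame_mapI) (simp_all add: q_closed q_top q_meet q_sup)

end

section \<open>Kernels, inequalities modulo a congruence, generated congruences\<close>

definition kernel_cong :: "'a gorder \<Rightarrow> ('a \<Rightarrow> 'b) \<Rightarrow> ('a \<times> 'a) set" where
  "kernel_cong L h = {(x, y) \<in> carrier L \<times> carrier L. h x = h y}"

lemma frame_congruence_kernel:
  assumes h: "frame_map L K h" and L: "complete_lattice L"
  shows "frame_congruence L (kernel_cong L h)"
proof -
  interpret complete_lattice L by fact
  show ?thesis
    unfolding frame_congruence_def
  proof (intro conjI allI impI)
    show "equiv (carrier L) (kernel_cong L h)"
      by (auto simp: kernel_cong_def equiv_def refl_on_def sym_def trans_def)
    show "\<forall>(x, x')\<in>kernel_cong L h. \<forall>(y, y')\<in>kernel_cong L h.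
       (x \<sqinter>\<^bsub>L\<^esub> y, x' \<sqinter>\<^bsub>L\<^esub> y') \<in> kernel_cong L h"
      by (auto simp: kernel_cong_def frame_map_meet[OF h])
    fix S assume S: "S \<subseteq> kernel_cong L h"
    then have c: "fst ` S \<subseteq> carrier L" "snd ` S \<subseteq> carrier L" by (auto simp: kernel_cong_def)
    have "h ` fst ` S = h ` snd ` S"
      unfolding image_image using S by (intro image_cong) (auto simp: kernel_cong_def)
    then show "(\<Squnion>\<^bsub>L\<^esub>(fst ` S), \<Squnion>\<^bsub>L\<^esub>(snd ` S)) \<in> kernel_cong L h"
      using c by (auto simp: kernel_cong_def frame_map_sup[OF h])
  qed
qed

text \<open>Relations are read as sets of inequalities, so congruences are compared through the
  order of their quotients rather than through congruent pairs.\<close>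

abbreviation cle :: "'a gorder \<Rightarrow> ('a \<times> 'a) set \<Rightarrow> 'a \<Rightarrow> 'a \<Rightarrow> bool" where
  "cle L C a b \<equiv> C `` {a} \<sqsubseteq>\<^bsub>quotient_frame L C\<^esub> C `` {b}"

lemma frame_congI: "frame L \<Longrightarrow> frame_congruence L C \<Longrightarrow> frame_cong L C"
  by (simp add: frame_cong_def frame_cong_axioms_def)

lemma cle_kernel_iff:
  assumes h: "frame_map L K h" and L: "frame L" and K: "complete_lattice K"
    and ab: "a \<in> carrier L" "b \<in> carrier L"
  shows "cle L (kernel_cong L h) a b \<longleftrightarrow> h a \<sqsubseteq>\<^bsub>K\<^esub> h b"
proof -
  interpret frame_cong L "kernel_cong L h"
    by (intro frame_congI L frame_congruence_kernel[OF h] frame_imp_complete_lattice[OF L])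
  interpret K: complete_lattice K by fact
  show ?thesis
    unfolding q_le_iff[OF ab] using ab frame_map_closed[OF h]
    by (simp add: kernel_cong_def frame_map_meet[OF h] K.meet_absorb_iff)
qed

lemma cong_iff_cle:
  assumes "frame_cong L C" "x \<in> carrier L" "y \<in> carrier L"
  shows "(x, y) \<in> C \<longleftrightarrow> cle L C x y \<and> cle L C y x"
proof -
  interpret frame_cong L C by fact
  interpret Q: frame Q by (rule frame_Q)
  show ?thesis using assms(2,3) q_eq_iff[of x y] q_closed by (metis Q.le_antisym Q.le_refl)
qed

text \<open>A congruent pair is an inequality in both directions, so a congruence is recovered from
  the order of its quotient.\<close>

lemma cong_subset_iff:
  assumes "frame_cong L C" "frame_cong L D"
  shows "C \<subseteq> D \<longleftrightarrow> (\<forall>x\<in>carrier L. \<forall>y\<in>carrier L. cle L C x y \<longrightarrow> cle L D x y)"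
proof -
  interpret C: frame_cong L C by fact
  interpret D: frame_cong L D by fact
  show ?thesis
  proof
    assume "C \<subseteq> D"
    then show "\<forall>x\<in>carrier L. \<forall>y\<in>carrier L. cle L C x y \<longrightarrow> cle L D x y"
      by (auto simp: C.q_le_iff D.q_le_iff)
  next
    assume r: "\<forall>x\<in>carrier L. \<forall>y\<in>carrier L. cle L C x y \<longrightarrow> cle L D x y"
    show "C \<subseteq> D"
    proof clarify
      fix x y assume "(x, y) \<in> C"
      then show "(x, y) \<in> D"
        using C.cong_closed[of x y] r cong_iff_cle[OF assms(1)] cong_iff_cle[OF assms(2)] by blast
    qed
  qed
qed

lemma quotient_factor:
  assumes C: "frame_cong L C" and h: "frame_map L K h" and sub: "C \<subseteq> kernel_cong L h"
  obtains g where "frame_map (quotient_frame L C) K g" "\<And>x. x \<in> carrier L \<Longrightarrow> g (C `` {x}) = h x"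
proof -
  interpret frame_cong L C by fact
  show thesis
  proof (rule frame_map_factor[OF frame_map_q h])
    show "h x = h y" if "x \<in> carrier L" "y \<in> carrier L" "q x = q y" for x y
      using that sub by (auto simp: q_eq_iff kernel_cong_def)
  qed (auto simp: carrier_Q intro: that complete_lattice_axioms)
qed

lemma frame_congruence_INT:
  assumes "complete_lattice L" "F \<noteq> {}" "\<And>C. C \<in> F \<Longrightarrow> frame_congruence L C"
  shows "frame_congruence L (\<Inter>F)"
  unfolding frame_congruence_def
proof (intro conjI allI impI)
  have e: "equiv (carrier L) C" if "C \<in> F" for C
    using assms(3)[OF that] by (simp add: frame_congruence_def)
  show "equiv (carrier L) (\<Inter>F)"
  proof (rule equivI)
    show "refl_on (carrier L) (\<Inter>F)"
      using e assms(2) unfolding equiv_def refl_on_def by blast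
    show "\<Inter>F \<subseteq> carrier L \<times> carrier L"
      using e assms(2) unfolding equiv_def by blast
    show "sym (\<Inter>F)" using e unfolding equiv_def sym_def by blast
    show "trans (\<Inter>F)" using e unfolding equiv_def trans_def by blast
  qed
  show "\<forall>(x, x')\<in>\<Inter>F. \<forall>(y, y')\<in>\<Inter>F. (x \<sqinter>\<^bsub>L\<^esub> y, x' \<sqinter>\<^bsub>L\<^esub> y') \<in> \<Inter>F"
    using assms(3) unfolding frame_congruence_def by blast
  show "(\<Squnion>\<^bsub>L\<^esub>(fst ` S), \<Squnion>\<^bsub>L\<^esub>(snd ` S)) \<in> \<Inter>F" if "S \<subseteq> \<Inter>F" for S
    using assms(3) that unfolding frame_congruence_def by blast
qed

lemma frame_congruence_full:
  assumes "complete_lattice L"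
  shows "frame_congruence L (carrier L \<times> carrier L)"
proof -
  interpret complete_lattice L by fact
  have "(\<Squnion>\<^bsub>L\<^esub>(fst ` S), \<Squnion>\<^bsub>L\<^esub>(snd ` S)) \<in> carrier L \<times> carrier L" if "S \<subseteq> carrier L \<times> carrier L" for S
    using that by (auto intro!: sup_closed)
  then show ?thesis
    by (auto simp: frame_congruence_def equiv_def refl_on_def sym_def trans_def)
qed

text \<open>The inequality of \<open>a\<close> and \<open>b\<close> modulo \<open>C\<close> is the
  single membership of \<open>(a \<sqinter> b, a)\<close> in \<open>C\<close>, and such a condition
  survives intersections of congruences. Hence the intersection that defines the generated
  congruence satisfies \<open>R\<close> itself.\<close>

lemma generated_congruence:
  assumes L: "frame L" and R: "R \<subseteq> carrier L \<times> carrier L"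
  shows "frame_cong L (generated_congruence L R)"
    and "\<And>a b. (a, b) \<in> R \<Longrightarrow> cle L (generated_congruence L R) a b"
proof -
  let ?F = "{C. frame_congruence L C \<and> (\<forall>(a, b)\<in>R. cle L C a b)}"
  interpret frame L by fact
  interpret full: frame_cong L "carrier L \<times> carrier L"
    by (intro frame_congI L frame_congruence_full complete_lattice_axioms)
  \<comment> \<open>The family is nonempty: the full congruence has a trivial quotient, in which
    every inequality holds.\<close>
  have "carrier L \<times> carrier L \<in> ?F"
    using R full.congr by (auto simp: full.q_le_iff)
  then have "frame_congruence L (\<Inter>?F)"
    by (intro frame_congruence_INT) (auto intro: complete_lattice_axioms)
  then show *: "frame_cong L (generated_congruence L R)"
    unfolding generated_congruence_def by (intro frame_congI L)
  then interpret g: frame_cong L "generated_congruence L R" .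
  fix a b assume ab: "(a, b) \<in> R"
  then have abc: "a \<in> carrier L" "b \<in> carrier L" using R by auto
  have "(a \<sqinter>\<^bsub>L\<^esub> b, a) \<in> C" if "C \<in> ?F" for C
  proof -
    interpret frame_cong L C using that L by (auto intro: frame_congI)
    show ?thesis using that ab q_le_iff[OF abc] by auto
  qed
  then have "(a \<sqinter>\<^bsub>L\<^esub> b, a) \<in> generated_congruence L R"
    unfolding generated_congruence_def by blast
  then show "cle L (generated_congruence L R) a b"
    using abc by (simp add: g.q_le_iff)
qed

lemma generated_congruence_least:
  assumes "frame_congruence L C" "\<And>a b. (a, b) \<in> R \<Longrightarrow> cle L C a b"
  shows "generated_congruence L R \<subseteq> C"
  unfolding generated_congruence_def using assms by blast

lemma generated_congruence_kernel:
  assumes h: "frame_map L K h" and L: "frame L" and K: "complete_lattice K"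
    and R: "R \<subseteq> carrier L \<times> carrier L" "\<And>a b. (a, b) \<in> R \<Longrightarrow> h a \<sqsubseteq>\<^bsub>K\<^esub> h b"
  shows "generated_congruence L R \<subseteq> kernel_cong L h"
proof (rule generated_congruence_least)
  show "frame_congruence L (kernel_cong L h)"
    by (intro frame_congruence_kernel[OF h] frame_imp_complete_lattice[OF L])
  show "cle L (kernel_cong L h) a b" if "(a, b) \<in> R" for a b
    using that R cle_kernel_iff[OF h L K, of a b] by auto
qed

section \<open>Coproducts of frames\<close>

context complete_lattice
begin

lemma join_left_comm:
  assumes "x \<in> carrier L" "y \<in> carrier L" "z \<in> carrier L"
  shows "x \<squnion> (y \<squnion> z) = y \<squnion> (x \<squnion> z)"
  using assms by (metis join_assoc join_comm)

lemma meet_left_comm: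
  assumes "x \<in> carrier L" "y \<in> carrier L" "z \<in> carrier L"
  shows "x \<sqinter> (y \<sqinter> z) = y \<sqinter> (x \<sqinter> z)"
  using assms by (metis meet_assoc meet_comm)

end

context frame_cong
begin

lemma cle_trans:
  assumes "x \<in> carrier L" "y \<in> carrier L" "z \<in> carrier L"
    "q x \<sqsubseteq>\<^bsub>Q\<^esub> q y" "q y \<sqsubseteq>\<^bsub>Q\<^esub> q z"
  shows "q x \<sqsubseteq>\<^bsub>Q\<^esub> q z"
proof -
  interpret Q: partial_order Q by (rule partial_order_Q)
  show ?thesis by (rule Q.le_trans[OF assms(4,5)]) (use assms in \<open>auto intro: q_closed\<close>)
qed

lemma cle_meet_iff:
  assumes "x \<in> carrier L" "y \<in> carrier L" "z \<in> carrier L"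
  shows "q z \<sqsubseteq>\<^bsub>Q\<^esub> q (x \<sqinter> y) \<longleftrightarrow> q z \<sqsubseteq>\<^bsub>Q\<^esub> q x \<and> q z \<sqsubseteq>\<^bsub>Q\<^esub> q y"
proof -
  interpret Q: frame Q by (rule frame_Q)
  show ?thesis using assms Q.meet_le_iff[of "q x" "q y" "q z"] by (simp add: q_meet q_closed)
qed

lemma cle_sup_iff:
  assumes "A \<subseteq> carrier L" "z \<in> carrier L"
  shows "q (\<Squnion>A) \<sqsubseteq>\<^bsub>Q\<^esub> q z \<longleftrightarrow> (\<forall>a\<in>A. q a \<sqsubseteq>\<^bsub>Q\<^esub> q z)"
proof
  assume *: "q (\<Squnion>A) \<sqsubseteq>\<^bsub>Q\<^esub> q z"
  show "\<forall>a\<in>A. q a \<sqsubseteq>\<^bsub>Q\<^esub> q z"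
  proof
    fix a assume a: "a \<in> A"
    then have "a \<in> carrier L" using assms by auto
    then show "q a \<sqsubseteq>\<^bsub>Q\<^esub> q z"
      using cle_trans[OF _ _ assms(2) q_sup_upper[OF assms(1) a] *] assms by simp
  qed
qed (use assms in \<open>auto intro: q_sup_least\<close>)

end

section \<open>The coproduct as a frame of ideals of pairs\<close>

locale frame_pair = P: frame P + N: frame N for P :: "'p gorder" and N :: "'n gorder"
begin

abbreviation PN where "PN \<equiv> coprod P N"
abbreviation inl where "inl \<equiv> coprod_inl P N"
abbreviation inr where "inr \<equiv> coprod_inr P N"

lemma coprod_ideal_full: "coprod_ideal P N (carrier P \<times> carrier N)"
  by (auto simp: coprod_ideal_def)

lemma coprod_ideal_INT:
  assumes "F \<noteq> {}" "\<And>D. D \<in> F \<Longrightarrow> coprod_ideal P N D"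
  shows "coprod_ideal P N (\<Inter>F)"
  unfolding coprod_ideal_def
proof (intro conjI allI impI)
  show "\<Inter>F \<subseteq> carrier P \<times> carrier N"
  proof -
    obtain D where "D \<in> F" using assms(1) by blast
    moreover from this have "D \<subseteq> carrier P \<times> carrier N" using assms(2) by (simp add: coprod_ideal_def)
    ultimately show ?thesis by blast
  qed
  show "\<forall>(a, b)\<in>\<Inter>F. \<forall>a'\<in>carrier P. \<forall>b'\<in>carrier N.
       a' \<sqsubseteq>\<^bsub>P\<^esub> a \<longrightarrow> b' \<sqsubseteq>\<^bsub>N\<^esub> b \<longrightarrow> (a', b') \<in> \<Inter>F"
  proof clarify
    fix a b a' b' D
    assume ab: "(a, b) \<in> \<Inter>F" "D \<in> F" and le: "a' \<in> carrier P" "b' \<in> carrier N" "a' \<sqsubseteq>\<^bsub>P\<^esub> a" "b' \<sqsubseteq>\<^bsub>N\<^esub> b"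
    have "\<forall>(a, b)\<in>D. \<forall>a'\<in>carrier P. \<forall>b'\<in>carrier N. a' \<sqsubseteq>\<^bsub>P\<^esub> a \<longrightarrow> b' \<sqsubseteq>\<^bsub>N\<^esub> b \<longrightarrow> (a', b') \<in> D"
      using assms(2)[OF ab(2)] by (simp add: coprod_ideal_def)
    moreover have "(a, b) \<in> D" using ab by simp
    ultimately show "(a', b') \<in> D" using le by fast
  qed
  show "(\<Squnion>\<^bsub>P\<^esub>A, b) \<in> \<Inter>F" if "A \<subseteq> carrier P" "b \<in> carrier N" "A \<times> {b} \<subseteq> \<Inter>F" for A b
  proof
    fix D assume "D \<in> F"
    then have "A \<times> {b} \<subseteq> D" using that by blast
    then show "(\<Squnion>\<^bsub>P\<^esub>A, b) \<in> D" using assms(2)[OF \<open>D \<in> F\<close>] that unfolding coprod_ideal_def by blast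
  qed
  show "(a, \<Squnion>\<^bsub>N\<^esub>B) \<in> \<Inter>F" if "a \<in> carrier P" "B \<subseteq> carrier N" "{a} \<times> B \<subseteq> \<Inter>F" for a B
  proof
    fix D assume "D \<in> F"
    then have "{a} \<times> B \<subseteq> D" using that by blast
    then show "(a, \<Squnion>\<^bsub>N\<^esub>B) \<in> D" using assms(2)[OF \<open>D \<in> F\<close>] that unfolding coprod_ideal_def by blast
  qed
qed

lemma carrier_coprod: "carrier PN = {D. coprod_ideal P N D}"
  and le_coprod: "le PN = (\<subseteq>)"
  by (simp_all add: coprod_def)

lemma complete_lattice_coprod: "complete_lattice PN"
  unfolding coprod_def
proof (rule complete_lattice_inclusion_order)
  show "carrier P \<times> carrier N \<in> {D. coprod_ideal P N D}" using coprod_ideal_full by simp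
  show "{D. coprod_ideal P N D} \<subseteq> Pow (carrier P \<times> carrier N)" by (auto simp: coprod_ideal_def)
qed (use coprod_ideal_INT in auto)

sublocale PN: complete_lattice PN by (rule complete_lattice_coprod)

lemma coprod_meet:
  assumes "D \<in> carrier PN" "E \<in> carrier PN"
  shows "D \<sqinter>\<^bsub>PN\<^esub> E = D \<inter> E"
  using assms coprod_ideal_INT[of "{D, E}"] unfolding carrier_coprod
  unfolding coprod_def by (intro meet_inclusion_order) auto

lemma coprod_top: "\<top>\<^bsub>PN\<^esub> = carrier P \<times> carrier N"
  unfolding coprod_def
  by (rule top_inclusion_order) (auto simp: coprod_ideal_full, auto simp: coprod_ideal_def)

lemma coprod_subset: "D \<in> carrier PN \<Longrightarrow> D \<subseteq> carrier P \<times> carrier N"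
  by (auto simp: carrier_coprod coprod_ideal_def)

lemma coprod_down:
  assumes "D \<in> carrier PN" "(a, b) \<in> D" "a' \<in> carrier P" "b' \<in> carrier N" "a' \<sqsubseteq>\<^bsub>P\<^esub> a" "b' \<sqsubseteq>\<^bsub>N\<^esub> b"
  shows "(a', b') \<in> D"
proof -
  have "\<forall>(a, b)\<in>D. \<forall>a'\<in>carrier P. \<forall>b'\<in>carrier N. a' \<sqsubseteq>\<^bsub>P\<^esub> a \<longrightarrow> b' \<sqsubseteq>\<^bsub>N\<^esub> b \<longrightarrow> (a', b') \<in> D"
    using assms(1) by (simp add: carrier_coprod coprod_ideal_def)
  from bspec[OF this assms(2)] show ?thesis using assms by simp
qed

lemma coprod_supl:
  assumes "D \<in> carrier PN" "A \<subseteq> carrier P" "b \<in> carrier N" "\<And>a. a \<in> A \<Longrightarrow> (a, b) \<in> D"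
  shows "(\<Squnion>\<^bsub>P\<^esub>A, b) \<in> D"
proof -
  have "A \<times> {b} \<subseteq> D" using assms by auto
  then show ?thesis using assms unfolding carrier_coprod coprod_ideal_def by blast
qed

lemma coprod_supr:
  assumes "D \<in> carrier PN" "a \<in> carrier P" "B \<subseteq> carrier N" "\<And>b. b \<in> B \<Longrightarrow> (a, b) \<in> D"
  shows "(a, \<Squnion>\<^bsub>N\<^esub>B) \<in> D"
proof -
  have "{a} \<times> B \<subseteq> D" using assms by auto
  then show ?thesis using assms unfolding carrier_coprod coprod_ideal_def by blast
qed

lemma coprod_botl: "D \<in> carrier PN \<Longrightarrow> b \<in> carrier N \<Longrightarrow> (\<bottom>\<^bsub>P\<^esub>, b) \<in> D"
  using coprod_supl[of D "{}" b] by (simp add: P.sup_empty)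

lemma coprod_botr: "D \<in> carrier PN \<Longrightarrow> a \<in> carrier P \<Longrightarrow> (a, \<bottom>\<^bsub>N\<^esub>) \<in> D"
  using coprod_supr[of D a "{}"] by (simp add: N.sup_empty)

lemma coprod_idealI:
  assumes "D \<subseteq> carrier P \<times> carrier N"
    and "\<And>a b a' b'. (a, b) \<in> D \<Longrightarrow> a' \<in> carrier P \<Longrightarrow> b' \<in> carrier N \<Longrightarrow>
      a' \<sqsubseteq>\<^bsub>P\<^esub> a \<Longrightarrow> b' \<sqsubseteq>\<^bsub>N\<^esub> b \<Longrightarrow> (a', b') \<in> D"
    and "\<And>A b. A \<subseteq> carrier P \<Longrightarrow> b \<in> carrier N \<Longrightarrow> (\<And>a. a \<in> A \<Longrightarrow> (a, b) \<in> D) \<Longrightarrow> (\<Squnion>\<^bsub>P\<^esub>A, b) \<in> D"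
    and "\<And>a B. a \<in> carrier P \<Longrightarrow> B \<subseteq> carrier N \<Longrightarrow> (\<And>b. b \<in> B \<Longrightarrow> (a, b) \<in> D) \<Longrightarrow> (a, \<Squnion>\<^bsub>N\<^esub>B) \<in> D"
  shows "D \<in> carrier PN"
  unfolding carrier_coprod mem_Collect_eq coprod_ideal_def
proof (intro conjI allI impI)
  show "\<forall>(a, b)\<in>D. \<forall>a'\<in>carrier P. \<forall>b'\<in>carrier N. a' \<sqsubseteq>\<^bsub>P\<^esub> a \<longrightarrow> b' \<sqsubseteq>\<^bsub>N\<^esub> b \<longrightarrow> (a', b') \<in> D"
    using assms(2) by blast
  show "(\<Squnion>\<^bsub>P\<^esub>A, b) \<in> D" if "A \<subseteq> carrier P" "b \<in> carrier N" "A \<times> {b} \<subseteq> D" for A b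
    using that by (intro assms(3)) auto
  show "(a, \<Squnion>\<^bsub>N\<^esub>B) \<in> D" if "a \<in> carrier P" "B \<subseteq> carrier N" "{a} \<times> B \<subseteq> D" for a B
    using that by (intro assms(4)) auto
qed (fact assms(1))

lemma frame_coprod: "frame PN"
proof (rule frameI[OF complete_lattice_coprod])
  fix D \<D> F assume D: "D \<in> carrier PN" and \<D>: "\<D> \<subseteq> carrier PN" and F: "F \<in> carrier PN"
    and le: "\<And>E. E \<in> \<D> \<Longrightarrow> D \<sqinter>\<^bsub>PN\<^esub> E \<sqsubseteq>\<^bsub>PN\<^esub> F"
  \<comment> \<open>\<open>H\<close> is the Heyting implication from \<open>D\<close> to
    \<open>F\<close>, computed on pairs. Once \<open>H\<close> is known to be an ideal, every
    \<open>E\<close> in the family lies below it and so does their join, although joins of ideals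
    have no explicit formula.\<close>
  define H where "H = {(a, b) \<in> carrier P \<times> carrier N. \<forall>(c, d)\<in>D. (a \<sqinter>\<^bsub>P\<^esub> c, b \<sqinter>\<^bsub>N\<^esub> d) \<in> F}"
  note cd = coprod_subset[OF D, THEN subsetD]
  have H: "H \<in> carrier PN"
  proof (rule coprod_idealI)
    show "H \<subseteq> carrier P \<times> carrier N" by (auto simp: H_def)
    show "(a', b') \<in> H" if "(a, b) \<in> H" "a' \<in> carrier P" "b' \<in> carrier N" "a' \<sqsubseteq>\<^bsub>P\<^esub> a" "b' \<sqsubseteq>\<^bsub>N\<^esub> b" for a b a' b'
      unfolding H_def
    proof safe
      fix c d assume cD: "(c, d) \<in> D"
      have "(a \<sqinter>\<^bsub>P\<^esub> c, b \<sqinter>\<^bsub>N\<^esub> d) \<in> F" "a \<in> carrier P" "b \<in> carrier N"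
        using that(1) cD by (auto simp: H_def)
      with that(2-) cd[OF cD] show "(a' \<sqinter>\<^bsub>P\<^esub> c, b' \<sqinter>\<^bsub>N\<^esub> d) \<in> F"
        by (intro coprod_down[OF F \<open>(a \<sqinter>\<^bsub>P\<^esub> c, b \<sqinter>\<^bsub>N\<^esub> d) \<in> F\<close>] P.meet_mono N.meet_mono) simp_all
    qed (use that in auto)
    show "(\<Squnion>\<^bsub>P\<^esub>A, b) \<in> H" if "A \<subseteq> carrier P" "b \<in> carrier N" "\<And>a. a \<in> A \<Longrightarrow> (a, b) \<in> H" for A b
      unfolding H_def
    proof safe
      fix c d assume "(c, d) \<in> D"
      then show "(\<Squnion>\<^bsub>P\<^esub>A \<sqinter>\<^bsub>P\<^esub> c, b \<sqinter>\<^bsub>N\<^esub> d) \<in> F"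
        using that(1,2) that(3)[unfolded H_def] cd[of "(c, d)"]
        by (subst P.Sup_inf_distrib) (fastforce intro!: coprod_supl[OF F])+
    qed (use that in auto)
    show "(a, \<Squnion>\<^bsub>N\<^esub>B) \<in> H" if "a \<in> carrier P" "B \<subseteq> carrier N" "\<And>b. b \<in> B \<Longrightarrow> (a, b) \<in> H" for a B
      unfolding H_def
    proof safe
      fix c d assume "(c, d) \<in> D"
      then show "(a \<sqinter>\<^bsub>P\<^esub> c, \<Squnion>\<^bsub>N\<^esub>B \<sqinter>\<^bsub>N\<^esub> d) \<in> F"
        using that cd[of "(c, d)"]
        by (subst N.Sup_inf_distrib) (fastforce simp: H_def intro!: coprod_supr[OF F])+
    qed (use that in auto)
  qed
  have "\<Squnion>\<^bsub>PN\<^esub>\<D> \<sqsubseteq>\<^bsub>PN\<^esub> H"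
  proof (rule PN.sup_least[OF \<D> H])
    fix E assume E: "E \<in> \<D>"
    then have Ec: "E \<in> carrier PN" using \<D> by auto
    have sub: "D \<inter> E \<subseteq> F" using le[OF E] D Ec by (simp add: coprod_meet le_coprod)
    have "(a \<sqinter>\<^bsub>P\<^esub> c, b \<sqinter>\<^bsub>N\<^esub> d) \<in> F" if ab: "(a, b) \<in> E" and cd': "(c, d) \<in> D" for a b c d
    proof -
      have m: "a \<in> carrier P" "b \<in> carrier N" "c \<in> carrier P" "d \<in> carrier N"
        using coprod_subset[OF Ec] coprod_subset[OF D] ab cd' by auto
      have "(a \<sqinter>\<^bsub>P\<^esub> c, b \<sqinter>\<^bsub>N\<^esub> d) \<in> E"
        using m by (intro coprod_down[OF Ec ab]) (auto intro: P.meet_left N.meet_left)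
      moreover have "(a \<sqinter>\<^bsub>P\<^esub> c, b \<sqinter>\<^bsub>N\<^esub> d) \<in> D"
        using m by (intro coprod_down[OF D cd']) (auto intro: P.meet_right N.meet_right)
      ultimately show ?thesis using sub by blast
    qed
    then show "E \<sqsubseteq>\<^bsub>PN\<^esub> H" using coprod_subset[OF Ec] by (auto simp: H_def le_coprod)
  qed
  \<comment> \<open>Modus ponens: a pair of \<open>D\<close> that lies in \<open>H\<close> is tested
    against itself, and idempotence of the meets puts it into \<open>F\<close>.\<close>
  moreover have "D \<inter> H \<subseteq> F"
    using coprod_subset[OF D] by (force simp: H_def P.meet_self N.meet_self)
  ultimately show "D \<sqinter>\<^bsub>PN\<^esub> \<Squnion>\<^bsub>PN\<^esub>\<D> \<sqsubseteq>\<^bsub>PN\<^esub> F"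
    using D \<D> by (auto simp: coprod_meet le_coprod)
qed

lemma inl_closed: "x \<in> carrier P \<Longrightarrow> inl x \<in> carrier PN"
proof (rule coprod_idealI)
  assume x: "x \<in> carrier P"
  show "inl x \<subseteq> carrier P \<times> carrier N" by (auto simp: coprod_inl_def)
  show "(a', b') \<in> inl x" if "(a, b) \<in> inl x" "a' \<in> carrier P" "b' \<in> carrier N" "a' \<sqsubseteq>\<^bsub>P\<^esub> a" "b' \<sqsubseteq>\<^bsub>N\<^esub> b" for a b a' b'
    using that x P.le_trans[of a' a x] N.le_bottom_eq[of b'] by (auto simp: coprod_inl_def)
  show "(\<Squnion>\<^bsub>P\<^esub>A, b) \<in> inl x" if "A \<subseteq> carrier P" "b \<in> carrier N" "\<And>a. a \<in> A \<Longrightarrow> (a, b) \<in> inl x" for A b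
    using that x by (auto simp: coprod_inl_def P.sup_le_iff)
  show "(a, \<Squnion>\<^bsub>N\<^esub>B) \<in> inl x" if "a \<in> carrier P" "B \<subseteq> carrier N" "\<And>b. b \<in> B \<Longrightarrow> (a, b) \<in> inl x" for a B
  proof (cases "a \<sqsubseteq>\<^bsub>P\<^esub> x")
    case False
    \<comment> \<open>The coordinate \<open>a\<close> is fixed, so if it is not below
      \<open>x\<close>, all of \<open>B\<close> must come from the clause for pairs with bottom
      second coordinate.\<close>
    then have "B \<subseteq> {\<bottom>\<^bsub>N\<^esub>}" using that by (auto simp: coprod_inl_def)
    then have "\<Squnion>\<^bsub>N\<^esub>B \<sqsubseteq>\<^bsub>N\<^esub> \<bottom>\<^bsub>N\<^esub>" using that by (intro N.sup_least) auto
    then show ?thesis using that N.le_bottom_eq by (auto simp: coprod_inl_def)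
  qed (use that in \<open>auto simp: coprod_inl_def\<close>)
qed

lemma inr_closed: "y \<in> carrier N \<Longrightarrow> inr y \<in> carrier PN"
proof (rule coprod_idealI)
  assume y: "y \<in> carrier N"
  show "inr y \<subseteq> carrier P \<times> carrier N" by (auto simp: coprod_inr_def)
  show "(a', b') \<in> inr y" if "(a, b) \<in> inr y" "a' \<in> carrier P" "b' \<in> carrier N" "a' \<sqsubseteq>\<^bsub>P\<^esub> a" "b' \<sqsubseteq>\<^bsub>N\<^esub> b" for a b a' b'
    using that y N.le_trans[of b' b y] P.le_bottom_eq[of a'] by (auto simp: coprod_inr_def)
  show "(a, \<Squnion>\<^bsub>N\<^esub>B) \<in> inr y" if "a \<in> carrier P" "B \<subseteq> carrier N" "\<And>b. b \<in> B \<Longrightarrow> (a, b) \<in> inr y" for a B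
    using that y by (auto simp: coprod_inr_def N.sup_le_iff)
  show "(\<Squnion>\<^bsub>P\<^esub>A, b) \<in> inr y" if "A \<subseteq> carrier P" "b \<in> carrier N" "\<And>a. a \<in> A \<Longrightarrow> (a, b) \<in> inr y" for A b
  proof (cases "b \<sqsubseteq>\<^bsub>N\<^esub> y")
    case False
    then have "A \<subseteq> {\<bottom>\<^bsub>P\<^esub>}" using that by (auto simp: coprod_inr_def)
    then have "\<Squnion>\<^bsub>P\<^esub>A \<sqsubseteq>\<^bsub>P\<^esub> \<bottom>\<^bsub>P\<^esub>" using that by (intro P.sup_least) auto
    then show ?thesis using that P.le_bottom_eq by (auto simp: coprod_inr_def)
  qed (use that in \<open>auto simp: coprod_inr_def\<close>)
qed

lemma frame_map_inl: "frame_map P PN inl"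
proof (rule frame_mapI)
  show "inl \<top>\<^bsub>P\<^esub> = \<top>\<^bsub>PN\<^esub>" by (auto simp: coprod_top coprod_inl_def)
  show "inl (x \<sqinter>\<^bsub>P\<^esub> y) = inl x \<sqinter>\<^bsub>PN\<^esub> inl y" if "x \<in> carrier P" "y \<in> carrier P" for x y
    unfolding coprod_meet[OF inl_closed[OF that(1)] inl_closed[OF that(2)]]
    using that by (auto simp: coprod_inl_def P.meet_le_iff)
  show "inl (\<Squnion>\<^bsub>P\<^esub>A) = \<Squnion>\<^bsub>PN\<^esub>(inl ` A)" if A: "A \<subseteq> carrier P" for A
  proof (rule PN.sup_eqI[symmetric])
    show "inl (\<Squnion>\<^bsub>P\<^esub>A) \<in> carrier PN" "inl ` A \<subseteq> carrier PN" using A by (auto intro!: inl_closed)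
    fix D assume "D \<in> inl ` A"
    then obtain x where x: "x \<in> A" "D = inl x" by auto
    have "a \<sqsubseteq>\<^bsub>P\<^esub> \<Squnion>\<^bsub>P\<^esub>A" if "a \<in> carrier P" "a \<sqsubseteq>\<^bsub>P\<^esub> x" for a
      using P.le_trans[OF that(2) P.sup_upper[OF A x(1)]] A x that by auto
    then show "D \<sqsubseteq>\<^bsub>PN\<^esub> inl (\<Squnion>\<^bsub>P\<^esub>A)" unfolding x by (auto simp: coprod_inl_def le_coprod)
  next
    fix E assume E: "E \<in> carrier PN" "\<And>D. D \<in> inl ` A \<Longrightarrow> D \<sqsubseteq>\<^bsub>PN\<^esub> E"
    show "inl (\<Squnion>\<^bsub>P\<^esub>A) \<sqsubseteq>\<^bsub>PN\<^esub> E"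
      unfolding le_coprod
    proof clarify
      fix a b assume ab: "(a, b) \<in> inl (\<Squnion>\<^bsub>P\<^esub>A)"
      then have abc: "a \<in> carrier P" "b \<in> carrier N" by (auto simp: coprod_inl_def)
      have "(x, b) \<in> E" if "x \<in> A" for x
      proof -
        have "(x, b) \<in> inl x" using that A abc by (auto simp: coprod_inl_def)
        moreover have "inl x \<subseteq> E" using E(2)[of "inl x"] that by (auto simp: le_coprod)
        ultimately show ?thesis by blast
      qed
      then have "(\<Squnion>\<^bsub>P\<^esub>A, b) \<in> E" using A abc by (intro coprod_supl[OF E(1)]) auto
      then show "(a, b) \<in> E"
        using ab abc coprod_down[OF E(1)] coprod_botr[OF E(1)] by (auto simp: coprod_inl_def)
    qed
  qed
qed (rule inl_closed)

lemma frame_map_inr: "frame_map N PN inr"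
proof (rule frame_mapI)
  show "inr \<top>\<^bsub>N\<^esub> = \<top>\<^bsub>PN\<^esub>" by (auto simp: coprod_top coprod_inr_def)
  show "inr (x \<sqinter>\<^bsub>N\<^esub> y) = inr x \<sqinter>\<^bsub>PN\<^esub> inr y" if "x \<in> carrier N" "y \<in> carrier N" for x y
    unfolding coprod_meet[OF inr_closed[OF that(1)] inr_closed[OF that(2)]]
    using that by (auto simp: coprod_inr_def N.meet_le_iff)
  show "inr (\<Squnion>\<^bsub>N\<^esub>A) = \<Squnion>\<^bsub>PN\<^esub>(inr ` A)" if A: "A \<subseteq> carrier N" for A
  proof (rule PN.sup_eqI[symmetric])
    show "inr (\<Squnion>\<^bsub>N\<^esub>A) \<in> carrier PN" "inr ` A \<subseteq> carrier PN" using A by (auto intro!: inr_closed)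
    fix D assume "D \<in> inr ` A"
    then obtain x where x: "x \<in> A" "D = inr x" by auto
    have "a \<sqsubseteq>\<^bsub>N\<^esub> \<Squnion>\<^bsub>N\<^esub>A" if "a \<in> carrier N" "a \<sqsubseteq>\<^bsub>N\<^esub> x" for a
      using N.le_trans[OF that(2) N.sup_upper[OF A x(1)]] A x that by auto
    then show "D \<sqsubseteq>\<^bsub>PN\<^esub> inr (\<Squnion>\<^bsub>N\<^esub>A)" unfolding x by (auto simp: coprod_inr_def le_coprod)
  next
    fix E assume E: "E \<in> carrier PN" "\<And>D. D \<in> inr ` A \<Longrightarrow> D \<sqsubseteq>\<^bsub>PN\<^esub> E"
    show "inr (\<Squnion>\<^bsub>N\<^esub>A) \<sqsubseteq>\<^bsub>PN\<^esub> E"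
      unfolding le_coprod
    proof clarify
      fix a b assume ab: "(a, b) \<in> inr (\<Squnion>\<^bsub>N\<^esub>A)"
      then have abc: "a \<in> carrier P" "b \<in> carrier N" by (auto simp: coprod_inr_def)
      have "(a, x) \<in> E" if "x \<in> A" for x
      proof -
        have "(a, x) \<in> inr x" using that A abc by (auto simp: coprod_inr_def)
        moreover have "inr x \<subseteq> E" using E(2)[of "inr x"] that by (auto simp: le_coprod)
        ultimately show ?thesis by blast
      qed
      then have "(a, \<Squnion>\<^bsub>N\<^esub>A) \<in> E" using A abc by (intro coprod_supr[OF E(1)]) auto
      then show "(a, b) \<in> E"
        using ab abc coprod_down[OF E(1)] coprod_botl[OF E(1)] by (auto simp: coprod_inr_def)
    qed
  qed
qed (rule inr_closed)

text \<open>The meet of \<open>inl a\<close> and \<open>inr b\<close> consists of the pairs below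
  \<open>(a, b)\<close> and of all pairs with a bottom coordinate. Every ideal contains the latter,
  so an ideal contains this rectangle exactly when it contains \<open>(a, b)\<close>.\<close>

lemma coprod_eq_sup_rects:
  assumes D: "D \<in> carrier PN"
  shows "D = \<Squnion>\<^bsub>PN\<^esub>((\<lambda>(a, b). inl a \<sqinter>\<^bsub>PN\<^esub> inr b) ` D)"
proof (rule PN.sup_eqI[symmetric, OF D])
  note cD = coprod_subset[OF D, THEN subsetD]
  show "(\<lambda>(a, b). inl a \<sqinter>\<^bsub>PN\<^esub> inr b) ` D \<subseteq> carrier PN"
    using cD by (auto intro!: PN.meet_closed inl_closed inr_closed)
  fix E assume "E \<in> (\<lambda>(a, b). inl a \<sqinter>\<^bsub>PN\<^esub> inr b) ` D"
  then obtain a b where ab: "(a, b) \<in> D" "E = inl a \<inter> inr b"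
    using cD by (auto simp: coprod_meet inl_closed inr_closed)
  then show "E \<sqsubseteq>\<^bsub>PN\<^esub> D"
    using coprod_botl[OF D] coprod_botr[OF D] coprod_down[OF D ab(1)]
    by (auto simp: le_coprod coprod_inl_def coprod_inr_def)
next
  note cD = coprod_subset[OF D, THEN subsetD]
  fix E assume E: "E \<in> carrier PN"
    "\<And>F. F \<in> (\<lambda>(a, b). inl a \<sqinter>\<^bsub>PN\<^esub> inr b) ` D \<Longrightarrow> F \<sqsubseteq>\<^bsub>PN\<^esub> E"
  show "D \<sqsubseteq>\<^bsub>PN\<^esub> E"
    unfolding le_coprod
  proof clarify
    fix a b assume ab: "(a, b) \<in> D"
    then have "inl a \<inter> inr b \<subseteq> E"
      using E(2)[OF image_eqI[OF _ ab]] cD[OF ab] by (simp add: coprod_meet inl_closed inr_closed le_coprod)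
    then show "(a, b) \<in> E" using cD[OF ab] by (auto simp: coprod_inl_def coprod_inr_def)
  qed
qed

end

section \<open>The universal property of the coproduct\<close>

locale copair_maps = frame_pair P N + K: frame K for P :: "'p gorder" and N :: "'n gorder" and K :: "'k gorder" +
  fixes f g
  assumes f: "frame_map P K f" and g: "frame_map N K g"
begin

abbreviation h where "h \<equiv> copair K f g"

lemma fg_closed: "a \<in> carrier P \<Longrightarrow> b \<in> carrier N \<Longrightarrow> f a \<sqinter>\<^bsub>K\<^esub> g b \<in> carrier K"
  using frame_map_closed[OF f] frame_map_closed[OF g] by simp

lemma h_le_iff:
  assumes "D \<subseteq> carrier P \<times> carrier N" "k \<in> carrier K"
  shows "h D \<sqsubseteq>\<^bsub>K\<^esub> k \<longleftrightarrow> (\<forall>(a, b)\<in>D. f a \<sqinter>\<^bsub>K\<^esub> g b \<sqsubseteq>\<^bsub>K\<^esub> k)"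
  unfolding copair_def using assms fg_closed by (subst K.sup_le_iff) auto

lemma h_closed: "D \<subseteq> carrier P \<times> carrier N \<Longrightarrow> h D \<in> carrier K"
  unfolding copair_def using fg_closed by (intro K.sup_closed) auto

lemma h_upper:
  assumes "D \<in> carrier PN" "(a, b) \<in> D"
  shows "f a \<sqinter>\<^bsub>K\<^esub> g b \<sqsubseteq>\<^bsub>K\<^esub> h D"
  using h_le_iff[of D "h D"] h_closed[of D] coprod_subset[OF assms(1)] assms(2) by auto

text \<open>This set is the value at \<open>k\<close> of the right adjoint of \<open>h\<close>: an
  ideal \<open>D\<close> has \<open>h D\<close> below \<open>k\<close> iff it is contained in it.
  That the set is an ideal is what makes \<open>h\<close> preserve joins.\<close>

lemma adjoint_ideal:
  assumes k: "k \<in> carrier K"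
  shows "{(a, b) \<in> carrier P \<times> carrier N. f a \<sqinter>\<^bsub>K\<^esub> g b \<sqsubseteq>\<^bsub>K\<^esub> k} \<in> carrier PN" (is "?D \<in> _")
proof (rule coprod_idealI)
  note c = frame_map_closed[OF f] frame_map_closed[OF g]
  show "?D \<subseteq> carrier P \<times> carrier N" by auto
  show "(a', b') \<in> ?D" if "(a, b) \<in> ?D" "a' \<in> carrier P" "b' \<in> carrier N" "a' \<sqsubseteq>\<^bsub>P\<^esub> a" "b' \<sqsubseteq>\<^bsub>N\<^esub> b" for a b a' b'
  proof -
    have "f a' \<sqsubseteq>\<^bsub>K\<^esub> f a" "g b' \<sqsubseteq>\<^bsub>K\<^esub> g b"
      using that by (auto intro!: frame_map_mono[OF f P.complete_lattice_axioms K.complete_lattice_axioms]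
          frame_map_mono[OF g N.complete_lattice_axioms K.complete_lattice_axioms])
    then have "f a' \<sqinter>\<^bsub>K\<^esub> g b' \<sqsubseteq>\<^bsub>K\<^esub> f a \<sqinter>\<^bsub>K\<^esub> g b" using that c by (intro K.meet_mono) auto
    then show ?thesis using that c k K.le_trans[of "f a' \<sqinter>\<^bsub>K\<^esub> g b'" "f a \<sqinter>\<^bsub>K\<^esub> g b" k] by auto
  qed
  show "(\<Squnion>\<^bsub>P\<^esub>A, b) \<in> ?D" if "A \<subseteq> carrier P" "b \<in> carrier N" "\<And>a. a \<in> A \<Longrightarrow> (a, b) \<in> ?D" for A b
    using that c k by (simp add: frame_map_sup[OF f])
      (subst K.Sup_inf_distrib, auto intro!: K.sup_least)
  show "(a, \<Squnion>\<^bsub>N\<^esub>B) \<in> ?D" if "a \<in> carrier P" "B \<subseteq> carrier N" "\<And>b. b \<in> B \<Longrightarrow> (a, b) \<in> ?D" for a B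
    using that c k by (simp add: frame_map_sup[OF g])
      (subst K.inf_Sup_distrib, auto intro!: K.sup_least)
qed

lemma h_mono: "D \<in> carrier PN \<Longrightarrow> E \<in> carrier PN \<Longrightarrow> D \<subseteq> E \<Longrightarrow> h D \<sqsubseteq>\<^bsub>K\<^esub> h E"
  using h_le_iff[of D "h E"] h_closed[of E] coprod_subset h_upper[of E] by blast

lemma frame_map_copair: "frame_map PN K h"
proof (rule frame_mapI)
  note c = frame_map_closed[OF f] frame_map_closed[OF g]
  show hc: "h D \<in> carrier K" if "D \<in> carrier PN" for D using that h_closed coprod_subset by blast
  have "f \<top>\<^bsub>P\<^esub> \<sqinter>\<^bsub>K\<^esub> g \<top>\<^bsub>N\<^esub> \<sqsubseteq>\<^bsub>K\<^esub> h \<top>\<^bsub>PN\<^esub>" by (rule h_upper) (auto simp: coprod_top[symmetric], simp add: coprod_top)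
  then have "\<top>\<^bsub>K\<^esub> \<sqsubseteq>\<^bsub>K\<^esub> h \<top>\<^bsub>PN\<^esub>" by (simp add: frame_map_top[OF f] frame_map_top[OF g] K.top_meet_eq)
  then show "h \<top>\<^bsub>PN\<^esub> = \<top>\<^bsub>K\<^esub>" using hc[of "\<top>\<^bsub>PN\<^esub>"] by (intro K.le_antisym) auto
  show "h (D \<sqinter>\<^bsub>PN\<^esub> E) = h D \<sqinter>\<^bsub>K\<^esub> h E" if D: "D \<in> carrier PN" and E: "E \<in> carrier PN" for D E
  proof (rule K.le_antisym)
    have DE: "D \<inter> E \<in> carrier PN" using PN.meet_closed[OF D E] by (simp add: coprod_meet D E)
    show "h (D \<sqinter>\<^bsub>PN\<^esub> E) \<sqsubseteq>\<^bsub>K\<^esub> h D \<sqinter>\<^bsub>K\<^esub> h E"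
      using D E DE hc by (auto simp: coprod_meet intro!: K.meet_le h_mono)
    \<comment> \<open>Binary meets are checked on rectangles: the coordinatewise meet of a pair of
      \<open>D\<close> and a pair of \<open>E\<close> lies in both ideals. Distributivity of
      \<open>K\<close>, applied once for \<open>E\<close> and once for \<open>D\<close>, then gives
      the inequality for the joins.\<close>
    have "f a \<sqinter>\<^bsub>K\<^esub> g b \<sqinter>\<^bsub>K\<^esub> (f c \<sqinter>\<^bsub>K\<^esub> g d) \<sqsubseteq>\<^bsub>K\<^esub> h (D \<inter> E)" if ab: "(a, b) \<in> D" and cd: "(c, d) \<in> E" for a b c d
    proof -
      have m: "a \<in> carrier P" "b \<in> carrier N" "c \<in> carrier P" "d \<in> carrier N"
        using coprod_subset[OF D] coprod_subset[OF E] that by auto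
      have "(a \<sqinter>\<^bsub>P\<^esub> c, b \<sqinter>\<^bsub>N\<^esub> d) \<in> D"
        using m by (intro coprod_down[OF D ab]) (auto intro: P.meet_left N.meet_left)
      moreover have "(a \<sqinter>\<^bsub>P\<^esub> c, b \<sqinter>\<^bsub>N\<^esub> d) \<in> E"
        using m by (intro coprod_down[OF E cd]) (auto intro: P.meet_right N.meet_right)
      ultimately have "f (a \<sqinter>\<^bsub>P\<^esub> c) \<sqinter>\<^bsub>K\<^esub> g (b \<sqinter>\<^bsub>N\<^esub> d) \<sqsubseteq>\<^bsub>K\<^esub> h (D \<inter> E)"
        using DE by (intro h_upper) auto
      moreover have "f (a \<sqinter>\<^bsub>P\<^esub> c) \<sqinter>\<^bsub>K\<^esub> g (b \<sqinter>\<^bsub>N\<^esub> d) = f a \<sqinter>\<^bsub>K\<^esub> g b \<sqinter>\<^bsub>K\<^esub> (f c \<sqinter>\<^bsub>K\<^esub> g d)"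
        using m c by (simp add: frame_map_meet[OF f] frame_map_meet[OF g] K.meet_assoc K.meet_left_comm)
      ultimately show ?thesis by simp
    qed
    note le = this
    have 1: "(f a \<sqinter>\<^bsub>K\<^esub> g b) \<sqinter>\<^bsub>K\<^esub> h E \<sqsubseteq>\<^bsub>K\<^esub> h (D \<inter> E)" if ab: "(a, b) \<in> D" for a b
      unfolding copair_def[of _ _ _ E]
      using le[OF ab] coprod_subset[OF D, THEN subsetD, OF ab] coprod_subset[OF E, THEN subsetD] c hc[OF DE]
      by (subst K.inf_Sup_distrib) (auto intro!: K.sup_least K.meet_closed)
    show "h D \<sqinter>\<^bsub>K\<^esub> h E \<sqsubseteq>\<^bsub>K\<^esub> h (D \<sqinter>\<^bsub>PN\<^esub> E)"
      unfolding coprod_meet[OF D E] copair_def[of _ _ _ D]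
      using 1 coprod_subset[OF D, THEN subsetD] c hc[OF DE] hc[OF E]
      by (subst K.Sup_inf_distrib) (auto intro!: K.sup_least K.meet_closed)
  qed (use hc D E in auto)
  show "h (\<Squnion>\<^bsub>PN\<^esub>\<D>) = \<Squnion>\<^bsub>K\<^esub>(h ` \<D>)" if \<D>: "\<D> \<subseteq> carrier PN" for \<D>
  proof (rule K.sup_eqI[symmetric])
    show "h (\<Squnion>\<^bsub>PN\<^esub>\<D>) \<in> carrier K" "h ` \<D> \<subseteq> carrier K" using hc \<D> by auto
    show "k \<sqsubseteq>\<^bsub>K\<^esub> h (\<Squnion>\<^bsub>PN\<^esub>\<D>)" if "k \<in> h ` \<D>" for k
      using that \<D> PN.sup_upper[OF \<D>] by (auto intro!: h_mono simp: le_coprod)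
    fix k assume k: "k \<in> carrier K" "\<And>y. y \<in> h ` \<D> \<Longrightarrow> y \<sqsubseteq>\<^bsub>K\<^esub> k"
    let ?I = "{(a, b) \<in> carrier P \<times> carrier N. f a \<sqinter>\<^bsub>K\<^esub> g b \<sqsubseteq>\<^bsub>K\<^esub> k}"
    \<comment> \<open>The join is tested through the adjoint: it suffices that every member of the
      family is contained in the ideal that belongs to the upper bound \<open>k\<close>.\<close>
    have "\<Squnion>\<^bsub>PN\<^esub>\<D> \<sqsubseteq>\<^bsub>PN\<^esub> ?I"
    proof (rule PN.sup_least[OF \<D> adjoint_ideal[OF k(1)]])
      fix D assume D: "D \<in> \<D>"
      then have "D \<subseteq> carrier P \<times> carrier N" using coprod_subset \<D> by blast
      then show "D \<sqsubseteq>\<^bsub>PN\<^esub> ?I" using k(2)[of "h D"] D k(1) by (auto simp: h_le_iff le_coprod)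
    qed
    then show "h (\<Squnion>\<^bsub>PN\<^esub>\<D>) \<sqsubseteq>\<^bsub>K\<^esub> k"
      using k(1) coprod_subset[of "\<Squnion>\<^bsub>PN\<^esub>\<D>"] \<D> by (auto simp: h_le_iff le_coprod)
  qed
qed

lemma copair_inl:
  assumes "x \<in> carrier P"
  shows "h (inl x) = f x"
proof (rule K.le_antisym)
  note c = frame_map_closed[OF f] frame_map_closed[OF g]
  have "f a \<sqinter>\<^bsub>K\<^esub> g b \<sqsubseteq>\<^bsub>K\<^esub> f x" if "(a, b) \<in> inl x" for a b
  proof (cases "b = \<bottom>\<^bsub>N\<^esub>")
    case True
    then show ?thesis using that c assms
      by (simp add: frame_map_bottom[OF g N.complete_lattice_axioms K.complete_lattice_axioms]
          K.meet_bottom_eq coprod_inl_def)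
  next
    case False
    then have ab: "a \<in> carrier P" "b \<in> carrier N" "a \<sqsubseteq>\<^bsub>P\<^esub> x" using that by (auto simp: coprod_inl_def)
    then have "f a \<sqsubseteq>\<^bsub>K\<^esub> f x"
      using assms by (intro frame_map_mono[OF f P.complete_lattice_axioms K.complete_lattice_axioms])
    then show ?thesis using K.le_trans[OF K.meet_left, of "f a" "g b" "f x"] ab assms c by auto
  qed
  then show "h (inl x) \<sqsubseteq>\<^bsub>K\<^esub> f x"
    using assms c coprod_subset[OF inl_closed[OF assms]] by (auto simp: h_le_iff)
  have "f x \<sqinter>\<^bsub>K\<^esub> g \<top>\<^bsub>N\<^esub> \<sqsubseteq>\<^bsub>K\<^esub> h (inl x)"
    using assms by (intro h_upper inl_closed) (auto simp: coprod_inl_def)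
  then show "f x \<sqsubseteq>\<^bsub>K\<^esub> h (inl x)" using assms c by (simp add: frame_map_top[OF g] K.meet_top_eq)
qed (use assms frame_map_closed[OF f] frame_map_closed[OF frame_map_copair] inl_closed in auto)

lemma copair_inr:
  assumes "y \<in> carrier N"
  shows "h (inr y) = g y"
proof (rule K.le_antisym)
  note c = frame_map_closed[OF f] frame_map_closed[OF g]
  have "f a \<sqinter>\<^bsub>K\<^esub> g b \<sqsubseteq>\<^bsub>K\<^esub> g y" if "(a, b) \<in> inr y" for a b
  proof (cases "a = \<bottom>\<^bsub>P\<^esub>")
    case True
    then show ?thesis using that c assms
      by (simp add: frame_map_bottom[OF f P.complete_lattice_axioms K.complete_lattice_axioms]
          K.bottom_meet_eq coprod_inr_def)
  next
    case False
    then have ab: "a \<in> carrier P" "b \<in> carrier N" "b \<sqsubseteq>\<^bsub>N\<^esub> y" using that by (auto simp: coprod_inr_def)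
    then have "g b \<sqsubseteq>\<^bsub>K\<^esub> g y"
      using assms by (intro frame_map_mono[OF g N.complete_lattice_axioms K.complete_lattice_axioms])
    then show ?thesis using K.le_trans[OF K.meet_right, of "f a" "g b" "g y"] ab assms c by auto
  qed
  then show "h (inr y) \<sqsubseteq>\<^bsub>K\<^esub> g y"
    using assms c coprod_subset[OF inr_closed[OF assms]] by (auto simp: h_le_iff)
  have "f \<top>\<^bsub>P\<^esub> \<sqinter>\<^bsub>K\<^esub> g y \<sqsubseteq>\<^bsub>K\<^esub> h (inr y)"
    using assms by (intro h_upper inr_closed) (auto simp: coprod_inr_def)
  then show "g y \<sqsubseteq>\<^bsub>K\<^esub> h (inr y)" using assms c by (simp add: frame_map_top[OF f] K.top_meet_eq)
qed (use assms frame_map_closed[OF g] frame_map_closed[OF frame_map_copair] inr_closed in auto)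

end

section \<open>Biframes and finitary relations\<close>

text \<open>Unlike in a biframe, the maps \<open>epos L\<close> and \<open>eneg L\<close> need not be injective: coproduct
  injections are not if one of the two frames is trivial and the other is not.\<close>

locale prebiframe =
  fixes L :: "('p, 'n, 'a) biframe"
  assumes frame_pos: "frame (pos L)" and frame_neg: "frame (neg L)" and frame_main: "frame (main L)"
    and frame_map_epos: "frame_map (pos L) (main L) (epos L)"
    and frame_map_eneg: "frame_map (neg L) (main L) (eneg L)"
    and sup_rects: "\<And>x. x \<in> carrier (main L) \<Longrightarrow>
      \<exists>S \<subseteq> carrier (pos L) \<times> carrier (neg L). x = \<Squnion>\<^bsub>main L\<^esub>(rect L ` S)"

sublocale prebiframe \<subseteq> P: frame "pos L" by (rule frame_pos)
sublocale prebiframe \<subseteq> N: frame "neg L" by (rule frame_neg)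
sublocale prebiframe \<subseteq> M: frame "main L" by (rule frame_main)

lemma is_biframe_iff:
  "is_biframe L \<longleftrightarrow> prebiframe L \<and> inj_on (epos L) (carrier (pos L)) \<and> inj_on (eneg L) (carrier (neg L))"
  by (auto simp: is_biframe_def prebiframe_def)

context prebiframe
begin

lemma e_closed [simp]:
  "a \<in> carrier (pos L) \<Longrightarrow> epos L a \<in> carrier (main L)"
  "b \<in> carrier (neg L) \<Longrightarrow> eneg L b \<in> carrier (main L)"
  using frame_map_closed[OF frame_map_epos] frame_map_closed[OF frame_map_eneg] by auto

lemma rect_pair: "rect L (a, b) = epos L a \<sqinter>\<^bsub>main L\<^esub> eneg L b"
  by (simp add: rect_def)

lemma rects_closed: "S \<subseteq> carrier (pos L) \<times> carrier (neg L) \<Longrightarrow> rect L ` S \<subseteq> carrier (main L)"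
  by (auto simp: rect_pair)

lemma fin_closed: "fin L \<subseteq> carrier (main L)"
  using rects_closed by (auto simp: fin_def)

lemma rect_in_fin:
  assumes "a \<in> carrier (pos L)" "b \<in> carrier (neg L)"
  shows "epos L a \<sqinter>\<^bsub>main L\<^esub> eneg L b \<in> fin L"
  unfolding fin_def using assms
  by (intro CollectI exI[of _ "{(a, b)}"]) (simp add: rect_pair)

lemma epos_in_fin: "a \<in> carrier (pos L) \<Longrightarrow> epos L a \<in> fin L"
  using rect_in_fin[of a "\<top>\<^bsub>neg L\<^esub>"] by (simp add: frame_map_top[OF frame_map_eneg] M.meet_top_eq)

lemma eneg_in_fin: "b \<in> carrier (neg L) \<Longrightarrow> eneg L b \<in> fin L"
  using rect_in_fin[of "\<top>\<^bsub>pos L\<^esub>" b] by (simp add: frame_map_top[OF frame_map_epos] M.top_meet_eq)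

lemma join_in_fin:
  assumes "c \<in> carrier (pos L)" "d \<in> carrier (neg L)"
  shows "epos L c \<squnion>\<^bsub>main L\<^esub> eneg L d \<in> fin L"
proof -
  have "epos L c \<squnion>\<^bsub>main L\<^esub> eneg L d = \<Squnion>\<^bsub>main L\<^esub>(rect L ` {(c, \<top>\<^bsub>neg L\<^esub>), (\<top>\<^bsub>pos L\<^esub>, d)})"
    using assms by (simp add: rect_pair frame_map_top[OF frame_map_epos] frame_map_top[OF frame_map_eneg]
        M.meet_top_eq M.top_meet_eq join_def)
  then show ?thesis
    unfolding fin_def using assms
    by (intro CollectI exI[of _ "{(c, \<top>\<^bsub>neg L\<^esub>), (\<top>\<^bsub>pos L\<^esub>, d)}"]) simp
qed

lemma frame_map_rect:
  assumes "frame_map (main L) K h" "a \<in> carrier (pos L)" "b \<in> carrier (neg L)"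
  shows "h (rect L (a, b)) = h (epos L a) \<sqinter>\<^bsub>K\<^esub> h (eneg L b)"
  using assms by (simp add: rect_pair frame_map_meet)

text \<open>Rectangles generate the main component under joins, and their images are determined by
  the two parts. This gives uniqueness of the extension of a biframe map.\<close>

lemma frame_map_main_eq:
  assumes "frame_map (main L) K h" "frame_map (main L) K h'"
    and "\<And>a. a \<in> carrier (pos L) \<Longrightarrow> h (epos L a) = h' (epos L a)"
    and "\<And>b. b \<in> carrier (neg L) \<Longrightarrow> h (eneg L b) = h' (eneg L b)"
    and "x \<in> carrier (main L)"
  shows "h x = h' x"
proof -
  obtain S where S: "S \<subseteq> carrier (pos L) \<times> carrier (neg L)" "x = \<Squnion>\<^bsub>main L\<^esub>(rect L ` S)"
    using sup_rects[OF assms(5)] by blast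
  have "h ` rect L ` S = h' ` rect L ` S"
    unfolding image_image
  proof (rule image_cong)
    fix p assume "p \<in> S"
    then obtain a b where "p = (a, b)" "a \<in> carrier (pos L)" "b \<in> carrier (neg L)" using S(1) by auto
    then show "h (rect L p) = h' (rect L p)"
      using assms(1-4) by (simp add: frame_map_rect)
  qed simp
  then show ?thesis
    unfolding S(2) using rects_closed[OF S(1)] assms(1,2) by (simp add: frame_map_sup)
qed

text \<open>Every finite join of rectangles is a finite meet of elements \<open>c \<squnion> d\<close>, so inequalities
  between elements of \<open>fin L\<close> reduce to those of the form \<open>a \<sqinter> b \<sqsubseteq> c \<squnion> d\<close>.\<close>

lemma cle_fin:
  assumes C: "frame_cong (main L) C" and D: "frame_cong (main L) D"
    and basic: "\<And>a b c d. a \<in> carrier (pos L) \<Longrightarrow> b \<in> carrier (neg L) \<Longrightarrow>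
      c \<in> carrier (pos L) \<Longrightarrow> d \<in> carrier (neg L) \<Longrightarrow>
      cle (main L) D (epos L a \<sqinter>\<^bsub>main L\<^esub> eneg L b) (epos L c \<squnion>\<^bsub>main L\<^esub> eneg L d) \<Longrightarrow>
      cle (main L) C (epos L a \<sqinter>\<^bsub>main L\<^esub> eneg L b) (epos L c \<squnion>\<^bsub>main L\<^esub> eneg L d)"
    and r: "r \<in> fin L" and s: "s \<in> fin L" and le: "cle (main L) D r s"
  shows "cle (main L) C r s"
proof -
  interpret C: frame_cong "main L" C by fact
  interpret D: frame_cong "main L" D by fact
  \<comment> \<open>The extra summands \<open>c\<close> and \<open>d\<close> make the induction on
    \<open>T\<close> work. With \<open>z\<close> the rest of the right-hand side, distributivity
    splits a new rectangle as \<open>z \<squnion> (c' \<sqinter> d') = (z \<squnion> c') \<sqinter>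
    (z \<squnion> d')\<close>. An inequality into a meet is two inequalities, and in each of them
    the new element is absorbed into \<open>c\<close> or into \<open>d\<close>.\<close>
  have key: "\<forall>c\<in>carrier (pos L). \<forall>d\<in>carrier (neg L).
      cle (main L) D (epos L a \<sqinter>\<^bsub>main L\<^esub> eneg L b) (epos L c \<squnion>\<^bsub>main L\<^esub> eneg L d \<squnion>\<^bsub>main L\<^esub> \<Squnion>\<^bsub>main L\<^esub>(rect L ` T)) \<longrightarrow>
      cle (main L) C (epos L a \<sqinter>\<^bsub>main L\<^esub> eneg L b) (epos L c \<squnion>\<^bsub>main L\<^esub> eneg L d \<squnion>\<^bsub>main L\<^esub> \<Squnion>\<^bsub>main L\<^esub>(rect L ` T))"
    if "finite T" "T \<subseteq> carrier (pos L) \<times> carrier (neg L)" and ab: "a \<in> carrier (pos L)" "b \<in> carrier (neg L)"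
    for a b T
    using that(1,2)
  proof (induction T)
    case empty
    then show ?case using ab basic by (simp add: M.sup_empty M.join_bottom_eq)
  next
    case (insert p T)
    obtain c' d' where p: "p = (c', d')" "c' \<in> carrier (pos L)" "d' \<in> carrier (neg L)"
      using insert.prems by auto
    let ?t = "\<Squnion>\<^bsub>main L\<^esub>(rect L ` T)"
    let ?x = "epos L a \<sqinter>\<^bsub>main L\<^esub> eneg L b"
    have t: "?t \<in> carrier (main L)" "rect L ` T \<subseteq> carrier (main L)"
      using insert.prems rects_closed by auto
    show ?case
    proof (intro ballI impI)
      fix c d assume cd: "c \<in> carrier (pos L)" "d \<in> carrier (neg L)"
      let ?u = "epos L (c \<squnion>\<^bsub>pos L\<^esub> c') \<squnion>\<^bsub>main L\<^esub> eneg L d \<squnion>\<^bsub>main L\<^esub> ?t"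
      let ?v = "epos L c \<squnion>\<^bsub>main L\<^esub> eneg L (d \<squnion>\<^bsub>neg L\<^esub> d') \<squnion>\<^bsub>main L\<^esub> ?t"
      let ?z = "epos L c \<squnion>\<^bsub>main L\<^esub> eneg L d \<squnion>\<^bsub>main L\<^esub> ?t"
      have u: "?u = ?z \<squnion>\<^bsub>main L\<^esub> epos L c'"
        using cd p t by (simp add: frame_map_join[OF frame_map_epos] M.join_assoc M.join_left_comm
            join_comm[of "main L"])
      have v: "?v = ?z \<squnion>\<^bsub>main L\<^esub> eneg L d'"
        using cd p t by (simp add: frame_map_join[OF frame_map_eneg] M.join_assoc M.join_left_comm
            join_comm[of "main L"])
      have "epos L c \<squnion>\<^bsub>main L\<^esub> eneg L d \<squnion>\<^bsub>main L\<^esub> \<Squnion>\<^bsub>main L\<^esub>(rect L ` insert p T) =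
        ?z \<squnion>\<^bsub>main L\<^esub> (epos L c' \<sqinter>\<^bsub>main L\<^esub> eneg L d')"
        using cd p t by (simp add: M.sup_insert rect_pair M.join_assoc M.join_left_comm join_comm[of "main L"])
      also have "\<dots> = ?u \<sqinter>\<^bsub>main L\<^esub> ?v"
        unfolding u v using cd p t by (intro M.join_meet_distrib) auto
      finally have eq: "epos L c \<squnion>\<^bsub>main L\<^esub> eneg L d \<squnion>\<^bsub>main L\<^esub> \<Squnion>\<^bsub>main L\<^esub>(rect L ` insert p T) =
        ?u \<sqinter>\<^bsub>main L\<^esub> ?v" .
      have cl: "?u \<in> carrier (main L)" "?v \<in> carrier (main L)" "?x \<in> carrier (main L)"
        using cd p t ab by auto
      assume "cle (main L) D ?x (epos L c \<squnion>\<^bsub>main L\<^esub> eneg L d \<squnion>\<^bsub>main L\<^esub> \<Squnion>\<^bsub>main L\<^esub>(rect L ` insert p T))"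
      then have "cle (main L) D ?x ?u" "cle (main L) D ?x ?v"
        unfolding eq using cl by (auto simp: D.cle_meet_iff)
      then have "cle (main L) C ?x ?u" "cle (main L) C ?x ?v"
        using insert.IH insert.prems cd p by auto
      then show "cle (main L) C ?x (epos L c \<squnion>\<^bsub>main L\<^esub> eneg L d \<squnion>\<^bsub>main L\<^esub> \<Squnion>\<^bsub>main L\<^esub>(rect L ` insert p T))"
        unfolding eq using cl by (auto simp: C.cle_meet_iff)
    qed
  qed
  obtain S where S: "S \<subseteq> carrier (pos L) \<times> carrier (neg L)" "r = \<Squnion>\<^bsub>main L\<^esub>(rect L ` S)"
    using r by (auto simp: fin_def)
  obtain T where T: "finite T" "T \<subseteq> carrier (pos L) \<times> carrier (neg L)" "s = \<Squnion>\<^bsub>main L\<^esub>(rect L ` T)"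
    using s by (auto simp: fin_def)
  have sc: "s \<in> carrier (main L)" using s fin_closed by auto
  have bot: "epos L \<bottom>\<^bsub>pos L\<^esub> = \<bottom>\<^bsub>main L\<^esub>" "eneg L \<bottom>\<^bsub>neg L\<^esub> = \<bottom>\<^bsub>main L\<^esub>"
    by (intro frame_map_bottom[OF frame_map_epos] frame_map_bottom[OF frame_map_eneg]
        P.complete_lattice_axioms N.complete_lattice_axioms M.complete_lattice_axioms)+
  \<comment> \<open>Taking bottom for both auxiliary summands specialises \<open>key\<close> to
    \<open>s\<close> itself.\<close>
  have s_eq: "epos L \<bottom>\<^bsub>pos L\<^esub> \<squnion>\<^bsub>main L\<^esub> eneg L \<bottom>\<^bsub>neg L\<^esub> \<squnion>\<^bsub>main L\<^esub> \<Squnion>\<^bsub>main L\<^esub>(rect L ` T) = s"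
    unfolding T(3)[symmetric] bot using sc by (simp add: M.bottom_join_eq)
  have "\<forall>x\<in>rect L ` S. cle (main L) D x s"
    using le sc rects_closed[OF S(1)] unfolding S(2) by (simp add: D.cle_sup_iff)
  moreover have "cle (main L) C x s" if x: "x \<in> rect L ` S" "cle (main L) D x s" for x
  proof -
    obtain a b where "a \<in> carrier (pos L)" "b \<in> carrier (neg L)" "x = epos L a \<sqinter>\<^bsub>main L\<^esub> eneg L b"
      using x(1) S(1) by (auto simp: rect_pair)
    then show ?thesis
      using key[OF T(1,2), of a b, THEN bspec[of _ _ "\<bottom>\<^bsub>pos L\<^esub>"], THEN bspec[of _ _ "\<bottom>\<^bsub>neg L\<^esub>"]] x(2)
      unfolding s_eq by simp
  qed
  ultimately have "\<forall>x\<in>rect L ` S. cle (main L) C x s" by blast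
  then show ?thesis
    unfolding S(2) using sc rects_closed[OF S(1)] by (simp add: C.cle_sup_iff)
qed

lemma frame_pair: "frame_pair (pos L) (neg L)"
  by (intro frame_pair.intro frame_pos frame_neg)

lemma copair_maps: "copair_maps (pos L) (neg L) (main L) (epos L) (eneg L)"
  by (intro copair_maps.intro frame_pair copair_maps_axioms.intro frame_main frame_map_epos frame_map_eneg)

lemma coprod_kernel_eq:
  "coprod_kernel L = kernel_cong (coprod (pos L) (neg L)) (copair (main L) (epos L) (eneg L))"
  by (auto simp: coprod_kernel_def kernel_cong_def)

lemma copair_surj:
  assumes "x \<in> carrier (main L)"
  shows "\<exists>D\<in>carrier (coprod (pos L) (neg L)). copair (main L) (epos L) (eneg L) D = x"
proof -
  interpret c: copair_maps "pos L" "neg L" "main L" "epos L" "eneg L" by (rule copair_maps)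
  obtain S where S: "S \<subseteq> carrier (pos L) \<times> carrier (neg L)" "x = \<Squnion>\<^bsub>main L\<^esub>(rect L ` S)"
    using sup_rects[OF assms] by blast
  let ?r = "\<lambda>(a, b). c.inl a \<sqinter>\<^bsub>coprod (pos L) (neg L)\<^esub> c.inr b"
  have r: "?r ` S \<subseteq> carrier (coprod (pos L) (neg L))"
    using S(1) by (auto intro!: c.PN.meet_closed c.inl_closed c.inr_closed)
  have "c.h (?r p) = rect L p" if "p \<in> S" for p
    using that S(1) by (auto simp: frame_map_meet[OF c.frame_map_copair] c.inl_closed c.inr_closed
        c.copair_inl c.copair_inr rect_pair)
  then have "c.h ` ?r ` S = rect L ` S"
    unfolding image_image by (intro image_cong) auto
  then have "c.h (\<Squnion>\<^bsub>coprod (pos L) (neg L)\<^esub>(?r ` S)) = x"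
    using r by (simp add: frame_map_sup[OF c.frame_map_copair] S(2))
  then show ?thesis using r c.PN.sup_closed by blast
qed

end

lemma prebiframe_coprod:
  assumes "frame P" "frame N"
  shows "prebiframe (coprod_biframe P N)"
proof -
  interpret frame_pair P N by (intro frame_pair.intro assms)
  show ?thesis
  proof (rule prebiframe.intro)
    fix D assume "D \<in> carrier (main (coprod_biframe P N))"
    then have D: "D \<in> carrier PN" by (simp add: coprod_biframe_def)
    then show "\<exists>S\<subseteq>carrier (pos (coprod_biframe P N)) \<times> carrier (neg (coprod_biframe P N)).
        D = \<Squnion>\<^bsub>main (coprod_biframe P N)\<^esub>(rect (coprod_biframe P N) ` S)"
      using coprod_subset[OF D] coprod_eq_sup_rects[OF D]
      by (intro exI[of _ D]) (simp add: coprod_biframe_def rect_def)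
  qed (simp_all add: coprod_biframe_def assms frame_coprod frame_map_inl frame_map_inr)
qed

text \<open>The copairing of \<open>f\<close> and \<open>g\<close> on the coproduct must kill the
  kernel of the surjection onto \<open>main L\<close>. Finitariness says that this kernel is
  generated by inequalities between finite joins of rectangles, and \<open>cle_fin\<close>, used in
  the coproduct, reduces those to the basic ones assumed in \<open>basic\<close>. The copairing then
  factors through the surjection.\<close>

lemma finitary_extension:
  fixes L :: "('p, 'n, 'a) biframe"
  assumes L: "finitary_biframe L" and K: "frame K"
    and f: "frame_map (pos L) K f" and g: "frame_map (neg L) K g"
    and basic: "\<And>a b c d. a \<in> carrier (pos L) \<Longrightarrow> b \<in> carrier (neg L) \<Longrightarrow>
      c \<in> carrier (pos L) \<Longrightarrow> d \<in> carrier (neg L) \<Longrightarrow>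
      epos L a \<sqinter>\<^bsub>main L\<^esub> eneg L b \<sqsubseteq>\<^bsub>main L\<^esub> epos L c \<squnion>\<^bsub>main L\<^esub> eneg L d \<Longrightarrow>
      f a \<sqinter>\<^bsub>K\<^esub> g b \<sqsubseteq>\<^bsub>K\<^esub> f c \<squnion>\<^bsub>K\<^esub> g d"
  obtains h where "frame_map (main L) K h"
    "\<And>a. a \<in> carrier (pos L) \<Longrightarrow> h (epos L a) = f a" "\<And>b. b \<in> carrier (neg L) \<Longrightarrow> h (eneg L b) = g b"
proof -
  interpret prebiframe L using L by (simp add: finitary_biframe_def is_biframe_iff)
  interpret c: copair_maps "pos L" "neg L" "main L" "epos L" "eneg L" by (rule copair_maps)
  interpret d: copair_maps "pos L" "neg L" K f g
    by (intro copair_maps.intro frame_pair copair_maps_axioms.intro K f g)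
  interpret K: frame K by fact
  let ?B = "coprod_biframe (pos L) (neg L)"
  let ?PN = "coprod (pos L) (neg L)"
  interpret B: prebiframe ?B by (intro prebiframe_coprod frame_pos frame_neg)
  have B: "pos ?B = pos L" "neg ?B = neg L" "main ?B = ?PN" "epos ?B = c.inl" "eneg ?B = c.inr"
    by (simp_all add: coprod_biframe_def)
  obtain R where R: "R \<subseteq> fin ?B \<times> fin ?B" "coprod_kernel L = generated_congruence ?PN R"
    using L unfolding finitary_biframe_def finitary_congruence_def B(3) by auto
  have Rc: "R \<subseteq> carrier ?PN \<times> carrier ?PN" using R(1) B.fin_closed unfolding B by blast
  note gen = generated_congruence[OF c.frame_coprod Rc, folded R(2)]
  interpret D: frame_cong ?PN "coprod_kernel L" by (rule gen)
  interpret C: frame_cong ?PN "kernel_cong ?PN d.h"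
    by (intro frame_congI c.frame_coprod frame_congruence_kernel[OF d.frame_map_copair] c.complete_lattice_coprod)
  have D_iff: "cle ?PN (coprod_kernel L) x y \<longleftrightarrow> c.h x \<sqsubseteq>\<^bsub>main L\<^esub> c.h y"
    if "x \<in> carrier ?PN" "y \<in> carrier ?PN" for x y
    unfolding coprod_kernel_eq using that
    by (intro cle_kernel_iff[OF c.frame_map_copair c.frame_coprod M.complete_lattice_axioms])
  have C_iff: "cle ?PN (kernel_cong ?PN d.h) x y \<longleftrightarrow> d.h x \<sqsubseteq>\<^bsub>K\<^esub> d.h y"
    if "x \<in> carrier ?PN" "y \<in> carrier ?PN" for x y
    using that by (intro cle_kernel_iff[OF d.frame_map_copair c.frame_coprod frame_imp_complete_lattice[OF K]])
  note simps = frame_map_meet[OF c.frame_map_copair] frame_map_join[OF c.frame_map_copair]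
    frame_map_meet[OF d.frame_map_copair] frame_map_join[OF d.frame_map_copair]
    c.copair_inl c.copair_inr d.copair_inl d.copair_inr c.inl_closed c.inr_closed
  \<comment> \<open>\<open>cle_fin\<close> is applied to the coproduct with its injections,
    comparing the kernel of the surjection onto \<open>main L\<close> with the kernel of the
    copairing. A basic inequality modulo the former is one that holds in \<open>L\<close>.\<close>
  have "cle (main ?B) (kernel_cong ?PN d.h) r s" if rs: "(r, s) \<in> R" for r s
  proof (rule B.cle_fin[where D = "coprod_kernel L"])
    show "frame_cong (main ?B) (kernel_cong ?PN d.h)" "frame_cong (main ?B) (coprod_kernel L)"
      unfolding B by (fact C.frame_cong_axioms D.frame_cong_axioms)+
    show "r \<in> fin ?B" "s \<in> fin ?B" using rs R by auto
    show "cle (main ?B) (coprod_kernel L) r s" unfolding B by (rule gen(2)[OF rs])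
    fix a b c' d assume "a \<in> carrier (pos ?B)" "b \<in> carrier (neg ?B)" "c' \<in> carrier (pos ?B)" "d \<in> carrier (neg ?B)"
      "cle (main ?B) (coprod_kernel L) (epos ?B a \<sqinter>\<^bsub>main ?B\<^esub> eneg ?B b) (epos ?B c' \<squnion>\<^bsub>main ?B\<^esub> eneg ?B d)"
    then show "cle (main ?B) (kernel_cong ?PN d.h) (epos ?B a \<sqinter>\<^bsub>main ?B\<^esub> eneg ?B b) (epos ?B c' \<squnion>\<^bsub>main ?B\<^esub> eneg ?B d)"
      unfolding B using basic[of a b c' d] by (simp add: D_iff C_iff simps)
  qed
  then have sub: "coprod_kernel L \<subseteq> kernel_cong ?PN d.h"
    unfolding R(2) using C.congr by (intro generated_congruence_least) (auto simp: B)
  show thesis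
  proof (rule frame_map_factor[OF c.frame_map_copair d.frame_map_copair c.complete_lattice_coprod])
    show "carrier (main L) \<subseteq> c.h ` carrier ?PN" using copair_surj by blast
    show "d.h x = d.h y" if "x \<in> carrier ?PN" "y \<in> carrier ?PN" "c.h x = c.h y" for x y
      using that sub unfolding coprod_kernel_eq by (auto simp: kernel_cong_def)
    fix h assume h: "frame_map (main L) K h" "\<And>x. x \<in> carrier ?PN \<Longrightarrow> h (c.h x) = d.h x"
    show thesis
    proof (rule that[OF h(1)])
      show "h (epos L a) = f a" if "a \<in> carrier (pos L)" for a
        using h(2)[of "c.inl a"] that by (simp add: simps)
      show "h (eneg L b) = g b" if "b \<in> carrier (neg L)" for b
        using h(2)[of "c.inr b"] that by (simp add: simps)
    qed
  qed
qed

section \<open>Quotient biframes\<close>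

locale biframe_cong = prebiframe L for L :: "('p, 'n, 'a) biframe" +
  fixes C
  assumes main_cong: "frame_cong (main L) C"

sublocale biframe_cong \<subseteq> C: frame_cong "main L" C by (rule main_cong)

context biframe_cong
begin

abbreviation QL where "QL \<equiv> quotient_biframe L C"
abbreviation qp where "qp \<equiv> \<lambda>a. cong_pos L C `` {a}"
abbreviation qn where "qn \<equiv> \<lambda>a. cong_neg L C `` {a}"

lemma QL_simps [simp]:
  "pos QL = quotient_frame (pos L) (cong_pos L C)" "neg QL = quotient_frame (neg L) (cong_neg L C)"
  "main QL = quotient_frame (main L) C"
  by (simp_all add: quotient_biframe_def)

lemma frame_map_qepos: "frame_map (pos L) C.Q (\<lambda>a. C.q (epos L a))"
  and frame_map_qeneg: "frame_map (neg L) C.Q (\<lambda>a. C.q (eneg L a))"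
  by (intro frame_map_comp[OF frame_map_epos C.frame_map_q] frame_map_comp[OF frame_map_eneg C.frame_map_q])+

text \<open>The restrictions of \<open>C\<close> to the two parts are kernels of the composites of
  the embeddings with the quotient map, hence frame congruences.\<close>

lemma cong_pos_eq: "cong_pos L C = kernel_cong (pos L) (\<lambda>a. C.q (epos L a))"
  and cong_neg_eq: "cong_neg L C = kernel_cong (neg L) (\<lambda>a. C.q (eneg L a))"
  using C.q_eq_iff[OF e_closed(1) e_closed(1)] C.q_eq_iff[OF e_closed(2) e_closed(2)]
  unfolding cong_pos_def cong_neg_def kernel_cong_def by blast+

lemma frame_cong_pos: "frame_cong (pos L) (cong_pos L C)"
  unfolding cong_pos_eq
  by (intro frame_congI frame_pos frame_congruence_kernel[OF frame_map_qepos] P.complete_lattice_axioms)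

lemma frame_cong_neg: "frame_cong (neg L) (cong_neg L C)"
  unfolding cong_neg_eq
  by (intro frame_congI frame_neg frame_congruence_kernel[OF frame_map_qeneg] N.complete_lattice_axioms)

end

sublocale biframe_cong \<subseteq> CP: frame_cong "pos L" "cong_pos L C" by (rule frame_cong_pos)
sublocale biframe_cong \<subseteq> CN: frame_cong "neg L" "cong_neg L C" by (rule frame_cong_neg)

context biframe_cong
begin

lemma epos_QL:
  assumes a: "a \<in> carrier (pos L)"
  shows "epos QL (qp a) = C.q (epos L a)"
proof -
  have "C `` (epos L ` qp a) = C.q (epos L a)"
  proof
    show "C `` (epos L ` qp a) \<subseteq> C.q (epos L a)"
      by (auto simp: cong_pos_def intro: C.cong_trans)
    show "C.q (epos L a) \<subseteq> C `` (epos L ` qp a)"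
      using CP.cong_refl[OF a] by auto
  qed
  then show ?thesis by (simp add: quotient_biframe_def)
qed

lemma eneg_QL:
  assumes a: "a \<in> carrier (neg L)"
  shows "eneg QL (qn a) = C.q (eneg L a)"
proof -
  have "C `` (eneg L ` qn a) = C.q (eneg L a)"
  proof
    show "C `` (eneg L ` qn a) \<subseteq> C.q (eneg L a)"
      by (auto simp: cong_neg_def intro: C.cong_trans)
    show "C.q (eneg L a) \<subseteq> C `` (eneg L ` qn a)"
      using CN.cong_refl[OF a] by auto
  qed
  then show ?thesis by (simp add: quotient_biframe_def)
qed

text \<open>The map defined by saturated images agrees on classes with the factorization of
  \<open>a \<mapsto> C.q (epos L a)\<close> through its kernel, which is a frame map by
  construction.\<close>

lemma frame_map_epos_QL: "frame_map (pos QL) (main QL) (epos QL)"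
proof -
  obtain g where g: "frame_map CP.Q C.Q g" "\<And>a. a \<in> carrier (pos L) \<Longrightarrow> g (qp a) = C.q (epos L a)"
    using quotient_factor[OF frame_cong_pos frame_map_qepos] unfolding cong_pos_eq by blast
  then show ?thesis
    by (auto intro!: frame_map_cong[OF g(1) CP.complete_lattice_Q] simp: CP.carrier_Q epos_QL)
qed

lemma frame_map_eneg_QL: "frame_map (neg QL) (main QL) (eneg QL)"
proof -
  obtain g where g: "frame_map CN.Q C.Q g" "\<And>a. a \<in> carrier (neg L) \<Longrightarrow> g (qn a) = C.q (eneg L a)"
    using quotient_factor[OF frame_cong_neg frame_map_qeneg] unfolding cong_neg_eq by blast
  then show ?thesis
    by (auto intro!: frame_map_cong[OF g(1) CN.complete_lattice_Q] simp: CN.carrier_Q eneg_QL)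
qed

lemma rect_QL:
  assumes "a \<in> carrier (pos L)" "b \<in> carrier (neg L)"
  shows "rect QL (qp a, qn b) = C.q (rect L (a, b))"
  using assms by (simp add: rect_def epos_QL eneg_QL C.q_meet)

lemma is_biframe_QL: "is_biframe QL"
  unfolding is_biframe_iff
proof (intro conjI prebiframe.intro)
  show "frame (pos QL)" "frame (neg QL)" "frame (main QL)"
    by (simp_all add: CP.frame_Q CN.frame_Q C.frame_Q)
  show "inj_on (epos QL) (carrier (pos QL))"
  proof (rule inj_onI)
    fix X Y assume XY: "X \<in> carrier (pos QL)" "Y \<in> carrier (pos QL)" "epos QL X = epos QL Y"
    then obtain x y where xy: "x \<in> carrier (pos L)" "y \<in> carrier (pos L)" "X = qp x" "Y = qp y"
      by (auto simp: CP.carrier_Q)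
    then have "(epos L x, epos L y) \<in> C" using XY(3) by (simp add: epos_QL C.q_eq_iff)
    then have "(x, y) \<in> cong_pos L C" using xy by (simp add: cong_pos_def)
    then show "X = Y" using xy by (simp add: CP.q_eq_iff)
  qed
  show "inj_on (eneg QL) (carrier (neg QL))"
  proof (rule inj_onI)
    fix X Y assume XY: "X \<in> carrier (neg QL)" "Y \<in> carrier (neg QL)" "eneg QL X = eneg QL Y"
    then obtain x y where xy: "x \<in> carrier (neg L)" "y \<in> carrier (neg L)" "X = qn x" "Y = qn y"
      by (auto simp: CN.carrier_Q)
    then have "(eneg L x, eneg L y) \<in> C" using XY(3) by (simp add: eneg_QL C.q_eq_iff)
    then have "(x, y) \<in> cong_neg L C" using xy by (simp add: cong_neg_def)
    then show "X = Y" using xy by (simp add: CN.q_eq_iff)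
  qed
  fix X assume "X \<in> carrier (main QL)"
  then obtain x where x: "x \<in> carrier (main L)" "X = C.q x" by (auto simp: C.carrier_Q)
  obtain S where S: "S \<subseteq> carrier (pos L) \<times> carrier (neg L)" "x = \<Squnion>\<^bsub>main L\<^esub>(rect L ` S)"
    using sup_rects[OF x(1)] by blast
  have "rect QL ` map_prod qp qn ` S = C.q ` rect L ` S"
    unfolding image_image using S(1) by (intro image_cong) (auto simp: rect_QL)
  then have "X = \<Squnion>\<^bsub>main QL\<^esub>(rect QL ` map_prod qp qn ` S)"
    unfolding x S(2) using C.q_sup[OF rects_closed[OF S(1)]] by simp
  then show "\<exists>S\<subseteq>carrier (pos QL) \<times> carrier (neg QL). X = \<Squnion>\<^bsub>main QL\<^esub>(rect QL ` S)"
    using S(1) by (intro exI[of _ "map_prod qp qn ` S"]) (auto simp: CP.carrier_Q CN.carrier_Q)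
qed (fact frame_map_epos_QL frame_map_eneg_QL)+

lemma prebiframe_QL: "prebiframe QL"
  using is_biframe_QL by (simp add: is_biframe_iff)

end

text \<open>The kernel of the coproduct of the two parts of \<open>L/C\<close> over
  \<open>L/C\<close> is shown to be generated by all inequalities between finite joins of rectangles
  that hold in \<open>L/C\<close>. The inclusion that needs work uses a map \<open>h\<close> from
  \<open>main L\<close> to the quotient of that coproduct by these inequalities. Two ideals with the
  same image in \<open>L/C\<close> lift to elements of \<open>L\<close> congruent modulo
  \<open>C\<close>, and \<open>h\<close> identifies such elements.\<close>

lemma finitary_quotient:
  fixes L :: "('p, 'n, 'a) biframe"
  assumes L: "finitary_biframe L" and C: "finitary_congruence L C"
  shows "finitary_biframe (quotient_biframe L C)"
proof -
  interpret prebiframe L using L by (simp add: finitary_biframe_def is_biframe_iff)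
  obtain R where R: "R \<subseteq> fin L \<times> fin L" "C = generated_congruence (main L) R"
    using C by (auto simp: finitary_congruence_def)
  have Rc: "R \<subseteq> carrier (main L) \<times> carrier (main L)" using R(1) fin_closed by blast
  note gen = generated_congruence[OF frame_main Rc, folded R(2)]
  interpret biframe_cong L C by unfold_locales (rule gen(1)[THEN frame_cong.congr])
  interpret QL: prebiframe QL by (rule prebiframe_QL)
  let ?B = "coprod_biframe (pos QL) (neg QL)"
  let ?PN = "coprod (pos QL) (neg QL)"
  interpret B: prebiframe ?B by (intro prebiframe_coprod QL.frame_pos QL.frame_neg)
  interpret c: copair_maps "pos QL" "neg QL" "main QL" "epos QL" "eneg QL" by (rule QL.copair_maps)
  have B: "pos ?B = pos QL" "neg ?B = neg QL" "main ?B = ?PN" "epos ?B = c.inl" "eneg ?B = c.inr"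
    by (simp_all add: coprod_biframe_def)
  \<comment> \<open>The largest candidate for a finitary set of generators: every inequality between
    elements of \<open>fin ?B\<close> that is true in the quotient.\<close>
  define R' where "R' = {(r, s) \<in> fin ?B \<times> fin ?B. c.h r \<sqsubseteq>\<^bsub>main QL\<^esub> c.h s}"
  define C' where "C' = generated_congruence ?PN R'"
  have finB: "fin ?B \<subseteq> carrier ?PN" using B.fin_closed unfolding B .
  then have R'c: "R' \<subseteq> carrier ?PN \<times> carrier ?PN" by (auto simp: R'_def)
  note gen' = generated_congruence[OF c.frame_coprod R'c, folded C'_def]
  interpret C': frame_cong ?PN C' by (rule gen')
  define f where "f = (\<lambda>a. C'.q (c.inl (qp a)))"
  define g where "g = (\<lambda>b. C'.q (c.inr (qn b)))"
  have f: "frame_map (pos L) C'.Q f"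
    unfolding f_def
    by (rule frame_map_comp[OF CP.frame_map_q[folded QL_simps(1)] frame_map_comp[OF c.frame_map_inl C'.frame_map_q]])
  have g: "frame_map (neg L) C'.Q g"
    unfolding g_def
    by (rule frame_map_comp[OF CN.frame_map_q[folded QL_simps(2)] frame_map_comp[OF c.frame_map_inr C'.frame_map_q]])
  have qpc: "qp a \<in> carrier (pos QL)" if "a \<in> carrier (pos L)" for a using that by (simp add: CP.q_closed)
  have qnc: "qn a \<in> carrier (neg QL)" if "a \<in> carrier (neg L)" for a using that by (simp add: CN.q_closed)
  \<comment> \<open>The map starts from \<open>L\<close>, not from \<open>L/C\<close>. A basic
    inequality of \<open>L\<close> persists in \<open>L/C\<close>, so its translation to the
    coproduct belongs to \<open>R'\<close>; this is the condition under which
    \<open>finitary_extension\<close> yields \<open>h\<close>.\<close>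
  obtain h where h: "frame_map (main L) C'.Q h"
    "\<And>a. a \<in> carrier (pos L) \<Longrightarrow> h (epos L a) = f a" "\<And>b. b \<in> carrier (neg L) \<Longrightarrow> h (eneg L b) = g b"
  proof (rule finitary_extension[OF L C'.frame_Q f g])
    fix a b c d assume abcd: "a \<in> carrier (pos L)" "b \<in> carrier (neg L)" "c \<in> carrier (pos L)" "d \<in> carrier (neg L)"
      and le: "epos L a \<sqinter>\<^bsub>main L\<^esub> eneg L b \<sqsubseteq>\<^bsub>main L\<^esub> epos L c \<squnion>\<^bsub>main L\<^esub> eneg L d"
    let ?r = "c.inl (qp a) \<sqinter>\<^bsub>?PN\<^esub> c.inr (qn b)" and ?s = "c.inl (qp c) \<squnion>\<^bsub>?PN\<^esub> c.inr (qn d)"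
    have "?r \<in> fin ?B" "?s \<in> fin ?B"
      using B.rect_in_fin[of "qp a" "qn b"] B.join_in_fin[of "qp c" "qn d"] abcd qpc qnc unfolding B by auto
    moreover have "c.h ?r \<sqsubseteq>\<^bsub>main QL\<^esub> c.h ?s"
      using C.q_mono[OF _ _ le] abcd qpc qnc
      by (simp add: frame_map_meet[OF c.frame_map_copair] frame_map_join[OF c.frame_map_copair] c.copair_inl c.copair_inr
          c.inl_closed c.inr_closed epos_QL eneg_QL C.q_meet frame_map_join[OF C.frame_map_q] del: QL_simps)
        (simp add: C.q_meet)
    ultimately have "C'.q ?r \<sqsubseteq>\<^bsub>C'.Q\<^esub> C'.q ?s" by (intro gen'(2)) (simp add: R'_def)
    then show "f a \<sqinter>\<^bsub>C'.Q\<^esub> g b \<sqsubseteq>\<^bsub>C'.Q\<^esub> f c \<squnion>\<^bsub>C'.Q\<^esub> g d"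
      using abcd qpc qnc by (simp add: f_def g_def C'.q_meet frame_map_join[OF C'.frame_map_q] c.inl_closed c.inr_closed del: QL_simps)
  qed blast
  \<comment> \<open>\<open>t S\<close> translates a formal join \<open>S\<close> of rectangles of
    \<open>L\<close> into the coproduct of the quotient parts. It is defined on index sets because
    an element of \<open>L\<close> may have several presentations; \<open>copair_t\<close> and
    \<open>h_t\<close> give its images in \<open>L/C\<close> and modulo \<open>C'\<close>.\<close>
  define t where "t = (\<lambda>S. \<Squnion>\<^bsub>?PN\<^esub>(rect ?B ` map_prod qp qn ` S))"
  have tS: "map_prod qp qn ` S \<subseteq> carrier (pos QL) \<times> carrier (neg QL)"
    if "S \<subseteq> carrier (pos L) \<times> carrier (neg L)" for S
    using that qpc qnc by auto
  have tr: "rect ?B ` map_prod qp qn ` S \<subseteq> carrier ?PN" if "S \<subseteq> carrier (pos L) \<times> carrier (neg L)" for S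
    using B.rects_closed[unfolded B, OF tS[OF that]] .
  have tc: "t S \<in> carrier ?PN" if "S \<subseteq> carrier (pos L) \<times> carrier (neg L)" for S
    unfolding t_def by (rule c.PN.sup_closed[OF tr[OF that]])
  have rectB: "rect ?B (qp a, qn b) = c.inl (qp a) \<sqinter>\<^bsub>?PN\<^esub> c.inr (qn b)" for a b
    by (simp only: B.rect_pair B)
  have copair_t: "c.h (t S) = C.q (\<Squnion>\<^bsub>main L\<^esub>(rect L ` S))" if S: "S \<subseteq> carrier (pos L) \<times> carrier (neg L)" for S
  proof -
    have "c.h ` rect ?B ` map_prod qp qn ` S = C.q ` rect L ` S"
      unfolding image_image
    proof (rule image_cong)
      fix p assume "p \<in> S"
      then obtain a b where p: "p = (a, b)" "a \<in> carrier (pos L)" "b \<in> carrier (neg L)" using S by auto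
      then show "c.h (rect ?B (map_prod qp qn p)) = C.q (rect L p)"
        using qpc qnc by (simp add: rectB frame_map_meet[OF c.frame_map_copair] c.copair_inl c.copair_inr
            c.inl_closed c.inr_closed epos_QL eneg_QL C.q_meet rect_pair del: QL_simps) (simp add: C.q_meet)
    qed simp
    then show ?thesis
      unfolding t_def frame_map_sup[OF c.frame_map_copair tr[OF S]]
      using C.q_sup[OF rects_closed[OF S]] by simp
  qed
  have h_t: "h (\<Squnion>\<^bsub>main L\<^esub>(rect L ` S)) = C'.q (t S)" if S: "S \<subseteq> carrier (pos L) \<times> carrier (neg L)" for S
  proof -
    have "h ` rect L ` S = C'.q ` rect ?B ` map_prod qp qn ` S"
      unfolding image_image
    proof (rule image_cong)
      fix p assume "p \<in> S"
      then obtain a b where p: "p = (a, b)" "a \<in> carrier (pos L)" "b \<in> carrier (neg L)" using S by auto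
      then show "h (rect L p) = C'.q (rect ?B (map_prod qp qn p))"
        using qpc qnc by (simp add: frame_map_rect[OF h(1)] h rectB f_def g_def C'.q_meet c.inl_closed c.inr_closed del: QL_simps)
    qed simp
    then show ?thesis
      unfolding t_def frame_map_sup[OF h(1) rects_closed[OF S]] using C'.q_sup[OF tr[OF S]] by simp
  qed
  \<comment> \<open>Here finitariness of \<open>C\<close> enters. Both sides of a generating
    inequality are joins over finite index sets, so their translations lie in \<open>fin ?B\<close>;
    as the inequality holds in \<open>L/C\<close>, the translated pair belongs to
    \<open>R'\<close>.\<close>
  have "C \<subseteq> kernel_cong (main L) h"
    unfolding R(2)
  proof (rule generated_congruence_kernel[OF h(1) frame_main C'.complete_lattice_Q Rc])
    fix r s assume rs: "(r, s) \<in> R"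
    obtain S where S: "finite S" "S \<subseteq> carrier (pos L) \<times> carrier (neg L)" "r = \<Squnion>\<^bsub>main L\<^esub>(rect L ` S)"
      using rs R(1) by (auto simp: fin_def)
    obtain T where T: "finite T" "T \<subseteq> carrier (pos L) \<times> carrier (neg L)" "s = \<Squnion>\<^bsub>main L\<^esub>(rect L ` T)"
      using rs R(1) by (auto simp: fin_def)
    have tfin: "t S \<in> fin ?B" if "finite S" "S \<subseteq> carrier (pos L) \<times> carrier (neg L)" for S
      unfolding fin_def t_def B using that tS[OF that(2)] by blast
    have "(t S, t T) \<in> R'"
      using gen(2)[OF rs] tfin[OF S(1,2)] tfin[OF T(1,2)] copair_t[OF S(2)] copair_t[OF T(2)]
      unfolding R'_def S(3) T(3) by simp
    then show "h r \<sqsubseteq>\<^bsub>C'.Q\<^esub> h s" using gen'(2) by (simp add: S(3) T(3) h_t[OF S(2)] h_t[OF T(2)])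
  qed
  note C_ker = this
  have "coprod_kernel QL = C'"
  proof
    show "C' \<subseteq> coprod_kernel QL"
      unfolding C'_def QL.coprod_kernel_eq
      by (rule generated_congruence_kernel[OF c.frame_map_copair c.frame_coprod QL.M.complete_lattice_axioms R'c])
        (simp add: R'_def)
    show "coprod_kernel QL \<subseteq> C'"
    proof clarify
      fix D E assume "(D, E) \<in> coprod_kernel QL"
      then have DE: "D \<in> carrier ?PN" "E \<in> carrier ?PN" "c.h D = c.h E" by (auto simp: coprod_kernel_def)
      \<comment> \<open>Every ideal is the join of its own rectangles, and these lift to rectangles
        of \<open>L\<close> because the quotient maps on the parts are surjective.\<close>
      have "\<exists>S \<subseteq> carrier (pos L) \<times> carrier (neg L). D = t S" if "D \<in> carrier ?PN" for D
      proof -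
        let ?S = "{p \<in> carrier (pos L) \<times> carrier (neg L). map_prod qp qn p \<in> D}"
        have "map_prod qp qn ` ?S = D"
        proof
          show "D \<subseteq> map_prod qp qn ` ?S"
          proof clarify
            fix X Y assume XY: "(X, Y) \<in> D"
            then have "X \<in> carrier CP.Q" "Y \<in> carrier CN.Q" using c.coprod_subset[OF that] by auto
            then obtain a b where ab: "a \<in> carrier (pos L)" "b \<in> carrier (neg L)" "X = qp a" "Y = qn b"
              unfolding CP.carrier_Q CN.carrier_Q by blast
            show "(X, Y) \<in> map_prod qp qn ` ?S"
              by (rule image_eqI[of _ _ "(a, b)"]) (use ab XY in auto)
          qed
        qed auto
        then have "t ?S = \<Squnion>\<^bsub>?PN\<^esub>(rect ?B ` D)"
          unfolding t_def by (rule arg_cong)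
        also have "rect ?B = (\<lambda>(a, b). c.inl a \<sqinter>\<^bsub>?PN\<^esub> c.inr b)"
          unfolding rect_def B ..
        also have "\<Squnion>\<^bsub>?PN\<^esub>((\<lambda>(a, b). c.inl a \<sqinter>\<^bsub>?PN\<^esub> c.inr b) ` D) = D"
          by (rule c.coprod_eq_sup_rects[OF that, symmetric])
        finally have "D = t ?S" by (rule sym)
        moreover have "?S \<subseteq> carrier (pos L) \<times> carrier (neg L)" by (rule Collect_restrict)
        ultimately show ?thesis by (intro exI[of _ ?S] conjI)
      qed
      from this[OF DE(1)] this[OF DE(2)] obtain S T where
        S: "S \<subseteq> carrier (pos L) \<times> carrier (neg L)" "D = t S" and
        T: "T \<subseteq> carrier (pos L) \<times> carrier (neg L)" "E = t T" by auto
      let ?x = "\<Squnion>\<^bsub>main L\<^esub>(rect L ` S)" and ?y = "\<Squnion>\<^bsub>main L\<^esub>(rect L ` T)"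
      have xy: "?x \<in> carrier (main L)" "?y \<in> carrier (main L)"
        using rects_closed[OF S(1)] rects_closed[OF T(1)] by auto
      have "C.q ?x = C.q ?y" using DE(3) copair_t S T by simp
      then have "(?x, ?y) \<in> C" using xy by (simp add: C.q_eq_iff)
      then have "h ?x = h ?y" using C_ker by (auto simp: kernel_cong_def)
      then have "C'.q D = C'.q E" using h_t S T by simp
      then show "(D, E) \<in> C'" using DE by (simp add: C'.q_eq_iff del: QL_simps)
    qed
  qed
  moreover have "finitary_congruence ?B C'"
    unfolding finitary_congruence_def B C'_def by (intro exI[of _ R']) (auto simp: R'_def)
  ultimately show ?thesis
    unfolding finitary_biframe_def using is_biframe_QL by (simp del: QL_simps)
qed

section \<open>Bipoints\<close>

lemma biframe_map_two_iff:
  "biframe_map L two_biframe f \<longleftrightarrow> frame_map (pos L) two (fst f) \<and> frame_map (neg L) two (snd f) \<and>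
    (\<exists>h. frame_map (main L) two h \<and> (\<forall>a\<in>carrier (pos L). h (epos L a) = fst f a) \<and>
      (\<forall>b\<in>carrier (neg L). h (eneg L b) = snd f b))"
  by (simp add: biframe_map_def two_biframe_def)

text \<open>\<open>biframe_map\<close> only asserts that a map on the main component exists, so one
  is chosen. On the carrier it is unique by \<open>frame_map_main_eq\<close>; off the carrier its
  values are arbitrary.\<close>

definition ext_point :: "('p, 'n, 'a) biframe \<Rightarrow> ('p \<Rightarrow> bool) \<times> ('n \<Rightarrow> bool) \<Rightarrow> 'a \<Rightarrow> bool" where
  "ext_point L f = (SOME h. frame_map (main L) two h \<and> (\<forall>a\<in>carrier (pos L). h (epos L a) = fst f a) \<and>
      (\<forall>b\<in>carrier (neg L). h (eneg L b) = snd f b))"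

lemma ext_point:
  assumes "f \<in> bipoints L"
  shows frame_map_ext_point: "frame_map (main L) two (ext_point L f)"
    and ext_point_epos: "\<And>a. a \<in> carrier (pos L) \<Longrightarrow> ext_point L f (epos L a) = fst f a"
    and ext_point_eneg: "\<And>b. b \<in> carrier (neg L) \<Longrightarrow> ext_point L f (eneg L b) = snd f b"
proof -
  have "\<exists>h. frame_map (main L) two h \<and> (\<forall>a\<in>carrier (pos L). h (epos L a) = fst f a) \<and>
      (\<forall>b\<in>carrier (neg L). h (eneg L b) = snd f b)"
    using assms by (simp add: bipoints_def biframe_map_two_iff)
  from someI_ex[OF this, folded ext_point_def]
  show "frame_map (main L) two (ext_point L f)"
    "\<And>a. a \<in> carrier (pos L) \<Longrightarrow> ext_point L f (epos L a) = fst f a"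
    "\<And>b. b \<in> carrier (neg L) \<Longrightarrow> ext_point L f (eneg L b) = snd f b"
    by auto
qed

lemma bipoint_frame_maps:
  assumes "f \<in> bipoints L"
  shows "frame_map (pos L) two (fst f)" "frame_map (neg L) two (snd f)"
  using assms by (auto simp: bipoints_def biframe_map_two_iff)

lemma bipoint_eqI:
  assumes "f \<in> bipoints L" "g \<in> bipoints L"
    and "\<And>a. a \<in> carrier (pos L) \<Longrightarrow> fst f a = fst g a"
    and "\<And>b. b \<in> carrier (neg L) \<Longrightarrow> snd f b = snd g b"
  shows "f = g"
  using assms by (auto simp: bipoints_def intro!: prod_eqI extensionalityI)

lemma bipointI:
  assumes h: "frame_map (main L) two h" and "complete_lattice (pos L)" "complete_lattice (neg L)"
    and f: "frame_map (pos L) two f" and g: "frame_map (neg L) two g"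
    and "\<And>a. a \<in> carrier (pos L) \<Longrightarrow> h (epos L a) = f a"
    and "\<And>b. b \<in> carrier (neg L) \<Longrightarrow> h (eneg L b) = g b"
  shows "(restrict f (carrier (pos L)), restrict g (carrier (neg L))) \<in> bipoints L"
  unfolding bipoints_def biframe_map_two_iff using assms
  by (auto intro!: frame_map_cong[OF f] frame_map_cong[OF g] exI[of _ h])

text \<open>\<open>topology\<close> is meaningful only for predicates that are topologies. Here this
  holds because \<open>V\<close> turns binary meets and all joins of \<open>L\<close> into
  intersections and unions.\<close>

lemma openin_basic_opens:
  assumes L: "complete_lattice L"
    and meet: "\<And>a b. a \<in> carrier L \<Longrightarrow> b \<in> carrier L \<Longrightarrow> V (a \<sqinter>\<^bsub>L\<^esub> b) = V a \<inter> V b"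
    and sup: "\<And>A. A \<subseteq> carrier L \<Longrightarrow> V (\<Squnion>\<^bsub>L\<^esub>A) = \<Union>(V ` A)"
  shows "openin (topology (\<lambda>U. \<exists>a\<in>carrier L. U = V a)) U \<longleftrightarrow> (\<exists>a\<in>carrier L. U = V a)"
    and "topspace (topology (\<lambda>U. \<exists>a\<in>carrier L. U = V a)) = V \<top>\<^bsub>L\<^esub>"
proof -
  interpret complete_lattice L by fact
  let ?P = "\<lambda>U. \<exists>a\<in>carrier L. U = V a"
  have "istopology ?P"
    unfolding istopology_def
  proof (intro conjI allI impI)
    fix S T assume "?P S" "?P T"
    then obtain a b where "a \<in> carrier L" "b \<in> carrier L" "S = V a" "T = V b" by blast
    then show "?P (S \<inter> T)" by (intro bexI[of _ "a \<sqinter>\<^bsub>L\<^esub> b"]) (auto simp: meet)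
  next
    fix \<K> assume K: "\<forall>U\<in>\<K>. ?P U"
    \<comment> \<open>Taking all indices of members of the family avoids choosing one index for each
      open set.\<close>
    let ?A = "{a \<in> carrier L. V a \<in> \<K>}"
    have "\<K> = V ` ?A" using K by auto
    then show "?P (\<Union>\<K>)" using sup[of ?A] by (intro bexI[of _ "\<Squnion>\<^bsub>L\<^esub>?A"]) auto
  qed
  then show op: "openin (topology ?P) U \<longleftrightarrow> ?P U" for U
    by (simp add: topology_inverse')
  have mono: "V a \<subseteq> V \<top>\<^bsub>L\<^esub>" if "a \<in> carrier L" for a
    using meet[OF that top_closed] that by (auto simp: meet_top_eq)
  show "topspace (topology ?P) = V \<top>\<^bsub>L\<^esub>"
  proof
    show "topspace (topology ?P) \<subseteq> V \<top>\<^bsub>L\<^esub>"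
      unfolding topspace_def op using mono by blast
    show "V \<top>\<^bsub>L\<^esub> \<subseteq> topspace (topology ?P)"
      by (rule openin_subset) (use op top_closed in blast)
  qed
qed

lemma openin_phi_pos:
  fixes L :: "('p, 'n, 'a) biframe"
  assumes L: "complete_lattice (pos L)"
  shows "openin (ptop (bpt L)) U \<longleftrightarrow> (\<exists>a\<in>carrier (pos L). U = phi_pos L a)"
    and "\<And>a b. a \<in> carrier (pos L) \<Longrightarrow> b \<in> carrier (pos L) \<Longrightarrow>
      phi_pos L (a \<sqinter>\<^bsub>pos L\<^esub> b) = phi_pos L a \<inter> phi_pos L b"
    and "\<And>A. A \<subseteq> carrier (pos L) \<Longrightarrow> phi_pos L (\<Squnion>\<^bsub>pos L\<^esub>A) = \<Union>(phi_pos L ` A)"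
    and "phi_pos L \<top>\<^bsub>pos L\<^esub> = bipoints L" and "phi_pos L \<bottom>\<^bsub>pos L\<^esub> = {}"
    and "topspace (ptop (bpt L)) = bipoints L"
proof -
  show meet: "phi_pos L (a \<sqinter>\<^bsub>pos L\<^esub> b) = phi_pos L a \<inter> phi_pos L b"
    if "a \<in> carrier (pos L)" "b \<in> carrier (pos L)" for a b
    using that frame_map_meet[OF bipoint_frame_maps(1)] by (fastforce simp: phi_pos_def)
  show sup: "phi_pos L (\<Squnion>\<^bsub>pos L\<^esub>A) = \<Union>(phi_pos L ` A)" if "A \<subseteq> carrier (pos L)" for A
    using that frame_map_sup[OF bipoint_frame_maps(1)] by (fastforce simp: phi_pos_def)
  show top: "phi_pos L \<top>\<^bsub>pos L\<^esub> = bipoints L"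
    using frame_map_top[OF bipoint_frame_maps(1)] by (fastforce simp: phi_pos_def)
  show "phi_pos L \<bottom>\<^bsub>pos L\<^esub> = {}"
    using sup[of "{}"] by (simp add: complete_lattice.sup_empty[OF L])
  have T: "ptop (bpt L) = topology (\<lambda>U. \<exists>a\<in>carrier (pos L). U = phi_pos L a)" by (simp add: bpt_def)
  show "openin (ptop (bpt L)) U \<longleftrightarrow> (\<exists>a\<in>carrier (pos L). U = phi_pos L a)"
    unfolding T by (rule openin_basic_opens[OF L meet sup])
  show "topspace (ptop (bpt L)) = bipoints L"
    unfolding T top[symmetric] by (rule openin_basic_opens[OF L meet sup])
qed

lemma openin_phi_neg:
  fixes L :: "('p, 'n, 'a) biframe"
  assumes L: "complete_lattice (neg L)"
  shows "openin (ntop (bpt L)) U \<longleftrightarrow> (\<exists>a\<in>carrier (neg L). U = phi_neg L a)"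
    and "\<And>a b. a \<in> carrier (neg L) \<Longrightarrow> b \<in> carrier (neg L) \<Longrightarrow>
      phi_neg L (a \<sqinter>\<^bsub>neg L\<^esub> b) = phi_neg L a \<inter> phi_neg L b"
    and "\<And>A. A \<subseteq> carrier (neg L) \<Longrightarrow> phi_neg L (\<Squnion>\<^bsub>neg L\<^esub>A) = \<Union>(phi_neg L ` A)"
    and "phi_neg L \<top>\<^bsub>neg L\<^esub> = bipoints L" and "phi_neg L \<bottom>\<^bsub>neg L\<^esub> = {}"
    and "topspace (ntop (bpt L)) = bipoints L"
proof -
  show meet: "phi_neg L (a \<sqinter>\<^bsub>neg L\<^esub> b) = phi_neg L a \<inter> phi_neg L b"
    if "a \<in> carrier (neg L)" "b \<in> carrier (neg L)" for a b
    using that frame_map_meet[OF bipoint_frame_maps(2)] by (fastforce simp: phi_neg_def)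
  show sup: "phi_neg L (\<Squnion>\<^bsub>neg L\<^esub>A) = \<Union>(phi_neg L ` A)" if "A \<subseteq> carrier (neg L)" for A
    using that frame_map_sup[OF bipoint_frame_maps(2)] by (fastforce simp: phi_neg_def)
  show top: "phi_neg L \<top>\<^bsub>neg L\<^esub> = bipoints L"
    using frame_map_top[OF bipoint_frame_maps(2)] by (fastforce simp: phi_neg_def)
  show "phi_neg L \<bottom>\<^bsub>neg L\<^esub> = {}"
    using sup[of "{}"] by (simp add: complete_lattice.sup_empty[OF L])
  have T: "ntop (bpt L) = topology (\<lambda>U. \<exists>a\<in>carrier (neg L). U = phi_neg L a)" by (simp add: bpt_def)
  show "openin (ntop (bpt L)) U \<longleftrightarrow> (\<exists>a\<in>carrier (neg L). U = phi_neg L a)"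
    unfolding T by (rule openin_basic_opens[OF L meet sup])
  show "topspace (ntop (bpt L)) = bipoints L"
    unfolding T top[symmetric] by (rule openin_basic_opens[OF L meet sup])
qed

context prebiframe
begin

lemmas phi_pos_simps = openin_phi_pos[OF P.complete_lattice_axioms]
lemmas phi_neg_simps = openin_phi_neg[OF N.complete_lattice_axioms]

lemma points_bpt: "points (bpt L) = bipoints L"
  by (simp add: points_def phi_pos_simps)

lemma ext_point_eq:
  assumes "f \<in> bipoints L" "frame_map (main L) two h"
    "\<And>a. a \<in> carrier (pos L) \<Longrightarrow> h (epos L a) = fst f a"
    "\<And>b. b \<in> carrier (neg L) \<Longrightarrow> h (eneg L b) = snd f b" "x \<in> carrier (main L)"
  shows "ext_point L f x = h x"
  by (rule frame_map_main_eq[OF frame_map_ext_point[OF assms(1)] assms(2)])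
    (use assms ext_point[OF assms(1)] in auto)

lemma point_of_main:
  assumes h: "frame_map (main L) two h"
  obtains f where "f \<in> bipoints L" "\<And>x. x \<in> carrier (main L) \<Longrightarrow> ext_point L f x = h x"
    "\<And>a. a \<in> carrier (pos L) \<Longrightarrow> fst f a = h (epos L a)"
    "\<And>b. b \<in> carrier (neg L) \<Longrightarrow> snd f b = h (eneg L b)"
proof -
  let ?f = "(restrict (\<lambda>a. h (epos L a)) (carrier (pos L)), restrict (\<lambda>b. h (eneg L b)) (carrier (neg L)))"
  have f: "?f \<in> bipoints L"
    by (rule bipointI[OF h]) (auto intro: P.complete_lattice_axioms N.complete_lattice_axioms
        frame_map_comp[OF frame_map_epos h] frame_map_comp[OF frame_map_eneg h])
  show thesis
  proof (rule that[OF f])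
    show "ext_point L ?f x = h x" if "x \<in> carrier (main L)" for x
      by (rule ext_point_eq[OF f h _ _ that]) auto
  qed auto
qed

lemma frame_cong_point:
  assumes "f \<in> bipoints L"
  shows "frame_cong (main L) (kernel_cong (main L) (ext_point L f))"
  by (intro frame_congI frame_main frame_congruence_kernel[OF frame_map_ext_point[OF assms]] M.complete_lattice_axioms)

lemma cle_point_iff:
  assumes "f \<in> bipoints L" "x \<in> carrier (main L)" "y \<in> carrier (main L)"
  shows "cle (main L) (kernel_cong (main L) (ext_point L f)) x y \<longleftrightarrow> (ext_point L f x \<longrightarrow> ext_point L f y)"
  using cle_kernel_iff[OF frame_map_ext_point[OF assms(1)] frame_main frame_imp_complete_lattice[OF frame_two] assms(2,3)]
  by (simp add: le_bool_def)

lemma ext_point_rect: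
  assumes "f \<in> bipoints L" "a \<in> carrier (pos L)" "b \<in> carrier (neg L)"
  shows "ext_point L f (epos L a \<sqinter>\<^bsub>main L\<^esub> eneg L b) \<longleftrightarrow> fst f a \<and> snd f b"
  using assms by (simp add: frame_map_meet[OF frame_map_ext_point[OF assms(1)]] ext_point)

lemma ext_point_join:
  assumes "f \<in> bipoints L" "a \<in> carrier (pos L)" "b \<in> carrier (neg L)"
  shows "ext_point L f (epos L a \<squnion>\<^bsub>main L\<^esub> eneg L b) \<longleftrightarrow> fst f a \<or> snd f b"
  using assms by (simp add: frame_map_join[OF frame_map_ext_point[OF assms(1)]] ext_point)

end

section \<open>Bipoints of a quotient biframe\<close>

context biframe_cong
begin

text \<open>Factoring through the two quotient parts is the same as factoring the extension to the
  main component: if \<open>f\<close> comes from \<open>g\<close>, uniqueness of extensions makes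
  \<open>ext_point L f\<close> the composite of \<open>ext_point QL g\<close> with the quotient map.
  Conversely, a map to \<open>two\<close> whose kernel contains \<open>C\<close> descends to
  \<open>L/C\<close>.\<close>

lemma bpt_biquotient_eq: "bpt_biquotient L C = {f \<in> bipoints L. C \<subseteq> kernel_cong (main L) (ext_point L f)}"
  and bipoint_QL_restricts: "\<And>g. g \<in> bipoints QL \<Longrightarrow> \<exists>f\<in>bpt_biquotient L C.
     (\<forall>a\<in>carrier (pos L). fst f a = fst g (qp a)) \<and> (\<forall>a\<in>carrier (neg L). snd f a = snd g (qn a))"
proof -
  interpret QL: prebiframe QL by (rule prebiframe_QL)
  have ext: "ext_point L f x = ext_point QL g (C.q x)"
    if fg: "f \<in> bipoints L" "g \<in> bipoints QL" "\<forall>a\<in>carrier (pos L). fst f a = fst g (qp a)"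
      "\<forall>a\<in>carrier (neg L). snd f a = snd g (qn a)" and x: "x \<in> carrier (main L)" for f g x
  proof (rule ext_point_eq[OF fg(1) _ _ _ x])
    show "frame_map (main L) two (\<lambda>x. ext_point QL g (C.q x))"
      using frame_map_comp[OF C.frame_map_q frame_map_ext_point[OF fg(2), unfolded QL_simps]] .
    show "ext_point QL g (C.q (epos L a)) = fst f a" if "a \<in> carrier (pos L)" for a
      using that fg(3) ext_point_epos[OF fg(2), of "qp a"] by (simp add: epos_QL CP.q_closed)
    show "ext_point QL g (C.q (eneg L b)) = snd f b" if "b \<in> carrier (neg L)" for b
      using that fg(4) ext_point_eneg[OF fg(2), of "qn b"] by (simp add: eneg_QL CN.q_closed)
  qed
  show *: "bpt_biquotient L C = {f \<in> bipoints L. C \<subseteq> kernel_cong (main L) (ext_point L f)}"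
  proof (intro equalityI subsetI)
    fix f assume "f \<in> bpt_biquotient L C"
    then obtain g where fg: "f \<in> bipoints L" "g \<in> bipoints QL" "\<forall>a\<in>carrier (pos L). fst f a = fst g (qp a)"
      "\<forall>a\<in>carrier (neg L). snd f a = snd g (qn a)"
      unfolding bpt_biquotient_def by blast
    have "(x, y) \<in> kernel_cong (main L) (ext_point L f)" if xy: "(x, y) \<in> C" for x y
      using ext[OF fg] C.cong_closed[OF xy] xy C.q_eq_iff[of x y] by (simp add: kernel_cong_def)
    then show "f \<in> {f \<in> bipoints L. C \<subseteq> kernel_cong (main L) (ext_point L f)}" using fg(1) by auto
  next
    fix f assume "f \<in> {f \<in> bipoints L. C \<subseteq> kernel_cong (main L) (ext_point L f)}"
    then have f: "f \<in> bipoints L" "C \<subseteq> kernel_cong (main L) (ext_point L f)" by auto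
    obtain g0 where g0: "frame_map C.Q two g0" "\<And>x. x \<in> carrier (main L) \<Longrightarrow> g0 (C.q x) = ext_point L f x"
      using quotient_factor[OF main_cong frame_map_ext_point[OF f(1)] f(2)] by blast
    have "frame_map (main QL) two g0" using g0(1) by simp
    then obtain g where g: "g \<in> bipoints QL"
      "\<And>a. a \<in> carrier (pos QL) \<Longrightarrow> fst g a = g0 (epos QL a)"
      "\<And>a. a \<in> carrier (neg QL) \<Longrightarrow> snd g a = g0 (eneg QL a)"
      by (rule QL.point_of_main) blast
    have "\<forall>a\<in>carrier (pos L). fst f a = fst g (qp a)" "\<forall>a\<in>carrier (neg L). snd f a = snd g (qn a)"
      using g(2,3) g0(2) ext_point[OF f(1)] by (simp_all add: CP.q_closed CN.q_closed epos_QL eneg_QL)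
    then show "f \<in> bpt_biquotient L C" using f(1) g(1) unfolding bpt_biquotient_def by blast
  qed
  fix g assume g: "g \<in> bipoints QL"
  have "frame_map (main L) two (\<lambda>x. ext_point QL g (C.q x))"
    using frame_map_comp[OF C.frame_map_q frame_map_ext_point[OF g, unfolded QL_simps]] .
  then obtain f where f: "f \<in> bipoints L"
    "\<And>a. a \<in> carrier (pos L) \<Longrightarrow> fst f a = ext_point QL g (C.q (epos L a))"
    "\<And>b. b \<in> carrier (neg L) \<Longrightarrow> snd f b = ext_point QL g (C.q (eneg L b))"
    by (rule point_of_main) blast
  have "fst f a = fst g (qp a)" if "a \<in> carrier (pos L)" for a
    using ext_point_epos[OF g, of "qp a"] f(2)[OF that] that by (simp add: CP.q_closed epos_QL)
  moreover have "snd f a = snd g (qn a)" if "a \<in> carrier (neg L)" for a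
    using ext_point_eneg[OF g, of "qn a"] f(3)[OF that] that by (simp add: CN.q_closed eneg_QL)
  ultimately have fg: "\<forall>a\<in>carrier (pos L). fst f a = fst g (qp a)"
    "\<forall>a\<in>carrier (neg L). snd f a = snd g (qn a)" by auto
  then show "\<exists>f\<in>bpt_biquotient L C.
     (\<forall>a\<in>carrier (pos L). fst f a = fst g (qp a)) \<and> (\<forall>a\<in>carrier (neg L). snd f a = snd g (qn a))"
    using f(1) g unfolding bpt_biquotient_def by blast
qed

text \<open>Bipoints of \<open>L/C\<close> and the members of \<open>bpt_biquotient L C\<close>
  restrict to one another with the same truth values. This moves the bispatiality test for the
  quotient back to bipoints of \<open>L\<close>.\<close>

lemma phi_QL_subset_iff:
  assumes "a \<in> carrier (pos L)" "b \<in> carrier (neg L)" "c \<in> carrier (pos L)" "d \<in> carrier (neg L)"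
  shows "phi_pos QL (qp a) \<inter> phi_neg QL (qn b) \<subseteq> phi_pos QL (qp c) \<union> phi_neg QL (qn d) \<longleftrightarrow>
    phi_pos L a \<inter> phi_neg L b \<inter> bpt_biquotient L C \<subseteq> phi_pos L c \<union> phi_neg L d"
proof
  assume l: "phi_pos QL (qp a) \<inter> phi_neg QL (qn b) \<subseteq> phi_pos QL (qp c) \<union> phi_neg QL (qn d)"
  show "phi_pos L a \<inter> phi_neg L b \<inter> bpt_biquotient L C \<subseteq> phi_pos L c \<union> phi_neg L d"
  proof
    fix f assume f: "f \<in> phi_pos L a \<inter> phi_neg L b \<inter> bpt_biquotient L C"
    then obtain g where g: "g \<in> bipoints QL" "\<forall>a\<in>carrier (pos L). fst f a = fst g (qp a)"
      "\<forall>a\<in>carrier (neg L). snd f a = snd g (qn a)"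
      unfolding bpt_biquotient_def by blast
    then have "g \<in> phi_pos QL (qp a) \<inter> phi_neg QL (qn b)" using f assms by (simp add: phi_pos_def phi_neg_def)
    then have "g \<in> phi_pos QL (qp c) \<union> phi_neg QL (qn d)" using l by blast
    then show "f \<in> phi_pos L c \<union> phi_neg L d" using f g assms by (simp add: phi_pos_def phi_neg_def)
  qed
next
  assume r: "phi_pos L a \<inter> phi_neg L b \<inter> bpt_biquotient L C \<subseteq> phi_pos L c \<union> phi_neg L d"
  show "phi_pos QL (qp a) \<inter> phi_neg QL (qn b) \<subseteq> phi_pos QL (qp c) \<union> phi_neg QL (qn d)"
  proof
    fix g assume g: "g \<in> phi_pos QL (qp a) \<inter> phi_neg QL (qn b)"
    then have gb: "g \<in> bipoints QL" by (simp add: phi_pos_def)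
    obtain f where f: "f \<in> bpt_biquotient L C" "\<forall>a\<in>carrier (pos L). fst f a = fst g (qp a)"
      "\<forall>a\<in>carrier (neg L). snd f a = snd g (qn a)"
      using bipoint_QL_restricts[OF gb] by blast
    moreover have fb: "f \<in> bipoints L" using f(1) by (simp add: bpt_biquotient_def)
    ultimately have "f \<in> phi_pos L a \<inter> phi_neg L b \<inter> bpt_biquotient L C"
      using g assms by (simp add: phi_pos_def phi_neg_def)
    then have "f \<in> phi_pos L c \<union> phi_neg L d" using r by blast
    then show "g \<in> phi_pos QL (qp c) \<union> phi_neg QL (qn d)" using f fb gb assms by (simp add: phi_pos_def phi_neg_def)
  qed
qed

end

section \<open>Bispatial biframes\<close>

lemma bOmega_fin_sel:
  "pos (bOmega_fin X) = opens_frame (ptop X)" "neg (bOmega_fin X) = opens_frame (ntop X)"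
  "main (bOmega_fin X) = quotient_frame (coprod (opens_frame (ptop X)) (opens_frame (ntop X)))
     (generated_congruence (coprod (opens_frame (ptop X)) (opens_frame (ntop X))) (bOmega_relation X))"
  "epos (bOmega_fin X) = (\<lambda>U. generated_congruence (coprod (opens_frame (ptop X)) (opens_frame (ntop X)))
     (bOmega_relation X) `` {coprod_inl (opens_frame (ptop X)) (opens_frame (ntop X)) U})"
  "eneg (bOmega_fin X) = (\<lambda>U. generated_congruence (coprod (opens_frame (ptop X)) (opens_frame (ntop X)))
     (bOmega_relation X) `` {coprod_inr (opens_frame (ptop X)) (opens_frame (ntop X)) U})"
  by (simp_all add: bOmega_fin_def Let_def)

locale bispace_opens =
  fixes X :: "'x bispace"
begin

abbreviation P where "P \<equiv> opens_frame (ptop X)"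
abbreviation N where "N \<equiv> opens_frame (ntop X)"
abbreviation R where "R \<equiv> bOmega_relation X"
abbreviation C where "C \<equiv> generated_congruence (coprod P N) R"

sublocale frame_pair P N by (intro frame_pair.intro frame_opens_frame)

lemma R_iff:
  "(r, s) \<in> R \<longleftrightarrow> (\<exists>U U' V V'. openin (ptop X) U \<and> openin (ntop X) U' \<and> openin (ptop X) V \<and> openin (ntop X) V' \<and>
    U \<inter> U' \<subseteq> V \<union> V' \<and> r = inl U \<sqinter>\<^bsub>PN\<^esub> inr U' \<and> s = inl V \<squnion>\<^bsub>PN\<^esub> inr V')"
  by (auto simp: bOmega_relation_def Let_def)

lemma io_closed [simp]:
  "openin (ptop X) U \<Longrightarrow> inl U \<in> carrier PN" "openin (ntop X) V \<Longrightarrow> inr V \<in> carrier PN"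
  by (auto intro: inl_closed inr_closed)

lemma R_closed: "R \<subseteq> carrier PN \<times> carrier PN"
  unfolding subset_iff by (auto simp: R_iff)

sublocale C: frame_cong PN C by (rule generated_congruence(1)[OF frame_coprod R_closed])

lemma C_le:
  assumes "openin (ptop X) U" "openin (ntop X) U'" "openin (ptop X) V" "openin (ntop X) V'" "U \<inter> U' \<subseteq> V \<union> V'"
  shows "C.q (inl U) \<sqinter>\<^bsub>C.Q\<^esub> C.q (inr U') \<sqsubseteq>\<^bsub>C.Q\<^esub> C.q (inl V) \<squnion>\<^bsub>C.Q\<^esub> C.q (inr V')"
proof -
  have "C.q (inl U \<sqinter>\<^bsub>PN\<^esub> inr U') \<sqsubseteq>\<^bsub>C.Q\<^esub> C.q (inl V \<squnion>\<^bsub>PN\<^esub> inr V')"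
    using assms by (intro generated_congruence(2)[OF frame_coprod R_closed]) (auto simp: R_iff)
  then show ?thesis using assms by (simp add: C.q_meet frame_map_join[OF C.frame_map_q])
qed

lemma frame_map_bOmega_epos: "frame_map P C.Q (\<lambda>U. C.q (inl U))"
  and frame_map_bOmega_eneg: "frame_map N C.Q (\<lambda>U. C.q (inr U))"
  by (intro frame_map_comp[OF frame_map_inl C.frame_map_q] frame_map_comp[OF frame_map_inr C.frame_map_q])+

text \<open>The counterpart of \<open>finitary_extension\<close> for the biframe of opens. Its
  defining relation consists of basic inequalities already, so no reduction from finite joins is
  needed before factoring the copairing.\<close>

lemma bOmega_fin_extension:
  assumes K: "frame K" and f: "frame_map P K f" and g: "frame_map N K g"
    and basic: "\<And>U U' V V'. openin (ptop X) U \<Longrightarrow> openin (ntop X) U' \<Longrightarrow> openin (ptop X) V \<Longrightarrow> openin (ntop X) V' \<Longrightarrow>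
      U \<inter> U' \<subseteq> V \<union> V' \<Longrightarrow> f U \<sqinter>\<^bsub>K\<^esub> g U' \<sqsubseteq>\<^bsub>K\<^esub> f V \<squnion>\<^bsub>K\<^esub> g V'"
  obtains h where "frame_map (main (bOmega_fin X)) K h"
    "\<And>U. openin (ptop X) U \<Longrightarrow> h (epos (bOmega_fin X) U) = f U"
    "\<And>U. openin (ntop X) U \<Longrightarrow> h (eneg (bOmega_fin X) U) = g U"
proof -
  interpret c: copair_maps P N K f g
    by (intro copair_maps.intro frame_pair_axioms copair_maps_axioms.intro K f g)
  have "C \<subseteq> kernel_cong PN c.h"
  proof (rule generated_congruence_kernel[OF c.frame_map_copair frame_coprod frame_imp_complete_lattice[OF K] R_closed])
    fix r s assume "(r, s) \<in> R"
    then show "c.h r \<sqsubseteq>\<^bsub>K\<^esub> c.h s"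
      unfolding R_iff by (auto simp: frame_map_meet[OF c.frame_map_copair] frame_map_join[OF c.frame_map_copair]
          c.copair_inl c.copair_inr intro: basic)
  qed
  then obtain h where h: "frame_map C.Q K h" "\<And>x. x \<in> carrier PN \<Longrightarrow> h (C.q x) = c.h x"
    using quotient_factor[OF C.frame_cong_axioms c.frame_map_copair] by blast
  show thesis
    by (rule that[of h]) (simp_all add: bOmega_fin_sel h c.copair_inl c.copair_inr)
qed

lemma bOmega_fin_map_le:
  assumes K: "frame K" and h: "frame_map (main (bOmega_fin X)) K h"
    and op: "openin (ptop X) U" "openin (ntop X) U'" "openin (ptop X) V" "openin (ntop X) V'" "U \<inter> U' \<subseteq> V \<union> V'"
  shows "h (epos (bOmega_fin X) U) \<sqinter>\<^bsub>K\<^esub> h (eneg (bOmega_fin X) U') \<sqsubseteq>\<^bsub>K\<^esub>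
    h (epos (bOmega_fin X) V) \<squnion>\<^bsub>K\<^esub> h (eneg (bOmega_fin X) V')"
proof -
  interpret Q: frame C.Q by (rule C.frame_Q)
  have h': "frame_map C.Q K h" using h by (simp add: bOmega_fin_sel)
  have "h (C.q (inl U) \<sqinter>\<^bsub>C.Q\<^esub> C.q (inr U')) \<sqsubseteq>\<^bsub>K\<^esub> h (C.q (inl V) \<squnion>\<^bsub>C.Q\<^esub> C.q (inr V'))"
    using op by (intro frame_map_mono[OF h' C.complete_lattice_Q frame_imp_complete_lattice[OF K]] C_le)
      (simp_all add: C.q_closed)
  then show ?thesis
    using op by (simp add: bOmega_fin_sel frame_map_meet[OF h'] frame_map_join[OF h'] C.q_closed)
qed

end

text \<open>An inverse of the spatialization carries an inequality that holds in
  \<open>bOmega_fin\<close> by construction back to \<open>L\<close>. Conversely, reflecting basic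
  inequalities makes \<open>phi_pos L\<close> and \<open>phi_neg L\<close> injective, and both they
  and their inverses extend to the main components: the former by finitariness of \<open>L\<close>,
  the latter by the relation that defines \<open>bOmega_fin\<close>.\<close>

lemma bispatial_iff:
  fixes L :: "('p, 'n, 'a) biframe"
  assumes L: "finitary_biframe L"
  shows "bispatial L \<longleftrightarrow> (\<forall>a\<in>carrier (pos L). \<forall>b\<in>carrier (neg L). \<forall>c\<in>carrier (pos L). \<forall>d\<in>carrier (neg L).
    phi_pos L a \<inter> phi_neg L b \<subseteq> phi_pos L c \<union> phi_neg L d \<longrightarrow>
    epos L a \<sqinter>\<^bsub>main L\<^esub> eneg L b \<sqsubseteq>\<^bsub>main L\<^esub> epos L c \<squnion>\<^bsub>main L\<^esub> eneg L d)"
proof -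
  have bi: "is_biframe L" using L by (simp add: finitary_biframe_def)
  interpret prebiframe L using bi by (simp add: is_biframe_iff)
  have inj: "inj_on (epos L) (carrier (pos L))" "inj_on (eneg L) (carrier (neg L))"
    using bi by (simp_all add: is_biframe_iff)
  interpret X: bispace_opens "bpt L" .
  let ?B = "bOmega_fin (bpt L)"
  have op: "openin (ptop (bpt L)) (phi_pos L a)" if "a \<in> carrier (pos L)" for a
    using that phi_pos_simps(1) by blast
  have on: "openin (ntop (bpt L)) (phi_neg L a)" if "a \<in> carrier (neg L)" for a
    using that phi_neg_simps(1) by blast
  show ?thesis
  proof (intro iffI ballI impI)
    fix a b c d assume abcd: "a \<in> carrier (pos L)" "b \<in> carrier (neg L)" "c \<in> carrier (pos L)" "d \<in> carrier (neg L)"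
      and sub: "phi_pos L a \<inter> phi_neg L b \<subseteq> phi_pos L c \<union> phi_neg L d" and "bispatial L"
    then obtain g where g: "biframe_map ?B L g" "\<forall>a\<in>carrier (pos L). fst g (phi_pos L a) = a"
      "\<forall>b\<in>carrier (neg L). snd g (phi_neg L b) = b"
      by (auto simp: bispatial_def biframe_iso_def)
    then obtain h where h: "frame_map (main ?B) (main L) h"
      "\<And>U. openin (ptop (bpt L)) U \<Longrightarrow> h (epos ?B U) = epos L (fst g U)"
      "\<And>U. openin (ntop (bpt L)) U \<Longrightarrow> h (eneg ?B U) = eneg L (snd g U)"
      by (auto simp: biframe_map_def bOmega_fin_sel(1,2))
    show "epos L a \<sqinter>\<^bsub>main L\<^esub> eneg L b \<sqsubseteq>\<^bsub>main L\<^esub> epos L c \<squnion>\<^bsub>main L\<^esub> eneg L d"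
      using X.bOmega_fin_map_le[OF frame_main h(1) op on op on sub, OF abcd] abcd g
      by (simp add: h op on)
  next
    assume r: "\<forall>a\<in>carrier (pos L). \<forall>b\<in>carrier (neg L). \<forall>c\<in>carrier (pos L). \<forall>d\<in>carrier (neg L).
      phi_pos L a \<inter> phi_neg L b \<subseteq> phi_pos L c \<union> phi_neg L d \<longrightarrow>
      epos L a \<sqinter>\<^bsub>main L\<^esub> eneg L b \<sqsubseteq>\<^bsub>main L\<^esub> epos L c \<squnion>\<^bsub>main L\<^esub> eneg L d"
    have phip: "frame_map (pos L) X.P (phi_pos L)"
    proof (rule frame_mapI)
      fix A assume A: "A \<subseteq> carrier (pos L)"
      then have "phi_pos L ` A \<subseteq> {U. openin (ptop (bpt L)) U}" using op by auto
      then show "phi_pos L (\<Squnion>\<^bsub>pos L\<^esub>A) = \<Squnion>\<^bsub>X.P\<^esub>(phi_pos L ` A)"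
        using A by (simp add: phi_pos_simps(3) opens_frame_simps)
    qed (simp_all add: op opens_frame_simps phi_pos_simps(2,4,6))
    have phin: "frame_map (neg L) X.N (phi_neg L)"
    proof (rule frame_mapI)
      fix A assume A: "A \<subseteq> carrier (neg L)"
      then have "phi_neg L ` A \<subseteq> {U. openin (ntop (bpt L)) U}" using on by auto
      then show "phi_neg L (\<Squnion>\<^bsub>neg L\<^esub>A) = \<Squnion>\<^bsub>X.N\<^esub>(phi_neg L ` A)"
        using A by (simp add: phi_neg_simps(3) opens_frame_simps)
    qed (simp_all add: on opens_frame_simps phi_neg_simps(2,4,6))
    have bot: "epos L \<bottom>\<^bsub>pos L\<^esub> = \<bottom>\<^bsub>main L\<^esub>" "eneg L \<bottom>\<^bsub>neg L\<^esub> = \<bottom>\<^bsub>main L\<^esub>"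
      by (intro frame_map_bottom[OF frame_map_epos] frame_map_bottom[OF frame_map_eneg]
          P.complete_lattice_axioms N.complete_lattice_axioms M.complete_lattice_axioms)+
    have top: "epos L \<top>\<^bsub>pos L\<^esub> = \<top>\<^bsub>main L\<^esub>" "eneg L \<top>\<^bsub>neg L\<^esub> = \<top>\<^bsub>main L\<^esub>"
      by (rule frame_map_top[OF frame_map_epos] frame_map_top[OF frame_map_eneg])+
    \<comment> \<open>With top as second factor on the left and bottom as second summand on the
      right, a basic inequality becomes one between positive elements alone.\<close>
    have lep: "epos L a \<sqsubseteq>\<^bsub>main L\<^esub> epos L c" if "a \<in> carrier (pos L)" "c \<in> carrier (pos L)" "phi_pos L a \<subseteq> phi_pos L c" for a c
      using r[rule_format, of a "\<top>\<^bsub>neg L\<^esub>" c "\<bottom>\<^bsub>neg L\<^esub>"] that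
      by (auto simp: top bot M.meet_top_eq M.join_bottom_eq)
    have len: "eneg L b \<sqsubseteq>\<^bsub>main L\<^esub> eneg L d" if "b \<in> carrier (neg L)" "d \<in> carrier (neg L)" "phi_neg L b \<subseteq> phi_neg L d" for b d
      using r[rule_format, of "\<top>\<^bsub>pos L\<^esub>" b "\<bottom>\<^bsub>pos L\<^esub>" d] that
      by (auto simp: top bot M.top_meet_eq M.bottom_join_eq)
    have injp: "a = c" if "a \<in> carrier (pos L)" "c \<in> carrier (pos L)" "phi_pos L a = phi_pos L c" for a c
      using lep[of a c] lep[of c a] that inj(1) M.le_antisym[of "epos L a" "epos L c"] by (simp add: inj_on_eq_iff)
    have injn: "a = c" if "a \<in> carrier (neg L)" "c \<in> carrier (neg L)" "phi_neg L a = phi_neg L c" for a c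
      using len[of a c] len[of c a] that inj(2) M.le_antisym[of "eneg L a" "eneg L c"] by (simp add: inj_on_eq_iff)
    have idp: "frame_map (pos L) (pos L) (\<lambda>x. x)" and idn: "frame_map (neg L) (neg L) (\<lambda>x. x)"
      by (auto intro: frame_mapI)
    \<comment> \<open>The inverse is the factorization of the identity through the surjective map
      \<open>phi_pos L\<close>, with injectivity as its kernel condition.\<close>
    obtain gp where gp: "frame_map X.P (pos L) gp" "\<And>a. a \<in> carrier (pos L) \<Longrightarrow> gp (phi_pos L a) = a"
      by (rule frame_map_factor[OF phip idp P.complete_lattice_axioms]) (auto simp: phi_pos_simps(1) injp)
    obtain gn where gn: "frame_map X.N (neg L) gn" "\<And>a. a \<in> carrier (neg L) \<Longrightarrow> gn (phi_neg L a) = a"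
      by (rule frame_map_factor[OF phin idn N.complete_lattice_axioms]) (auto simp: phi_neg_simps(1) injn)
    have "biframe_map L ?B (phi_pos L, phi_neg L)"
    proof -
      obtain h where "frame_map (main L) X.C.Q h"
        "\<And>a. a \<in> carrier (pos L) \<Longrightarrow> h (epos L a) = X.C.q (X.inl (phi_pos L a))"
        "\<And>b. b \<in> carrier (neg L) \<Longrightarrow> h (eneg L b) = X.C.q (X.inr (phi_neg L b))"
      proof (rule finitary_extension[OF L X.C.frame_Q frame_map_comp[OF phip X.frame_map_bOmega_epos]
            frame_map_comp[OF phin X.frame_map_bOmega_eneg]])
        fix a b c d assume abcd: "a \<in> carrier (pos L)" "b \<in> carrier (neg L)" "c \<in> carrier (pos L)" "d \<in> carrier (neg L)"
          and le: "epos L a \<sqinter>\<^bsub>main L\<^esub> eneg L b \<sqsubseteq>\<^bsub>main L\<^esub> epos L c \<squnion>\<^bsub>main L\<^esub> eneg L d"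
        have "phi_pos L a \<inter> phi_neg L b \<subseteq> phi_pos L c \<union> phi_neg L d"
        proof
          fix f assume f: "f \<in> phi_pos L a \<inter> phi_neg L b"
          then have fb: "f \<in> bipoints L" by (simp add: phi_pos_def)
          have "ext_point L f (epos L a \<sqinter>\<^bsub>main L\<^esub> eneg L b) \<longrightarrow> ext_point L f (epos L c \<squnion>\<^bsub>main L\<^esub> eneg L d)"
            using frame_map_mono[OF frame_map_ext_point[OF fb] M.complete_lattice_axioms frame_imp_complete_lattice[OF frame_two] _ _ le]
              abcd by (simp add: le_bool_def)
          then show "f \<in> phi_pos L c \<union> phi_neg L d"
            using f fb abcd by (simp add: ext_point_rect ext_point_join phi_pos_def phi_neg_def)
        qed
        then show "X.C.q (X.inl (phi_pos L a)) \<sqinter>\<^bsub>X.C.Q\<^esub> X.C.q (X.inr (phi_neg L b)) \<sqsubseteq>\<^bsub>X.C.Q\<^esub>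
          X.C.q (X.inl (phi_pos L c)) \<squnion>\<^bsub>X.C.Q\<^esub> X.C.q (X.inr (phi_neg L d))"
          using abcd by (intro X.C_le op on)
      qed blast
      then show ?thesis using phip phin by (auto simp: biframe_map_def bOmega_fin_sel)
    qed
    moreover have "biframe_map ?B L (gp, gn)"
    proof -
      obtain h where "frame_map (main ?B) (main L) h"
        "\<And>U. openin (ptop (bpt L)) U \<Longrightarrow> h (epos ?B U) = epos L (gp U)"
        "\<And>U. openin (ntop (bpt L)) U \<Longrightarrow> h (eneg ?B U) = eneg L (gn U)"
      proof (rule X.bOmega_fin_extension[OF frame_main frame_map_comp[OF gp(1) frame_map_epos]
            frame_map_comp[OF gn(1) frame_map_eneg]])
        fix U U' V V' assume "openin (ptop (bpt L)) U" "openin (ntop (bpt L)) U'"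
          "openin (ptop (bpt L)) V" "openin (ntop (bpt L)) V'" and sub: "U \<inter> U' \<subseteq> V \<union> V'"
        then obtain a b c d where "a \<in> carrier (pos L)" "b \<in> carrier (neg L)" "c \<in> carrier (pos L)" "d \<in> carrier (neg L)"
          "U = phi_pos L a" "U' = phi_neg L b" "V = phi_pos L c" "V' = phi_neg L d"
          unfolding phi_pos_simps(1) phi_neg_simps(1) by blast
        then show "epos L (gp U) \<sqinter>\<^bsub>main L\<^esub> eneg L (gn U') \<sqsubseteq>\<^bsub>main L\<^esub> epos L (gp V) \<squnion>\<^bsub>main L\<^esub> eneg L (gn V')"
          using r sub by (simp add: gp gn)
      qed blast
      then show ?thesis using gp(1) gn(1) by (auto simp: biframe_map_def bOmega_fin_sel(1,2))
    qed
    ultimately have "biframe_iso L ?B (phi_pos L, phi_neg L)"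
      unfolding biframe_iso_def
      by (intro conjI exI[of _ "(gp, gn)"])
        (auto simp: gp(2) gn(2) bOmega_fin_sel(1,2) phi_pos_simps(1) phi_neg_simps(1))
    then show "bispatial L" using L by (simp add: bispatial_def)
  qed
qed

section \<open>Closed sets of bipoints\<close>

locale iso_orders = P: partial_order P + Q: partial_order Q for P :: "'a gorder" and Q :: "'b gorder" +
  fixes f
  assumes iso: "order_iso P Q f"
begin

abbreviation g where "g \<equiv> inv_into (carrier P) f"

lemma bij: "bij_betw f (carrier P) (carrier Q)"
  using iso by (simp add: order_iso_def)

lemma f_closed [simp]: "x \<in> carrier P \<Longrightarrow> f x \<in> carrier Q"
  using bij by (rule bij_betw_apply)

lemma g_closed [simp]: "y \<in> carrier Q \<Longrightarrow> g y \<in> carrier P"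
  using bij_betw_inv_into[OF bij] by (rule bij_betw_apply)

lemma fg [simp]: "y \<in> carrier Q \<Longrightarrow> f (g y) = y"
  using bij by (rule bij_betw_inv_into_right)

lemma le_iff: "x \<in> carrier P \<Longrightarrow> y \<in> carrier P \<Longrightarrow> x \<sqsubseteq>\<^bsub>P\<^esub> y \<longleftrightarrow> f x \<sqsubseteq>\<^bsub>Q\<^esub> f y"
  using iso by (auto simp: order_iso_def order_emb_def)

lemma f_eq_iff: "x \<in> carrier P \<Longrightarrow> y \<in> carrier P \<Longrightarrow> f x = f y \<longleftrightarrow> x = y"
  using bij by (auto simp: bij_betw_def inj_on_eq_iff)

lemma complete_lattice:
  assumes "complete_lattice Q"
  shows "complete_lattice P"
proof (rule complete_latticeI_sup[OF P.partial_order_axioms])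
  interpret Q: complete_lattice Q by fact
  fix A assume A: "A \<subseteq> carrier P"
  then have fA: "f ` A \<subseteq> carrier Q" by auto
  show "\<exists>s\<in>carrier P. (\<forall>a\<in>A. a \<sqsubseteq>\<^bsub>P\<^esub> s) \<and> (\<forall>y\<in>carrier P. (\<forall>a\<in>A. a \<sqsubseteq>\<^bsub>P\<^esub> y) \<longrightarrow> s \<sqsubseteq>\<^bsub>P\<^esub> y)"
  proof (intro bexI[of _ "g (\<Squnion>\<^bsub>Q\<^esub>(f ` A))"] conjI ballI impI)
    show "g (\<Squnion>\<^bsub>Q\<^esub>(f ` A)) \<in> carrier P" using fA by simp
    show "a \<sqsubseteq>\<^bsub>P\<^esub> g (\<Squnion>\<^bsub>Q\<^esub>(f ` A))" if "a \<in> A" for a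
      using that A fA Q.sup_upper[OF fA] by (subst le_iff) auto
    show "g (\<Squnion>\<^bsub>Q\<^esub>(f ` A)) \<sqsubseteq>\<^bsub>P\<^esub> y" if "y \<in> carrier P" "\<forall>a\<in>A. a \<sqsubseteq>\<^bsub>P\<^esub> y" for y
      using that A fA by (subst le_iff) (auto intro!: Q.sup_least simp: le_iff[symmetric] subset_iff)
  qed
qed

lemma f_meet:
  assumes "complete_lattice Q" "x \<in> carrier P" "y \<in> carrier P"
  shows "f (x \<sqinter>\<^bsub>P\<^esub> y) = f x \<sqinter>\<^bsub>Q\<^esub> f y"
proof -
  interpret P: complete_lattice P by (rule complete_lattice) fact
  show ?thesis
  proof (rule Q.meet_eqI[symmetric])
    fix w assume w: "w \<in> carrier Q" "w \<sqsubseteq>\<^bsub>Q\<^esub> f x" "w \<sqsubseteq>\<^bsub>Q\<^esub> f y"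
    then have "g w \<sqsubseteq>\<^bsub>P\<^esub> x \<sqinter>\<^bsub>P\<^esub> y" using assms by (intro P.meet_le) (auto simp: le_iff)
    then show "w \<sqsubseteq>\<^bsub>Q\<^esub> f (x \<sqinter>\<^bsub>P\<^esub> y)" using w assms by (simp add: le_iff)
  qed (use assms in \<open>auto simp: le_iff[symmetric] P.meet_left P.meet_right\<close>)
qed

lemma f_sup:
  assumes "complete_lattice Q" "A \<subseteq> carrier P"
  shows "f (\<Squnion>\<^bsub>P\<^esub>A) = \<Squnion>\<^bsub>Q\<^esub>(f ` A)"
proof -
  interpret P: complete_lattice P by (rule complete_lattice) fact
  show ?thesis
  proof (rule Q.sup_eqI[symmetric])
    fix w assume w: "w \<in> carrier Q" "\<And>a. a \<in> f ` A \<Longrightarrow> a \<sqsubseteq>\<^bsub>Q\<^esub> w"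
    then have "\<Squnion>\<^bsub>P\<^esub>A \<sqsubseteq>\<^bsub>P\<^esub> g w" using assms by (intro P.sup_least) (auto simp: le_iff subset_iff)
    then show "f (\<Squnion>\<^bsub>P\<^esub>A) \<sqsubseteq>\<^bsub>Q\<^esub> w" using w assms by (simp add: le_iff)
  next
    fix b assume "b \<in> f ` A"
    then obtain a where a: "a \<in> A" "b = f a" by auto
    then have "a \<sqsubseteq>\<^bsub>P\<^esub> \<Squnion>\<^bsub>P\<^esub>A" using assms by (intro P.sup_upper)
    then show "b \<sqsubseteq>\<^bsub>Q\<^esub> f (\<Squnion>\<^bsub>P\<^esub>A)" using a assms by (subst (asm) le_iff) auto
  qed (use assms in auto)
qed

lemma frame:
  assumes "frame Q"
  shows "frame P"
proof -
  interpret Q: frame Q by fact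
  note cl = Q.complete_lattice_axioms
  interpret P: complete_lattice P by (rule complete_lattice) (fact cl)
  show ?thesis
  proof (rule frameI[OF P.complete_lattice_axioms])
    fix x A z assume a: "x \<in> carrier P" "A \<subseteq> carrier P" "z \<in> carrier P" "\<And>a. a \<in> A \<Longrightarrow> x \<sqinter>\<^bsub>P\<^esub> a \<sqsubseteq>\<^bsub>P\<^esub> z"
    have "f x \<sqinter>\<^bsub>Q\<^esub> f b \<sqsubseteq>\<^bsub>Q\<^esub> f z" if "b \<in> A" for b
      using a(4)[OF that] a(1-3) that le_iff[of "x \<sqinter>\<^bsub>P\<^esub> b" z] by (auto simp: f_meet[OF cl])
    then have "f x \<sqinter>\<^bsub>Q\<^esub> \<Squnion>\<^bsub>Q\<^esub>(f ` A) \<sqsubseteq>\<^bsub>Q\<^esub> f z"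
      using a(1-3) by (subst Q.inf_Sup_distrib) (auto intro!: Q.sup_least)
    then show "x \<sqinter>\<^bsub>P\<^esub> \<Squnion>\<^bsub>P\<^esub>A \<sqsubseteq>\<^bsub>P\<^esub> z"
      using a(1-3) by (simp add: le_iff f_meet[OF cl] f_sup[OF cl])
  qed
qed

end

lemma boolean_algebra_Pow: "is_boolean_algebra (inclusion_order (Pow X))"
proof -
  let ?P = "inclusion_order (Pow X)"
  interpret complete_lattice ?P by (rule complete_lattice_inclusion_order[of X]) auto
  have s: "a \<sqinter>\<^bsub>?P\<^esub> b = a \<inter> b" "a \<squnion>\<^bsub>?P\<^esub> b = a \<union> b" if "a \<subseteq> X" "b \<subseteq> X" for a b
    using that by (simp_all add: meet_inclusion_order join_inclusion_order le_infI1)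
  have t: "\<top>\<^bsub>?P\<^esub> = X" "\<bottom>\<^bsub>?P\<^esub> = {}"
    by (auto simp: top_inclusion_order[of X] bottom_inclusion_order)
  show ?thesis
    unfolding is_boolean_algebra_def
  proof (intro conjI ballI)
    show "\<exists>y\<in>carrier ?P. x \<sqinter>\<^bsub>?P\<^esub> y = \<bottom>\<^bsub>?P\<^esub> \<and> x \<squnion>\<^bsub>?P\<^esub> y = \<top>\<^bsub>?P\<^esub>" if "x \<in> carrier ?P" for x
      using that by (intro bexI[of _ "X - x"]) (auto simp: s t)
    show "x \<sqinter>\<^bsub>?P\<^esub> (y \<squnion>\<^bsub>?P\<^esub> z) = (x \<sqinter>\<^bsub>?P\<^esub> y) \<squnion>\<^bsub>?P\<^esub> (x \<sqinter>\<^bsub>?P\<^esub> z)"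
      if "x \<in> carrier ?P" "y \<in> carrier ?P" "z \<in> carrier ?P" for x y z
    proof -
      have "x \<sqinter>\<^bsub>?P\<^esub> (y \<squnion>\<^bsub>?P\<^esub> z) = x \<inter> (y \<union> z)" using that s[of y z] s[of x "y \<union> z"] by auto
      moreover have "(x \<sqinter>\<^bsub>?P\<^esub> y) \<squnion>\<^bsub>?P\<^esub> (x \<sqinter>\<^bsub>?P\<^esub> z) = (x \<inter> y) \<union> (x \<inter> z)"
        using that s[of x y] s[of x z] s[of "x \<inter> y" "x \<inter> z"] by auto
      ultimately show ?thesis by auto
    qed
  qed (rule bounded_lattice_axioms)
qed

context iso_orders
begin

lemma f_join:
  assumes "complete_lattice Q" "x \<in> carrier P" "y \<in> carrier P"
  shows "f (x \<squnion>\<^bsub>P\<^esub> y) = f x \<squnion>\<^bsub>Q\<^esub> f y"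
  using f_sup[OF assms(1), of "{x, y}"] assms by (simp add: join_def)

lemma f_top:
  assumes "complete_lattice Q"
  shows "f \<top>\<^bsub>P\<^esub> = \<top>\<^bsub>Q\<^esub>"
proof -
  interpret P: complete_lattice P by (rule complete_lattice) fact
  have "w \<sqsubseteq>\<^bsub>Q\<^esub> f \<top>\<^bsub>P\<^esub>" if "w \<in> carrier Q" for w
    using that le_iff[of "g w" "\<top>\<^bsub>P\<^esub>"] by simp
  then show ?thesis by (intro Q.top_eqI[symmetric]) auto
qed

lemma f_bottom:
  assumes "complete_lattice Q"
  shows "f \<bottom>\<^bsub>P\<^esub> = \<bottom>\<^bsub>Q\<^esub>"
  using f_sup[OF assms, of "{}"]
  by (simp add: complete_lattice.sup_empty[OF assms] complete_lattice.sup_empty[OF complete_lattice[OF assms]])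

lemma boolean_algebra:
  assumes Q: "complete_lattice Q" and bool: "is_boolean_algebra Q"
  shows "is_boolean_algebra P"
proof -
  interpret P: complete_lattice P by (rule complete_lattice) fact
  interpret Q: complete_lattice Q by fact
  note hom = f_meet[OF Q] f_join[OF Q] f_top[OF Q] f_bottom[OF Q]
  show ?thesis
    unfolding is_boolean_algebra_def
  proof (intro conjI ballI)
    show "x \<sqinter>\<^bsub>P\<^esub> (y \<squnion>\<^bsub>P\<^esub> z) = (x \<sqinter>\<^bsub>P\<^esub> y) \<squnion>\<^bsub>P\<^esub> (x \<sqinter>\<^bsub>P\<^esub> z)"
      if xyz: "x \<in> carrier P" "y \<in> carrier P" "z \<in> carrier P" for x y z
    proof -
      have "f (x \<sqinter>\<^bsub>P\<^esub> (y \<squnion>\<^bsub>P\<^esub> z)) = f ((x \<sqinter>\<^bsub>P\<^esub> y) \<squnion>\<^bsub>P\<^esub> (x \<sqinter>\<^bsub>P\<^esub> z))"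
        using bool xyz by (simp add: hom is_boolean_algebra_def)
      then show ?thesis using xyz by (subst (asm) f_eq_iff) auto
    qed
    fix x assume x: "x \<in> carrier P"
    then obtain y where y: "y \<in> carrier Q" "f x \<sqinter>\<^bsub>Q\<^esub> y = \<bottom>\<^bsub>Q\<^esub>" "f x \<squnion>\<^bsub>Q\<^esub> y = \<top>\<^bsub>Q\<^esub>"
      using bool f_closed unfolding is_boolean_algebra_def by blast
    have "f (x \<sqinter>\<^bsub>P\<^esub> g y) = f \<bottom>\<^bsub>P\<^esub>" "f (x \<squnion>\<^bsub>P\<^esub> g y) = f \<top>\<^bsub>P\<^esub>"
      using x y by (simp_all add: hom)
    then show "\<exists>y\<in>carrier P. x \<sqinter>\<^bsub>P\<^esub> y = \<bottom>\<^bsub>P\<^esub> \<and> x \<squnion>\<^bsub>P\<^esub> y = \<top>\<^bsub>P\<^esub>"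
      using x y by (intro bexI[of _ "g y"]) (auto simp: f_eq_iff)
  qed (rule P.bounded_lattice_axioms)
qed

end

section \<open>Closure of sets of bipoints under basic inequalities\<close>

locale fin_biframe =
  fixes L :: "('p, 'n, 'a) biframe"
  assumes finitary: "finitary_biframe L"

sublocale fin_biframe \<subseteq> prebiframe L
  using finitary by (simp add: finitary_biframe_def is_biframe_iff)

context fin_biframe
begin

text \<open>Validity at all points of \<open>S\<close> of the inequality
  \<open>a \<sqinter> b \<sqsubseteq> c \<squnion> d\<close>. Membership in the carriers is included
  so that quantifiers over such quadruples need no bounds.\<close>

definition covers :: "(('p \<Rightarrow> bool) \<times> ('n \<Rightarrow> bool)) set \<Rightarrow> 'p \<Rightarrow> 'n \<Rightarrow> 'p \<Rightarrow> 'n \<Rightarrow> bool" where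
  "covers S a b c d \<longleftrightarrow> a \<in> carrier (pos L) \<and> b \<in> carrier (neg L) \<and> c \<in> carrier (pos L) \<and> d \<in> carrier (neg L) \<and>
     phi_pos L a \<inter> phi_neg L b \<inter> S \<subseteq> phi_pos L c \<union> phi_neg L d"

text \<open>The closure of \<open>S\<close> in the patch topology of \<open>Sk (bpt L)\<close>.\<close>

definition pclosure :: "(('p \<Rightarrow> bool) \<times> ('n \<Rightarrow> bool)) set \<Rightarrow> (('p \<Rightarrow> bool) \<times> ('n \<Rightarrow> bool)) set" where
  "pclosure S = {f \<in> bipoints L. \<forall>a b c d. covers S a b c d \<longrightarrow> fst f a \<longrightarrow> snd f b \<longrightarrow> fst f c \<or> snd f d}"

definition spatial_rel :: "(('p \<Rightarrow> bool) \<times> ('n \<Rightarrow> bool)) set \<Rightarrow> ('a \<times> 'a) set" where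
  "spatial_rel S = {(epos L a \<sqinter>\<^bsub>main L\<^esub> eneg L b, epos L c \<squnion>\<^bsub>main L\<^esub> eneg L d) | a b c d. covers S a b c d}"

text \<open>The quotient in which everything basic that is true on \<open>S\<close> is forced. On
  closed sets and bispatial biquotients it becomes the inverse of
  \<open>bpt_biquotient L\<close>.\<close>

definition spatial_cong :: "(('p \<Rightarrow> bool) \<times> ('n \<Rightarrow> bool)) set \<Rightarrow> ('a \<times> 'a) set" where
  "spatial_cong S = generated_congruence (main L) (spatial_rel S)"

lemma covers_closed:
  "covers S a b c d \<Longrightarrow> a \<in> carrier (pos L)" "covers S a b c d \<Longrightarrow> b \<in> carrier (neg L)"
  "covers S a b c d \<Longrightarrow> c \<in> carrier (pos L)" "covers S a b c d \<Longrightarrow> d \<in> carrier (neg L)"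
  by (auto simp: covers_def)

lemma spatial_rel_fin: "spatial_rel S \<subseteq> fin L \<times> fin L"
  by (auto simp: spatial_rel_def intro!: rect_in_fin join_in_fin dest: covers_closed)

lemma spatial_rel_closed: "spatial_rel S \<subseteq> carrier (main L) \<times> carrier (main L)"
  using spatial_rel_fin fin_closed by blast

lemma finitary_spatial_cong: "finitary_congruence L (spatial_cong S)"
  unfolding finitary_congruence_def spatial_cong_def using spatial_rel_fin by blast

lemma frame_cong_finitary:
  assumes "finitary_congruence L C"
  shows "frame_cong (main L) C"
proof -
  obtain R where R: "R \<subseteq> fin L \<times> fin L" "C = generated_congruence (main L) R"
    using assms by (auto simp: finitary_congruence_def)
  have "R \<subseteq> carrier (main L) \<times> carrier (main L)" using R(1) fin_closed by blast
  from generated_congruence(1)[OF frame_main this] show ?thesis unfolding R(2) .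
qed

lemma biframe_cong_finitary: "finitary_congruence L C \<Longrightarrow> biframe_cong L C"
  by (intro biframe_cong.intro prebiframe_axioms biframe_cong_axioms.intro frame_cong_finitary)

lemma cle_spatial_cong:
  "covers S a b c d \<Longrightarrow>
    cle (main L) (spatial_cong S) (epos L a \<sqinter>\<^bsub>main L\<^esub> eneg L b) (epos L c \<squnion>\<^bsub>main L\<^esub> eneg L d)"
  unfolding spatial_cong_def
  by (rule generated_congruence(2)[OF frame_main spatial_rel_closed]) (auto simp: spatial_rel_def)

lemma bpt_eq:
  assumes "finitary_congruence L C"
  shows "bpt_biquotient L C = {f \<in> bipoints L. C \<subseteq> kernel_cong (main L) (ext_point L f)}"
proof -
  interpret biframe_cong L C by (rule biframe_cong_finitary[OF assms])
  show ?thesis by (rule bpt_biquotient_eq)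
qed

text \<open>A point of the quotient has a kernel containing \<open>C\<close>, so every inequality
  modulo \<open>C\<close> is true at that point.\<close>

lemma covers_bpt:
  assumes C: "finitary_congruence L C"
    and abcd: "a \<in> carrier (pos L)" "b \<in> carrier (neg L)" "c \<in> carrier (pos L)" "d \<in> carrier (neg L)"
    and le: "cle (main L) C (epos L a \<sqinter>\<^bsub>main L\<^esub> eneg L b) (epos L c \<squnion>\<^bsub>main L\<^esub> eneg L d)"
  shows "covers (bpt_biquotient L C) a b c d"
  unfolding covers_def
proof (intro conjI abcd subsetI)
  fix f assume f: "f \<in> phi_pos L a \<inter> phi_neg L b \<inter> bpt_biquotient L C"
  then have fb: "f \<in> bipoints L" "C \<subseteq> kernel_cong (main L) (ext_point L f)"
    by (auto simp: bpt_eq[OF C])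
  then have "cle (main L) (kernel_cong (main L) (ext_point L f)) (epos L a \<sqinter>\<^bsub>main L\<^esub> eneg L b) (epos L c \<squnion>\<^bsub>main L\<^esub> eneg L d)"
    using cong_subset_iff[OF frame_cong_finitary[OF C] frame_cong_point[OF fb(1)]] le abcd by simp
  then show "f \<in> phi_pos L c \<union> phi_neg L d"
    using f fb(1) abcd by (simp add: cle_point_iff ext_point_rect ext_point_join phi_pos_def phi_neg_def)
qed

text \<open>A point factors through the quotient iff its kernel contains the generated congruence.
  By the universal property this means that the point satisfies each generating inequality, that is,
  each basic inequality valid on \<open>S\<close>.\<close>

lemma bpt_spatial_cong: "bpt_biquotient L (spatial_cong S) = pclosure S"
proof (intro equalityI subsetI)
  fix f assume "f \<in> bpt_biquotient L (spatial_cong S)"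
  moreover from this have fb: "f \<in> bipoints L" by (simp add: bpt_biquotient_def)
  moreover have "covers (bpt_biquotient L (spatial_cong S)) a b c d" if "covers S a b c d" for a b c d
    using that by (intro covers_bpt finitary_spatial_cong cle_spatial_cong) (auto dest: covers_closed)
  ultimately show "f \<in> pclosure S"
    unfolding pclosure_def covers_def phi_pos_def phi_neg_def by blast
next
  fix f assume f: "f \<in> pclosure S"
  then have fb: "f \<in> bipoints L" by (simp add: pclosure_def)
  have "spatial_cong S \<subseteq> kernel_cong (main L) (ext_point L f)"
    unfolding spatial_cong_def
  proof (rule generated_congruence_kernel[OF frame_map_ext_point[OF fb] frame_main
        frame_imp_complete_lattice[OF frame_two] spatial_rel_closed])
    fix r s assume "(r, s) \<in> spatial_rel S"
    then obtain a b c d where abcd: "covers S a b c d"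
      "r = epos L a \<sqinter>\<^bsub>main L\<^esub> eneg L b" "s = epos L c \<squnion>\<^bsub>main L\<^esub> eneg L d"
      by (auto simp: spatial_rel_def)
    note cl = covers_closed[OF abcd(1)]
    have "fst f a \<Longrightarrow> snd f b \<Longrightarrow> fst f c \<or> snd f d" using f abcd(1) by (auto simp: pclosure_def)
    then show "ext_point L f r \<sqsubseteq>\<^bsub>two\<^esub> ext_point L f s"
      unfolding abcd(2,3) using ext_point_rect[OF fb cl(1,2)] ext_point_join[OF fb cl(3,4)]
      by (auto simp: le_bool_def)
  qed
  then show "f \<in> bpt_biquotient L (spatial_cong S)"
    using fb by (simp add: bpt_eq[OF finitary_spatial_cong])
qed

lemma pclosure_subset: "pclosure S \<subseteq> bipoints L"
  by (auto simp: pclosure_def)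

lemma subset_pclosure: "S \<subseteq> bipoints L \<Longrightarrow> S \<subseteq> pclosure S"
  by (auto simp: pclosure_def covers_def phi_pos_def phi_neg_def)

lemma pclosureD: "f \<in> pclosure S \<Longrightarrow> covers S a b c d \<Longrightarrow> fst f a \<Longrightarrow> snd f b \<Longrightarrow> fst f c \<or> snd f d"
  by (auto simp: pclosure_def)

lemma covers_pclosure: "covers S a b c d \<Longrightarrow> covers (pclosure S) a b c d"
  by (auto simp: pclosure_def covers_def phi_pos_def phi_neg_def)

lemma covers_mono: "S \<subseteq> T \<Longrightarrow> covers T a b c d \<Longrightarrow> covers S a b c d"
  by (auto simp: covers_def)

lemma pclosure_mono: "S \<subseteq> T \<Longrightarrow> pclosure S \<subseteq> pclosure T"
  unfolding pclosure_def using covers_mono by blast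

lemma pclosure_idem: "pclosure (pclosure S) = pclosure S"
proof
  show "pclosure S \<subseteq> pclosure (pclosure S)" by (rule subset_pclosure[OF pclosure_subset])
  show "pclosure (pclosure S) \<subseteq> pclosure S"
  proof
    fix f assume f: "f \<in> pclosure (pclosure S)"
    then have "fst f c \<or> snd f d" if "covers S a b c d" "fst f a" "snd f b" for a b c d
      using pclosureD[OF f covers_pclosure] that by blast
    then show "f \<in> pclosure S" using f unfolding pclosure_def by blast
  qed
qed

lemma spatial_cong_antimono: "S \<subseteq> T \<Longrightarrow> spatial_cong T \<subseteq> spatial_cong S"
  unfolding spatial_cong_def[of T] using frame_cong.congr[OF frame_cong_finitary[OF finitary_spatial_cong]]
  by (intro generated_congruence_least) (auto simp: spatial_rel_def intro: cle_spatial_cong covers_mono)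

lemma not_in_pclosure:
  assumes "f \<in> bipoints L" "f \<notin> pclosure S"
  obtains a b c d where "covers S a b c d" "fst f a" "snd f b" "\<not> fst f c" "\<not> snd f d"
  using assms by (auto simp: pclosure_def)

lemma bipoint_top_bot:
  assumes "f \<in> bipoints L"
  shows "fst f \<top>\<^bsub>pos L\<^esub>" "snd f \<top>\<^bsub>neg L\<^esub>" "\<not> fst f \<bottom>\<^bsub>pos L\<^esub>" "\<not> snd f \<bottom>\<^bsub>neg L\<^esub>"
proof -
  have "f \<in> phi_pos L \<top>\<^bsub>pos L\<^esub>" "f \<in> phi_neg L \<top>\<^bsub>neg L\<^esub>" "f \<notin> phi_pos L \<bottom>\<^bsub>pos L\<^esub>" "f \<notin> phi_neg L \<bottom>\<^bsub>neg L\<^esub>"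
    using assms by (simp_all only: phi_pos_simps(4,5) phi_neg_simps(4,5) empty_iff not_False_eq_True)
  then show "fst f \<top>\<^bsub>pos L\<^esub>" "snd f \<top>\<^bsub>neg L\<^esub>" "\<not> fst f \<bottom>\<^bsub>pos L\<^esub>" "\<not> snd f \<bottom>\<^bsub>neg L\<^esub>"
    using assms by (simp_all add: phi_pos_def phi_neg_def)
qed

text \<open>The inequality of top and bottom is valid on the empty set and fails at every
  bipoint.\<close>

lemma pclosure_empty: "pclosure {} = {}"
proof -
  have "covers {} \<top>\<^bsub>pos L\<^esub> \<top>\<^bsub>neg L\<^esub> \<bottom>\<^bsub>pos L\<^esub> \<bottom>\<^bsub>neg L\<^esub>" by (simp add: covers_def)
  then have "f \<notin> pclosure {}" for f
    using pclosureD[of f "{}"] bipoint_top_bot[of f] pclosure_subset by blast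
  then show ?thesis by blast
qed

text \<open>A point outside both closures violates one inequality for each set. Taking meets of the
  two left sides and joins of the two right sides gives an inequality valid on the union that the
  point still violates.\<close>

lemma pclosure_Un:
  assumes "S \<subseteq> bipoints L" "T \<subseteq> bipoints L"
  shows "pclosure (S \<union> T) = pclosure S \<union> pclosure T"
proof
  show "pclosure S \<union> pclosure T \<subseteq> pclosure (S \<union> T)" by (simp add: pclosure_mono)
  show "pclosure (S \<union> T) \<subseteq> pclosure S \<union> pclosure T"
  proof (rule ccontr)
    assume "\<not> ?thesis"
    then obtain f where f: "f \<in> pclosure (S \<union> T)" "f \<notin> pclosure S" "f \<notin> pclosure T" by auto
    then have fb: "f \<in> bipoints L" using pclosure_subset by auto
    obtain a b c d where 1: "covers S a b c d" "fst f a" "snd f b" "\<not> fst f c" "\<not> snd f d"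
      by (rule not_in_pclosure[OF fb f(2)])
    obtain a' b' c' d' where 2: "covers T a' b' c' d'" "fst f a'" "snd f b'" "\<not> fst f c'" "\<not> snd f d'"
      by (rule not_in_pclosure[OF fb f(3)])
    note cl = covers_closed[OF 1(1)] covers_closed[OF 2(1)]
    have phi: "phi_pos L (c \<squnion>\<^bsub>pos L\<^esub> c') = phi_pos L c \<union> phi_pos L c'" "phi_neg L (d \<squnion>\<^bsub>neg L\<^esub> d') = phi_neg L d \<union> phi_neg L d'"
      using phi_pos_simps(3)[of "{c, c'}"] phi_neg_simps(3)[of "{d, d'}"] cl by (auto simp: join_def)
    have "covers (S \<union> T) (a \<sqinter>\<^bsub>pos L\<^esub> a') (b \<sqinter>\<^bsub>neg L\<^esub> b') (c \<squnion>\<^bsub>pos L\<^esub> c') (d \<squnion>\<^bsub>neg L\<^esub> d')"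
      using 1(1) 2(1) cl unfolding covers_def by (auto simp: phi phi_pos_simps(2) phi_neg_simps(2))
    moreover have "fst f (a \<sqinter>\<^bsub>pos L\<^esub> a')" "snd f (b \<sqinter>\<^bsub>neg L\<^esub> b')"
      using 1 2 cl by (simp_all add: frame_map_meet[OF bipoint_frame_maps(1)[OF fb]] frame_map_meet[OF bipoint_frame_maps(2)[OF fb]])
    moreover have "\<not> fst f (c \<squnion>\<^bsub>pos L\<^esub> c')" "\<not> snd f (d \<squnion>\<^bsub>neg L\<^esub> d')"
      using 1 2 cl by (simp_all add: frame_map_join[OF bipoint_frame_maps(1)[OF fb]] frame_map_join[OF bipoint_frame_maps(2)[OF fb]])
    ultimately show False using f(1) unfolding pclosure_def by blast
  qed
qed

lemma pclosure_singleton: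
  assumes f: "f \<in> bipoints L"
  shows "pclosure {f} = {f}"
proof
  show "{f} \<subseteq> pclosure {f}" using subset_pclosure[of "{f}"] f by simp
  show "pclosure {f} \<subseteq> {f}"
  proof
    fix g assume g: "g \<in> pclosure {f}"
    then have gb: "g \<in> bipoints L" using pclosure_subset by auto
    have "fst g a = fst f a" if a: "a \<in> carrier (pos L)" for a
    proof (cases "fst f a")
      case True
      then have "covers {f} \<top>\<^bsub>pos L\<^esub> \<top>\<^bsub>neg L\<^esub> a \<bottom>\<^bsub>neg L\<^esub>" using a f by (auto simp: covers_def phi_pos_def)
      then show ?thesis using True pclosureD[OF g] bipoint_top_bot[OF gb] by blast
    next
      case False
      then have "covers {f} a \<top>\<^bsub>neg L\<^esub> \<bottom>\<^bsub>pos L\<^esub> \<bottom>\<^bsub>neg L\<^esub>" using a f by (auto simp: covers_def phi_pos_def)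
      then show ?thesis using False pclosureD[OF g] bipoint_top_bot[OF gb] by blast
    qed
    moreover have "snd g b = snd f b" if b: "b \<in> carrier (neg L)" for b
    proof (cases "snd f b")
      case True
      then have "covers {f} \<top>\<^bsub>pos L\<^esub> \<top>\<^bsub>neg L\<^esub> \<bottom>\<^bsub>pos L\<^esub> b" using b f by (auto simp: covers_def phi_neg_def)
      then show ?thesis using True pclosureD[OF g] bipoint_top_bot[OF gb] by blast
    next
      case False
      then have "covers {f} \<top>\<^bsub>pos L\<^esub> b \<bottom>\<^bsub>pos L\<^esub> \<bottom>\<^bsub>neg L\<^esub>" using b f by (auto simp: covers_def phi_neg_def)
      then show ?thesis using False pclosureD[OF g] bipoint_top_bot[OF gb] by blast
    qed
    ultimately show "g \<in> {f}" using bipoint_eqI[OF gb f] by simp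
  qed
qed

text \<open>The four open sets that isolate \<open>f\<close> are given by elements \<open>a\<close>,
  \<open>b\<close>, \<open>c\<close>, \<open>d\<close>. Isolating \<open>f\<close> means that the
  corresponding inequality holds at all other points and fails at \<open>f\<close>.\<close>

lemma bi_TD_iff_isolated:
  "bi_TD (bpt L) \<longleftrightarrow> (\<forall>f\<in>bipoints L. pclosure (bipoints L - {f}) = bipoints L - {f})"
proof
  assume td: "bi_TD (bpt L)"
  show "\<forall>f\<in>bipoints L. pclosure (bipoints L - {f}) = bipoints L - {f}"
  proof
    fix f assume f: "f \<in> bipoints L"
    then obtain U U' V V' where U: "openin (ptop (bpt L)) U" "openin (ntop (bpt L)) U'" "openin (ptop (bpt L)) V"
      "openin (ntop (bpt L)) V'" and "{f} = U \<inter> U' \<inter> (bipoints L - V) \<inter> (bipoints L - V')"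
      using td unfolding bi_TD_def points_bpt by meson
    moreover from U obtain a b c d where abcd: "a \<in> carrier (pos L)" "b \<in> carrier (neg L)" "c \<in> carrier (pos L)" "d \<in> carrier (neg L)"
      "U = phi_pos L a" "U' = phi_neg L b" "V = phi_pos L c" "V' = phi_neg L d"
      unfolding phi_pos_simps(1) phi_neg_simps(1) by blast
    ultimately have eq: "{f} = phi_pos L a \<inter> phi_neg L b \<inter> (bipoints L - phi_pos L c) \<inter> (bipoints L - phi_neg L d)"
      by simp
    then have "covers (bipoints L - {f}) a b c d" using abcd by (auto simp: covers_def)
    moreover have "fst f a" "snd f b" "\<not> fst f c" "\<not> snd f d" using eq by (auto simp: phi_pos_def phi_neg_def)
    ultimately have "f \<notin> pclosure (bipoints L - {f})" by (auto simp: pclosure_def)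
    then show "pclosure (bipoints L - {f}) = bipoints L - {f}"
      using subset_pclosure[of "bipoints L - {f}"] pclosure_subset[of "bipoints L - {f}"] by blast
  qed
next
  assume r: "\<forall>f\<in>bipoints L. pclosure (bipoints L - {f}) = bipoints L - {f}"
  show "bi_TD (bpt L)"
    unfolding bi_TD_def points_bpt
  proof
    fix f assume f: "f \<in> bipoints L"
    then have "f \<notin> pclosure (bipoints L - {f})" using r by simp
    then obtain a b c d where 1: "covers (bipoints L - {f}) a b c d" "fst f a" "snd f b" "\<not> fst f c" "\<not> snd f d"
      by (rule not_in_pclosure[OF f])
    have "{f} = phi_pos L a \<inter> phi_neg L b \<inter> (bipoints L - phi_pos L c) \<inter> (bipoints L - phi_neg L d)"
    proof
      show "{f} \<subseteq> phi_pos L a \<inter> phi_neg L b \<inter> (bipoints L - phi_pos L c) \<inter> (bipoints L - phi_neg L d)"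
        using 1 f by (auto simp: phi_pos_def phi_neg_def)
      show "phi_pos L a \<inter> phi_neg L b \<inter> (bipoints L - phi_pos L c) \<inter> (bipoints L - phi_neg L d) \<subseteq> {f}"
        using 1(1) unfolding covers_def by blast
    qed
    moreover have "openin (ptop (bpt L)) (phi_pos L a)" "openin (ntop (bpt L)) (phi_neg L b)"
      "openin (ptop (bpt L)) (phi_pos L c)" "openin (ntop (bpt L)) (phi_neg L d)"
      using covers_closed[OF 1(1)] phi_pos_simps(1) phi_neg_simps(1) by blast+
    ultimately show "\<exists>U U' V V'. openin (ptop (bpt L)) U \<and> openin (ntop (bpt L)) U' \<and> openin (ptop (bpt L)) V \<and>
      openin (ntop (bpt L)) V' \<and> {f} = U \<inter> U' \<inter> (bipoints L - V) \<inter> (bipoints L - V')" by blast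
  qed
qed

text \<open>A point of the closure of \<open>S\<close> outside \<open>S\<close> is, by monotonicity,
  in the closure of the set of all other points; isolation of single points therefore makes every
  set closed.\<close>

lemma bi_TD_iff_closed: "bi_TD (bpt L) \<longleftrightarrow> (\<forall>S \<subseteq> bipoints L. pclosure S = S)"
proof
  assume td: "bi_TD (bpt L)"
  show "\<forall>S \<subseteq> bipoints L. pclosure S = S"
  proof (intro allI impI equalityI)
    fix S assume S: "S \<subseteq> bipoints L"
    then show "S \<subseteq> pclosure S" by (rule subset_pclosure)
    show "pclosure S \<subseteq> S"
    proof (rule ccontr)
      assume "\<not> pclosure S \<subseteq> S"
      then obtain f where f: "f \<in> pclosure S" "f \<notin> S" by blast
      then have "f \<in> pclosure (bipoints L - {f})" using pclosure_mono[of S "bipoints L - {f}"] S by auto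
      then show False using td f pclosure_subset unfolding bi_TD_iff_isolated by blast
    qed
  qed
qed (simp add: bi_TD_iff_isolated)

end

section \<open>The coframe of bispatial biquotients\<close>

lemma bisp_sel [simp]:
  "carrier (bisp_biquotients L) = {C. finitary_congruence L C \<and> bispatial (quotient_biframe L C)}"
  "le (bisp_biquotients L) = (\<lambda>C D. D \<subseteq> C)" "eq (bisp_biquotients L) = (=)"
  by (simp_all add: bisp_biquotients_def biquotients_def)

lemma partial_order_bisp: "partial_order (bisp_biquotients L)"
  by (rule partial_orderI) auto

context fin_biframe
begin

text \<open>The criterion \<open>bispatial_iff\<close> applied to \<open>L/C\<close>, which is
  finitary by \<open>finitary_quotient\<close>, and rewritten in terms of elements and bipoints of
  \<open>L\<close>.\<close>

lemma bisp_iff: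
  "C \<in> carrier (bisp_biquotients L) \<longleftrightarrow> finitary_congruence L C \<and>
    (\<forall>a b c d. covers (bpt_biquotient L C) a b c d \<longrightarrow>
      cle (main L) C (epos L a \<sqinter>\<^bsub>main L\<^esub> eneg L b) (epos L c \<squnion>\<^bsub>main L\<^esub> eneg L d))"
proof (cases "finitary_congruence L C")
  case True
  interpret biframe_cong L C by (rule biframe_cong_finitary[OF True])
  have "epos QL (qp a) \<sqinter>\<^bsub>main QL\<^esub> eneg QL (qn b) \<sqsubseteq>\<^bsub>main QL\<^esub> epos QL (qp c) \<squnion>\<^bsub>main QL\<^esub> eneg QL (qn d) \<longleftrightarrow>
      cle (main L) C (epos L a \<sqinter>\<^bsub>main L\<^esub> eneg L b) (epos L c \<squnion>\<^bsub>main L\<^esub> eneg L d)"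
    if "a \<in> carrier (pos L)" "b \<in> carrier (neg L)" "c \<in> carrier (pos L)" "d \<in> carrier (neg L)" for a b c d
    using that by (simp add: epos_QL eneg_QL C.q_meet frame_map_join[OF C.frame_map_q])
  then have "bispatial QL \<longleftrightarrow> (\<forall>a\<in>carrier (pos L). \<forall>b\<in>carrier (neg L). \<forall>c\<in>carrier (pos L). \<forall>d\<in>carrier (neg L).
      phi_pos L a \<inter> phi_neg L b \<inter> bpt_biquotient L C \<subseteq> phi_pos L c \<union> phi_neg L d \<longrightarrow>
      cle (main L) C (epos L a \<sqinter>\<^bsub>main L\<^esub> eneg L b) (epos L c \<squnion>\<^bsub>main L\<^esub> eneg L d))"
    unfolding bispatial_iff[OF finitary_quotient[OF finitary True]]
    by (simp add: CP.carrier_Q CN.carrier_Q phi_QL_subset_iff)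
  then show ?thesis using True by (auto simp: covers_def)
qed simp

text \<open>Bispatiality says that \<open>C\<close> contains the congruence of its points. The other
  inclusion holds for every finitary \<open>C\<close>: by \<open>cle_fin\<close> its generators
  reduce to basic inequalities modulo \<open>C\<close>, and these are valid on its points.\<close>

lemma bisp_eq_spatial_cong:
  assumes "C \<in> carrier (bisp_biquotients L)"
  shows "C = spatial_cong (bpt_biquotient L C)"
proof
  have fin: "finitary_congruence L C" using assms by simp
  note fc = frame_cong_finitary[OF fin] frame_cong_finitary[OF finitary_spatial_cong]
  show "spatial_cong (bpt_biquotient L C) \<subseteq> C"
    unfolding spatial_cong_def
  proof (rule generated_congruence_least[OF frame_cong.congr[OF fc(1)]])
    show "cle (main L) C r s" if "(r, s) \<in> spatial_rel (bpt_biquotient L C)" for r s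
      using that assms unfolding bisp_iff by (auto simp: spatial_rel_def)
  qed
  obtain R where R: "R \<subseteq> fin L \<times> fin L" "C = generated_congruence (main L) R"
    using fin by (auto simp: finitary_congruence_def)
  have Rc: "R \<subseteq> carrier (main L) \<times> carrier (main L)" using R(1) fin_closed by blast
  have "generated_congruence (main L) R \<subseteq> spatial_cong (bpt_biquotient L C)"
  proof (rule generated_congruence_least[OF frame_cong.congr[OF fc(2)]])
    fix r s assume rs: "(r, s) \<in> R"
    show "cle (main L) (spatial_cong (bpt_biquotient L C)) r s"
    proof (rule cle_fin[OF fc(2) fc(1)])
      show "cle (main L) C r s" unfolding R(2) by (rule generated_congruence(2)[OF frame_main Rc rs])
    qed (use rs R(1) in \<open>auto intro!: cle_spatial_cong covers_bpt[OF fin]\<close>)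
  qed
  then show "C \<subseteq> spatial_cong (bpt_biquotient L C)" using R(2) by simp
qed

lemma spatial_cong_bisp: "spatial_cong (pclosure S) \<in> carrier (bisp_biquotients L)"
  unfolding bisp_iff bpt_spatial_cong pclosure_idem
  using finitary_spatial_cong cle_spatial_cong by blast

abbreviation closed_sets where "closed_sets \<equiv> {S. pclosure S = S}"

text \<open>The inverse is \<open>spatial_cong\<close>. Biquotients carry reverse inclusion of
  congruences, and fewer identifications leave more points, so the correspondence preserves
  order.\<close>

lemma order_iso_bisp: "order_iso (bisp_biquotients L) (inclusion_order closed_sets) (bpt_biquotient L)"
  unfolding order_iso_def order_emb_def
proof (intro conjI ballI)
  show "weak_partial_order (bisp_biquotients L)" "weak_partial_order (inclusion_order closed_sets)"
    using partial_order_bisp partial_order_inclusion_order by (auto intro: partial_order.axioms)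
  \<comment> \<open>Point sets of bispatial biquotients are closed, because such a congruence is
    generated by its points and the points of a generated congruence form a closure.\<close>
  have eq: "bpt_biquotient L C = pclosure (bpt_biquotient L C)" if "C \<in> carrier (bisp_biquotients L)" for C
    using bpt_spatial_cong[of "bpt_biquotient L C"] bisp_eq_spatial_cong[OF that] by simp
  show le: "bpt_biquotient L C \<sqsubseteq>\<^bsub>inclusion_order closed_sets\<^esub> bpt_biquotient L D \<longleftrightarrow> C \<sqsubseteq>\<^bsub>bisp_biquotients L\<^esub> D"
    if C: "C \<in> carrier (bisp_biquotients L)" and D: "D \<in> carrier (bisp_biquotients L)" for C D
  proof
    assume "bpt_biquotient L C \<sqsubseteq>\<^bsub>inclusion_order closed_sets\<^esub> bpt_biquotient L D"
    then have "spatial_cong (bpt_biquotient L D) \<subseteq> spatial_cong (bpt_biquotient L C)"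
      by (intro spatial_cong_antimono) simp
    then show "C \<sqsubseteq>\<^bsub>bisp_biquotients L\<^esub> D"
      using bisp_eq_spatial_cong[OF C] bisp_eq_spatial_cong[OF D] by simp
  next
    assume "C \<sqsubseteq>\<^bsub>bisp_biquotients L\<^esub> D"
    then show "bpt_biquotient L C \<sqsubseteq>\<^bsub>inclusion_order closed_sets\<^esub> bpt_biquotient L D"
      using C D by (auto simp: bpt_eq)
  qed
  have cl: "bpt_biquotient L \<in> carrier (bisp_biquotients L) \<rightarrow> carrier (inclusion_order closed_sets)"
    using eq by auto
  show "bij_betw (bpt_biquotient L) (carrier (bisp_biquotients L)) (carrier (inclusion_order closed_sets))"
    unfolding bij_betw_def
  proof (intro conjI equalityI subsetI)
    show "inj_on (bpt_biquotient L) (carrier (bisp_biquotients L))"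
      using bisp_eq_spatial_cong by (metis inj_onI)
    show "S \<in> carrier (inclusion_order closed_sets)" if "S \<in> bpt_biquotient L ` carrier (bisp_biquotients L)" for S
      using that cl by auto
    show "S \<in> bpt_biquotient L ` carrier (bisp_biquotients L)" if "S \<in> carrier (inclusion_order closed_sets)" for S
      using that spatial_cong_bisp[of S] bpt_spatial_cong[of S] by (intro image_eqI[of _ _ "spatial_cong S"]) auto
  qed
qed

lemma pclosure_full: "pclosure (bipoints L) = bipoints L"
  using subset_pclosure[of "bipoints L"] pclosure_subset by blast

lemma pclosure_INT:
  assumes "F \<noteq> {}" "\<And>S. S \<in> F \<Longrightarrow> pclosure S = S"
  shows "pclosure (\<Inter>F) = \<Inter>F"
proof
  show "pclosure (\<Inter>F) \<subseteq> \<Inter>F"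
  proof (rule Inter_greatest)
    fix S assume "S \<in> F"
    then show "pclosure (\<Inter>F) \<subseteq> S" using pclosure_mono[of "\<Inter>F" S] assms(2) by auto
  qed
  have "\<Inter>F \<subseteq> bipoints L" using assms pclosure_subset by blast
  then show "\<Inter>F \<subseteq> pclosure (\<Inter>F)" by (rule subset_pclosure)
qed

lemma complete_lattice_closed_sets: "complete_lattice (inclusion_order closed_sets)"
proof (rule complete_lattice_inclusion_order[of "bipoints L"])
  show "bipoints L \<in> closed_sets" by (simp add: pclosure_full)
  show "closed_sets \<subseteq> Pow (bipoints L)" using pclosure_subset by blast
  show "\<Inter>A \<in> closed_sets" if "A \<subseteq> closed_sets" "A \<noteq> {}" for A
    using that by (auto intro!: pclosure_INT)
qed

abbreviation open_sets where "open_sets \<equiv> {U. U \<subseteq> bipoints L \<and> bipoints L - U \<in> closed_sets}"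

lemma open_sets_Union:
  assumes A: "A \<subseteq> open_sets"
  shows "\<Union>A \<in> open_sets"
proof -
  have "pclosure (bipoints L - \<Union>A) = bipoints L - \<Union>A"
  proof (cases "A = {}")
    case False
    then have "bipoints L - \<Union>A = \<Inter>((\<lambda>U. bipoints L - U) ` A)" by auto
    then show ?thesis using pclosure_INT[of "(\<lambda>U. bipoints L - U) ` A"] A False by auto
  qed (simp add: pclosure_full)
  then show ?thesis using A by auto
qed

lemma open_sets_Int: "x \<in> open_sets \<Longrightarrow> y \<in> open_sets \<Longrightarrow> x \<inter> y \<in> open_sets"
  using pclosure_Un[of "bipoints L - x" "bipoints L - y"] by (auto simp: Diff_Int)

text \<open>Complementation turns the isomorphism with closed sets into one from the opposite order
  to the open sets, which form a frame because they are closed under unions and binary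
  intersections.\<close>

lemma coframe_bisp: "coframe (bisp_biquotients L)"
proof -
  let ?P = "inv_gorder (bisp_biquotients L)"
  let ?f = "\<lambda>C. bipoints L - bpt_biquotient L C"
  have P: "partial_order ?P" by (rule partial_orderI) auto
  have iso: "order_iso (bisp_biquotients L) (inclusion_order closed_sets) (bpt_biquotient L)" by (rule order_iso_bisp)
  have sub: "bpt_biquotient L C \<subseteq> bipoints L" for C by (auto simp: bpt_biquotient_def)
  have f_iso: "order_iso ?P (inclusion_order open_sets) ?f"
    unfolding order_iso_def order_emb_def
  proof (intro conjI ballI)
    show "weak_partial_order ?P" "weak_partial_order (inclusion_order open_sets)"
      using P partial_order_inclusion_order by (auto intro: partial_order.axioms)
    have bij: "bij_betw (bpt_biquotient L) (carrier (bisp_biquotients L)) closed_sets"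
      using iso by (simp add: order_iso_def)
    have "bij_betw (\<lambda>S. bipoints L - S) closed_sets open_sets"
    proof (rule bij_betw_byWitness[where f' = "\<lambda>S. bipoints L - S"])
      have dd: "bipoints L - (bipoints L - S) = S" if "S \<in> closed_sets" for S
        using that pclosure_subset[of S] by auto
      then show "\<forall>S\<in>closed_sets. bipoints L - (bipoints L - S) = S" by blast
      show "(\<lambda>S. bipoints L - S) ` closed_sets \<subseteq> open_sets"
      proof (rule image_subsetI)
        fix S assume "S \<in> closed_sets"
        then show "bipoints L - S \<in> open_sets" using dd[of S] by simp
      qed
    qed (auto simp: double_diff)
    from bij_betw_trans[OF bij this]
    show "bij_betw ?f (carrier ?P) (carrier (inclusion_order open_sets))" by (simp add: comp_def)
    fix C D assume "C \<in> carrier ?P" "D \<in> carrier ?P"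
    then have "bpt_biquotient L D \<subseteq> bpt_biquotient L C \<longleftrightarrow> C \<subseteq> D"
      using iso unfolding order_iso_def order_emb_def by simp
    then show "?f C \<sqsubseteq>\<^bsub>inclusion_order open_sets\<^esub> ?f D \<longleftrightarrow> C \<sqsubseteq>\<^bsub>?P\<^esub> D"
      using sub[of C] sub[of D] by auto
  qed
  have "frame (inclusion_order open_sets)"
    by (rule frame_inclusion_order) (fact open_sets_Union open_sets_Int)+
  moreover have "iso_orders ?P (inclusion_order open_sets) ?f"
    by (intro iso_orders.intro iso_orders_axioms.intro P partial_order_inclusion_order f_iso)
  ultimately have "frame ?P" by (rule iso_orders.frame[rotated])
  then show ?thesis by (simp add: coframe_def)
qed

lemma bi_TD_imp_iso:
  assumes "bi_TD (bpt L)"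
  shows "order_iso (bisp_biquotients L) (inclusion_order (Pow (points (bpt L)))) (bpt_biquotient L)"
proof -
  have "closed_sets = Pow (points (bpt L))"
  proof
    show "closed_sets \<subseteq> Pow (points (bpt L))"
      unfolding points_bpt
    proof
      fix S assume "S \<in> closed_sets"
      then show "S \<in> Pow (bipoints L)" using pclosure_subset[of S] by simp
    qed
    show "Pow (points (bpt L)) \<subseteq> closed_sets"
      using assms unfolding bi_TD_iff_closed points_bpt by auto
  qed
  then show ?thesis using order_iso_bisp by simp
qed

text \<open>The image of \<open>bpt_biquotient L\<close> is always the family of closed sets, so an
  isomorphism onto the powerset forces every set to be closed.\<close>

lemma bi_TD_iff_iso:
  "bi_TD (bpt L) \<longleftrightarrow> order_iso (bisp_biquotients L) (inclusion_order (Pow (points (bpt L)))) (bpt_biquotient L)"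
proof
  assume "order_iso (bisp_biquotients L) (inclusion_order (Pow (points (bpt L)))) (bpt_biquotient L)"
  then have "bpt_biquotient L ` carrier (bisp_biquotients L) = Pow (bipoints L)"
    by (simp add: order_iso_def bij_betw_def points_bpt)
  moreover have "bpt_biquotient L ` carrier (bisp_biquotients L) = closed_sets"
    using order_iso_bisp by (simp add: order_iso_def bij_betw_def)
  ultimately have "Pow (bipoints L) = closed_sets" by (rule trans[OF sym])
  then show "bi_TD (bpt L)" unfolding bi_TD_iff_closed by auto
qed (rule bi_TD_imp_iso)

text \<open>One direction transports the Boolean structure of the powerset. For the other, {f} is
  closed and has a complement among closed sets; since meets and joins used there are intersections
  and unions, this complement is the set of all other points, which is therefore closed.\<close>

lemma bi_TD_iff_boolean: "bi_TD (bpt L) \<longleftrightarrow> is_boolean_algebra (bisp_biquotients L)"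
proof
  assume "bi_TD (bpt L)"
  then interpret iso_orders "bisp_biquotients L" "inclusion_order (Pow (points (bpt L)))" "bpt_biquotient L"
    by (intro iso_orders.intro iso_orders_axioms.intro partial_order_bisp partial_order_inclusion_order bi_TD_imp_iso)
  show "is_boolean_algebra (bisp_biquotients L)"
    by (rule boolean_algebra[OF _ boolean_algebra_Pow]) (rule complete_lattice_inclusion_order[of "points (bpt L)"], auto)
next
  assume bool: "is_boolean_algebra (bisp_biquotients L)"
  let ?K = "inclusion_order closed_sets"
  interpret iso_orders "bisp_biquotients L" ?K "bpt_biquotient L"
    by (intro iso_orders.intro iso_orders_axioms.intro partial_order_bisp partial_order_inclusion_order order_iso_bisp)
  note K = complete_lattice_closed_sets
  show "bi_TD (bpt L)"
    unfolding bi_TD_iff_isolated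
  proof
    fix f assume f: "f \<in> bipoints L"
    then have fK: "{f} \<in> carrier ?K" by (simp add: pclosure_singleton)
    \<comment> \<open>The complement is taken among biquotients, at the preimage of {f}, and is
      carried to closed sets through the lattice operations.\<close>
    obtain D where D: "D \<in> carrier (bisp_biquotients L)"
      "g {f} \<sqinter>\<^bsub>bisp_biquotients L\<^esub> D = \<bottom>\<^bsub>bisp_biquotients L\<^esub>"
      "g {f} \<squnion>\<^bsub>bisp_biquotients L\<^esub> D = \<top>\<^bsub>bisp_biquotients L\<^esub>"
      using bool g_closed[OF fK] unfolding is_boolean_algebra_def by blast
    let ?S = "bpt_biquotient L D"
    have S: "?S \<in> carrier ?K" using D(1) by (rule f_closed)
    have meet: "{f} \<sqinter>\<^bsub>?K\<^esub> ?S = {f} \<inter> ?S"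
      using fK S pclosure_INT[of "{{f}, ?S}"] by (intro meet_inclusion_order) auto
    have join: "{f} \<squnion>\<^bsub>?K\<^esub> ?S = {f} \<union> ?S"
    proof (rule join_inclusion_order)
      show "{f} \<in> closed_sets" "?S \<in> closed_sets" using fK S by auto
      then show "{f} \<union> ?S \<in> closed_sets" using pclosure_Un[of "{f}" ?S] f pclosure_subset by blast
    qed
    have "{f} \<inter> ?S = \<bottom>\<^bsub>?K\<^esub>"
      unfolding meet[symmetric] using f_meet[OF K g_closed[OF fK] D(1)] D(2) fg[OF fK] f_bottom[OF K] by simp
    also have "\<dots> = {}" by (rule bottom_inclusion_order) (simp add: pclosure_empty)
    finally have 1: "f \<notin> ?S" by simp
    have "{f} \<union> ?S = \<top>\<^bsub>?K\<^esub>"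
      unfolding join[symmetric] using f_join[OF K g_closed[OF fK] D(1)] D(3) fg[OF fK] f_top[OF K] by simp
    also have "\<dots> = bipoints L"
      by (rule top_inclusion_order) (use pclosure_full pclosure_subset in blast)+
    finally have "?S = bipoints L - {f}" using 1 by blast
    then show "pclosure (bipoints L - {f}) = bipoints L - {f}" using S by simp
  qed
qed

end

section \<open>Bisober bisubspaces\<close>

context bispace_opens
begin

abbreviation B where "B \<equiv> bOmega_fin X"

lemma complete_lattice_bOmega: "complete_lattice (pos B)" "complete_lattice (neg B)"
  by (simp_all add: bOmega_fin_sel frame_imp_complete_lattice frame_opens_frame)

lemma bipoint_bOmega_le:
  assumes g: "g \<in> bipoints B"
    and op: "openin (ptop X) U" "openin (ntop X) U'" "openin (ptop X) V" "openin (ntop X) V'" "U \<inter> U' \<subseteq> V \<union> V'"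
    and "fst g U" "snd g U'"
  shows "fst g V \<or> snd g V'"
  using bOmega_fin_map_le[OF frame_two frame_map_ext_point[OF g] op] ext_point_epos[OF g] ext_point_eneg[OF g] assms
  by (simp add: bOmega_fin_sel(1,2))

lemma bipoint_bOmegaI:
  assumes f: "frame_map P two f" and g: "frame_map N two g"
    and le: "\<And>U U' V V'. openin (ptop X) U \<Longrightarrow> openin (ntop X) U' \<Longrightarrow> openin (ptop X) V \<Longrightarrow> openin (ntop X) V' \<Longrightarrow>
      U \<inter> U' \<subseteq> V \<union> V' \<Longrightarrow> f U \<Longrightarrow> g U' \<Longrightarrow> f V \<or> g V'"
  shows "(restrict f {U. openin (ptop X) U}, restrict g {U. openin (ntop X) U}) \<in> bipoints B"
proof -
  obtain h where h: "frame_map (main B) two h"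
    "\<And>U. openin (ptop X) U \<Longrightarrow> h (epos B U) = f U" "\<And>U. openin (ntop X) U \<Longrightarrow> h (eneg B U) = g U"
  proof (rule bOmega_fin_extension[OF frame_two f g])
    show "f U \<sqinter>\<^bsub>two\<^esub> g U' \<sqsubseteq>\<^bsub>two\<^esub> f V \<squnion>\<^bsub>two\<^esub> g V'"
      if "openin (ptop X) U" "openin (ntop X) U'" "openin (ptop X) V" "openin (ntop X) V'" "U \<inter> U' \<subseteq> V \<union> V'"
      for U U' V V'
      using le[OF that] by (simp add: le_bool_def)
  qed blast
  have "(restrict f (carrier (pos B)), restrict g (carrier (neg B))) \<in> bipoints B"
    by (rule bipointI[OF h(1) complete_lattice_bOmega]) (simp_all add: bOmega_fin_sel(1,2) f g h)
  then show ?thesis by (simp add: bOmega_fin_sel(1,2))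
qed

lemma nbhd_point_bipoint:
  assumes "x \<in> topspace (ptop X)" "x \<in> topspace (ntop X)"
  shows "nbhd_point X x \<in> bipoints B"
  unfolding nbhd_point_def
proof (rule bipoint_bOmegaI)
  show "frame_map P two (\<lambda>U. x \<in> U)" "frame_map N two (\<lambda>U. x \<in> U)"
    using assms by (auto simp: frame_map_two_iff frame_imp_complete_lattice frame_opens_frame opens_frame_simps)
qed auto

lemma nbhd_point_simps:
  "openin (ptop X) U \<Longrightarrow> fst (nbhd_point X x) U \<longleftrightarrow> x \<in> U"
  "openin (ntop X) U \<Longrightarrow> snd (nbhd_point X x) U \<longleftrightarrow> x \<in> U"
  by (simp_all add: nbhd_point_def)

text \<open>Once \<open>nbhd_point X\<close> is onto, it sends each open \<open>U\<close> onto
  \<open>phi_pos B U\<close> or \<open>phi_neg B U\<close>, and these are all the opens of the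
  target. A bijection is therefore open and continuous for both topologies.\<close>

lemma bisober_iff:
  assumes X: "is_bispace X"
  shows "bisober X \<longleftrightarrow> bij_betw (nbhd_point X) (points X) (bipoints B)"
proof
  note tp = openin_phi_pos[OF complete_lattice_bOmega(1)] and tn = openin_phi_neg[OF complete_lattice_bOmega(2)]
  have ts: "topspace (ptop X) = points X" "topspace (ntop X) = points X"
    using X by (simp_all add: points_def is_bispace_def)
  {
    assume "bisober X"
    then have "homeomorphic_map (ptop X) (ptop (bpt B)) (nbhd_point X)"
      by (simp add: bisober_def bihomeomorphism_def)
    then show "bij_betw (nbhd_point X) (points X) (bipoints B)"
      using homeomorphic_imp_surjective_map homeomorphic_imp_injective_map
      unfolding bij_betw_def ts[symmetric] tp(6)[symmetric] by metis
  }
  assume bij: "bij_betw (nbhd_point X) (points X) (bipoints B)"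
  then have img: "nbhd_point X ` points X = bipoints B" and inj: "inj_on (nbhd_point X) (points X)"
    by (auto simp: bij_betw_def)
  have sub: "openin (ptop X) U \<Longrightarrow> U \<subseteq> points X" "openin (ntop X) U \<Longrightarrow> U \<subseteq> points X" for U
    using openin_subset ts by metis+
  have ip: "nbhd_point X ` U = phi_pos B U" if "openin (ptop X) U" for U
    unfolding phi_pos_def img[symmetric] using sub(1)[OF that] nbhd_point_simps(1)[OF that] by auto
  have im: "nbhd_point X ` U = phi_neg B U" if "openin (ntop X) U" for U
    unfolding phi_neg_def img[symmetric] using sub(2)[OF that] nbhd_point_simps(2)[OF that] by auto
  have pre: "{x \<in> points X. nbhd_point X x \<in> nbhd_point X ` U} = U" if "U \<subseteq> points X" for U
    using inj that by (auto dest: inj_onD)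
  have "homeomorphic_map (ptop X) (ptop (bpt B)) (nbhd_point X)"
  proof (rule bijective_open_imp_homeomorphic_map)
    show "nbhd_point X ` topspace (ptop X) = topspace (ptop (bpt B))" by (simp add: ts tp(6) img)
    show "inj_on (nbhd_point X) (topspace (ptop X))" by (simp add: ts inj)
    show "open_map (ptop X) (ptop (bpt B)) (nbhd_point X)"
      unfolding open_map_def tp(1) bOmega_fin_sel(1) carrier_opens_frame using ip by blast
    show "continuous_map (ptop X) (ptop (bpt B)) (nbhd_point X)"
      unfolding continuous_map_def
    proof (intro conjI allI impI)
      show "nbhd_point X \<in> topspace (ptop X) \<rightarrow> topspace (ptop (bpt B))" using img by (auto simp: ts tp(6))
      fix W assume "openin (ptop (bpt B)) W"
      then obtain U where "openin (ptop X) U" "W = phi_pos B U"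
        unfolding tp(1) bOmega_fin_sel(1) carrier_opens_frame by blast
      then show "openin (ptop X) {x \<in> topspace (ptop X). nbhd_point X x \<in> W}"
        using pre[OF sub(1), of U] by (simp add: ts ip)
    qed
  qed
  moreover have "homeomorphic_map (ntop X) (ntop (bpt B)) (nbhd_point X)"
  proof (rule bijective_open_imp_homeomorphic_map)
    show "nbhd_point X ` topspace (ntop X) = topspace (ntop (bpt B))" by (simp add: ts tn(6) img)
    show "inj_on (nbhd_point X) (topspace (ntop X))" by (simp add: ts inj)
    show "open_map (ntop X) (ntop (bpt B)) (nbhd_point X)"
      unfolding open_map_def tn(1) bOmega_fin_sel(2) carrier_opens_frame using im by blast
    show "continuous_map (ntop X) (ntop (bpt B)) (nbhd_point X)"
      unfolding continuous_map_def
    proof (intro conjI allI impI)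
      show "nbhd_point X \<in> topspace (ntop X) \<rightarrow> topspace (ntop (bpt B))" using img by (auto simp: ts tn(6))
      fix W assume "openin (ntop (bpt B)) W"
      then obtain U where "openin (ntop X) U" "W = phi_neg B U"
        unfolding tn(1) bOmega_fin_sel(2) carrier_opens_frame by blast
      then show "openin (ntop X) {x \<in> topspace (ntop X). nbhd_point X x \<in> W}"
        using pre[OF sub(2), of U] by (simp add: ts im)
    qed
  qed
  ultimately show "bisober X" using X by (simp add: bisober_def bihomeomorphism_def)
qed

end

context fin_biframe
begin

text \<open>Bipoints of the opens of \<open>S\<close> correspond to the points of
  \<open>pclosure S\<close>: a point of the closure evaluates traces of open sets on
  \<open>S\<close>, and a bipoint of the opens, composed with taking traces, is a point of
  \<open>L\<close> satisfying all inequalities valid on \<open>S\<close>. The neighbourhood map is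
  always injective, so bisobriety says that the closure adds nothing.\<close>

lemma bisober_bisubspace_iff:
  assumes S: "S \<subseteq> bipoints L"
  shows "bisober (bisubspace (bpt L) S) \<longleftrightarrow> pclosure S = S"
proof -
  let ?Y = "bisubspace (bpt L) S"
  interpret Y: bispace_opens ?Y .
  have ts: "topspace (ptop ?Y) = S" "topspace (ntop ?Y) = S"
    using S by (auto simp: bisubspace_def phi_pos_simps(6) phi_neg_simps(6))
  have bis: "is_bispace ?Y" and pts: "points ?Y = S" by (simp_all add: is_bispace_def ts points_def)
  have op: "openin (ptop ?Y) W \<longleftrightarrow> (\<exists>a\<in>carrier (pos L). W = phi_pos L a \<inter> S)" for W
    by (auto simp: bisubspace_def openin_subtopology phi_pos_simps(1))
  have on: "openin (ntop ?Y) W \<longleftrightarrow> (\<exists>a\<in>carrier (neg L). W = phi_neg L a \<inter> S)" for W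
    by (auto simp: bisubspace_def openin_subtopology phi_neg_simps(1))
  have opI: "a \<in> carrier (pos L) \<Longrightarrow> openin (ptop ?Y) (phi_pos L a \<inter> S)" for a using op by blast
  have onI: "a \<in> carrier (neg L) \<Longrightarrow> openin (ntop ?Y) (phi_neg L a \<inter> S)" for a using on by blast
  have rp: "frame_map (pos L) Y.P (\<lambda>a. phi_pos L a \<inter> S)"
  proof (rule frame_mapI)
    show "phi_pos L \<top>\<^bsub>pos L\<^esub> \<inter> S = \<top>\<^bsub>Y.P\<^esub>" using S by (auto simp: opens_frame_simps ts phi_pos_simps(4))
    fix A assume A: "A \<subseteq> carrier (pos L)"
    then have "(\<lambda>a. phi_pos L a \<inter> S) ` A \<subseteq> {U. openin (ptop ?Y) U}" using opI by auto
    then show "phi_pos L (\<Squnion>\<^bsub>pos L\<^esub>A) \<inter> S = \<Squnion>\<^bsub>Y.P\<^esub>((\<lambda>a. phi_pos L a \<inter> S) ` A)"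
      using A by (simp add: phi_pos_simps(3) opens_frame_simps)
  qed (auto simp: opI opens_frame_simps phi_pos_simps(2))
  have rn: "frame_map (neg L) Y.N (\<lambda>a. phi_neg L a \<inter> S)"
  proof (rule frame_mapI)
    show "phi_neg L \<top>\<^bsub>neg L\<^esub> \<inter> S = \<top>\<^bsub>Y.N\<^esub>" using S by (auto simp: opens_frame_simps ts phi_neg_simps(4))
    fix A assume A: "A \<subseteq> carrier (neg L)"
    then have "(\<lambda>a. phi_neg L a \<inter> S) ` A \<subseteq> {U. openin (ntop ?Y) U}" using onI by auto
    then show "phi_neg L (\<Squnion>\<^bsub>neg L\<^esub>A) \<inter> S = \<Squnion>\<^bsub>Y.N\<^esub>((\<lambda>a. phi_neg L a \<inter> S) ` A)"
      using A by (simp add: phi_neg_simps(3) opens_frame_simps)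
  qed (auto simp: onI opens_frame_simps phi_neg_simps(2))
  have np: "fst (nbhd_point ?Y f) (phi_pos L a \<inter> S) \<longleftrightarrow> fst f a" if "f \<in> S" "a \<in> carrier (pos L)" for f a
    unfolding Y.nbhd_point_simps(1)[OF opI[OF that(2)]] using that(1) S by (auto simp: phi_pos_def)
  have nn: "snd (nbhd_point ?Y f) (phi_neg L a \<inter> S) \<longleftrightarrow> snd f a" if "f \<in> S" "a \<in> carrier (neg L)" for f a
    unfolding Y.nbhd_point_simps(2)[OF onI[OF that(2)]] using that(1) S by (auto simp: phi_neg_def)
  have inj: "inj_on (nbhd_point ?Y) S"
  proof (rule inj_onI)
    fix f f' assume ff: "f \<in> S" "f' \<in> S" "nbhd_point ?Y f = nbhd_point ?Y f'"
    then show "f = f'" using np[OF ff(1)] np[OF ff(2)] nn[OF ff(1)] nn[OF ff(2)] S by (intro bipoint_eqI[of f L f']) auto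
  qed
  have nb: "nbhd_point ?Y ` S \<subseteq> bipoints Y.B" using Y.nbhd_point_bipoint by (auto simp: ts)
  have Ybp: "frame_map Y.P two (fst h)" "frame_map Y.N two (snd h)" if "h \<in> bipoints Y.B" for h
    using bipoint_frame_maps[OF that] by (simp_all add: bOmega_fin_sel(1,2))
  show ?thesis
    unfolding Y.bisober_iff[OF bis] pts
  proof
    assume "bij_betw (nbhd_point ?Y) S (bipoints Y.B)"
    then have img: "nbhd_point ?Y ` S = bipoints Y.B" by (simp add: bij_betw_def)
    have "pclosure S \<subseteq> S"
    proof
      fix f assume f: "f \<in> pclosure S"
      then have fb: "f \<in> bipoints L" using pclosure_subset by auto
      note tb = bipoint_top_bot[OF fb]
      \<comment> \<open>Evaluation of traces is well defined: equality of two traces on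
        \<open>S\<close> is a pair of basic inequalities valid on \<open>S\<close>, and
        \<open>f\<close> satisfies both.\<close>
      have kp: "fst f a = fst f c" if ac: "a \<in> carrier (pos L)" "c \<in> carrier (pos L)" "phi_pos L a \<inter> S = phi_pos L c \<inter> S" for a c
      proof -
        have "covers S a \<top>\<^bsub>neg L\<^esub> c \<bottom>\<^bsub>neg L\<^esub>" "covers S c \<top>\<^bsub>neg L\<^esub> a \<bottom>\<^bsub>neg L\<^esub>"
          using ac by (auto simp: covers_def)
        then show ?thesis using pclosureD[OF f] tb by blast
      qed
      have kn: "snd f a = snd f c" if ac: "a \<in> carrier (neg L)" "c \<in> carrier (neg L)" "phi_neg L a \<inter> S = phi_neg L c \<inter> S" for a c
      proof -
        have "covers S \<top>\<^bsub>pos L\<^esub> a \<bottom>\<^bsub>pos L\<^esub> c" "covers S \<top>\<^bsub>pos L\<^esub> c \<bottom>\<^bsub>pos L\<^esub> a"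
          using ac by (auto simp: covers_def)
        then show ?thesis using pclosureD[OF f] tb by blast
      qed
      have surj: "carrier Y.P \<subseteq> (\<lambda>a. phi_pos L a \<inter> S) ` carrier (pos L)" "carrier Y.N \<subseteq> (\<lambda>a. phi_neg L a \<inter> S) ` carrier (neg L)"
        using op on by auto
      obtain gp where gp: "frame_map Y.P two gp" "\<And>a. a \<in> carrier (pos L) \<Longrightarrow> gp (phi_pos L a \<inter> S) = fst f a"
        using frame_map_factor[OF rp bipoint_frame_maps(1)[OF fb] P.complete_lattice_axioms surj(1) kp] by blast
      obtain gn where gn: "frame_map Y.N two gn" "\<And>a. a \<in> carrier (neg L) \<Longrightarrow> gn (phi_neg L a \<inter> S) = snd f a"
        using frame_map_factor[OF rn bipoint_frame_maps(2)[OF fb] N.complete_lattice_axioms surj(2) kn] by blast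
      let ?h = "(restrict gp {U. openin (ptop ?Y) U}, restrict gn {U. openin (ntop ?Y) U})"
      have "?h \<in> bipoints Y.B"
      proof (rule Y.bipoint_bOmegaI[OF gp(1) gn(1)])
        fix U U' V V' assume "openin (ptop ?Y) U" "openin (ntop ?Y) U'" "openin (ptop ?Y) V" "openin (ntop ?Y) V'"
          and sub: "U \<inter> U' \<subseteq> V \<union> V'" and g: "gp U" "gn U'"
        then obtain a b c d where abcd: "a \<in> carrier (pos L)" "b \<in> carrier (neg L)" "c \<in> carrier (pos L)" "d \<in> carrier (neg L)"
          and eq: "U = phi_pos L a \<inter> S" "U' = phi_neg L b \<inter> S" "V = phi_pos L c \<inter> S" "V' = phi_neg L d \<inter> S"
          unfolding op on by blast
        have "covers S a b c d" using abcd sub unfolding eq covers_def by blast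
        then show "gp V \<or> gn V'" using pclosureD[OF f] g abcd unfolding eq by (simp add: gp(2) gn(2))
      qed
      then obtain x where x: "x \<in> S" "?h = nbhd_point ?Y x" unfolding img[symmetric] by (rule imageE)
      have "fst x a = fst f a" if "a \<in> carrier (pos L)" for a
        using np[OF x(1) that] that unfolding x(2)[symmetric] by (simp add: opI gp(2))
      moreover have "snd x a = snd f a" if "a \<in> carrier (neg L)" for a
        using nn[OF x(1) that] that unfolding x(2)[symmetric] by (simp add: onI gn(2))
      ultimately have "x = f" using x(1) S fb by (intro bipoint_eqI) auto
      then show "f \<in> S" using x(1) by simp
    qed
    then show "pclosure S = S" using subset_pclosure[OF S] by blast
  next
    assume cl: "pclosure S = S"
    have "bipoints Y.B \<subseteq> nbhd_point ?Y ` S"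
    proof
      fix h assume h: "h \<in> bipoints Y.B"
      \<comment> \<open>An inequality valid on \<open>S\<close> is an inclusion between traces,
        hence part of the relation that defines \<open>bOmega_fin\<close>, and \<open>h\<close>
        respects it.\<close>
      have Yle: "fst h (phi_pos L c \<inter> S) \<or> snd h (phi_neg L d \<inter> S)"
        if "covers S a b c d" "fst h (phi_pos L a \<inter> S)" "snd h (phi_neg L b \<inter> S)" for a b c d
        by (rule Y.bipoint_bOmega_le[OF h opI onI opI onI _ that(2,3)])
          (use covers_closed[OF that(1)] that(1) in \<open>auto simp: covers_def\<close>)
      obtain k where k: "frame_map (main L) two k"
        "\<And>a. a \<in> carrier (pos L) \<Longrightarrow> k (epos L a) = fst h (phi_pos L a \<inter> S)"
        "\<And>b. b \<in> carrier (neg L) \<Longrightarrow> k (eneg L b) = snd h (phi_neg L b \<inter> S)"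
      \<comment> \<open>Finitariness of \<open>L\<close> produces the point on the main component:
        inequalities of \<open>L\<close> hold at every bipoint, in particular on \<open>S\<close>,
        so \<open>Yle\<close> applies to them.\<close>
      proof (rule finitary_extension[OF finitary frame_two frame_map_comp[OF rp Ybp(1)[OF h]] frame_map_comp[OF rn Ybp(2)[OF h]]])
        fix a b c d assume abcd: "a \<in> carrier (pos L)" "b \<in> carrier (neg L)" "c \<in> carrier (pos L)" "d \<in> carrier (neg L)"
          and le: "epos L a \<sqinter>\<^bsub>main L\<^esub> eneg L b \<sqsubseteq>\<^bsub>main L\<^esub> epos L c \<squnion>\<^bsub>main L\<^esub> eneg L d"
        have "covers S a b c d"
          unfolding covers_def
        proof (intro conjI abcd subsetI)
          fix f assume f: "f \<in> phi_pos L a \<inter> phi_neg L b \<inter> S"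
          then have fb: "f \<in> bipoints L" using S by auto
          have "ext_point L f (epos L a \<sqinter>\<^bsub>main L\<^esub> eneg L b) \<longrightarrow> ext_point L f (epos L c \<squnion>\<^bsub>main L\<^esub> eneg L d)"
            using frame_map_mono[OF frame_map_ext_point[OF fb] M.complete_lattice_axioms frame_imp_complete_lattice[OF frame_two] _ _ le]
              abcd by (simp add: le_bool_def)
          then show "f \<in> phi_pos L c \<union> phi_neg L d"
            using f fb abcd by (simp add: ext_point_rect ext_point_join phi_pos_def phi_neg_def)
        qed
        then show "fst h (phi_pos L a \<inter> S) \<sqinter>\<^bsub>two\<^esub> snd h (phi_neg L b \<inter> S) \<sqsubseteq>\<^bsub>two\<^esub>
            fst h (phi_pos L c \<inter> S) \<squnion>\<^bsub>two\<^esub> snd h (phi_neg L d \<inter> S)"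
          using Yle by (simp add: le_bool_def)
      qed blast
      obtain f where f: "f \<in> bipoints L" "\<And>a. a \<in> carrier (pos L) \<Longrightarrow> fst f a = fst h (phi_pos L a \<inter> S)"
        "\<And>b. b \<in> carrier (neg L) \<Longrightarrow> snd f b = snd h (phi_neg L b \<inter> S)"
        using point_of_main[OF k(1)] k(2,3) by metis
      have "f \<in> pclosure S"
        unfolding pclosure_def
      proof (intro CollectI conjI allI impI f(1))
        fix a b c d assume "covers S a b c d" "fst f a" "snd f b"
        then show "fst f c \<or> snd f d" using Yle[of a b c d] covers_closed[of S a b c d] by (simp add: f)
      qed
      then have fS: "f \<in> S" by (simp add: cl)
      have "h = nbhd_point ?Y f"
      proof (rule bipoint_eqI[OF h])
        show "nbhd_point ?Y f \<in> bipoints Y.B" using nb fS by auto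
        show "fst h W = fst (nbhd_point ?Y f) W" if "W \<in> carrier (pos Y.B)" for W
          using that np[OF fS] f(2) unfolding bOmega_fin_sel(1) carrier_opens_frame mem_Collect_eq op by auto
        show "snd h W = snd (nbhd_point ?Y f) W" if "W \<in> carrier (neg Y.B)" for W
          using that nn[OF fS] f(3) unfolding bOmega_fin_sel(2) carrier_opens_frame mem_Collect_eq on by auto
      qed
      then show "h \<in> nbhd_point ?Y ` S" using fS by blast
    qed
    then show "bij_betw (nbhd_point ?Y) S (bipoints Y.B)" using inj nb by (auto simp: bij_betw_def)
  qed
qed

lemma bi_TD_iff_bisober: "bi_TD (bpt L) \<longleftrightarrow> (\<forall>A \<subseteq> points (bpt L). bisober (bisubspace (bpt L) A))"
  unfolding bi_TD_iff_closed points_bpt by (simp add: bisober_bisubspace_iff)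

end

section \<open>The frame of congruences\<close>

locale subframe = complete_lattice L for L :: "'a gorder" (structure) +
  fixes T
  assumes T: "subframe_carrier L T"
begin

lemma subframe_subset: "T \<subseteq> carrier L"
  using T by (simp add: subframe_carrier_def)

lemma partial_order_subframe: "partial_order (L\<lparr>carrier := T\<rparr>)"
proof (rule partial_orderI)
  show "eq (L\<lparr>carrier := T\<rparr>) = (=)" by (simp add: eq_is_equal)
  show "le (L\<lparr>carrier := T\<rparr>) x z"
    if "x \<in> carrier (L\<lparr>carrier := T\<rparr>)" "y \<in> carrier (L\<lparr>carrier := T\<rparr>)" "z \<in> carrier (L\<lparr>carrier := T\<rparr>)"
      "le (L\<lparr>carrier := T\<rparr>) x y" "le (L\<lparr>carrier := T\<rparr>) y z" for x y z
    using that subframe_subset le_trans[of x y z] by auto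
qed (use subframe_subset in \<open>auto intro: le_antisym\<close>)

lemma sup_subframe: "A \<subseteq> T \<Longrightarrow> \<Squnion>\<^bsub>L\<lparr>carrier := T\<rparr>\<^esub>A = \<Squnion>A"
  by (rule partial_order.sup_eqI[OF partial_order_subframe])
    (use T subframe_subset sup_upper[of A] in \<open>auto simp: subframe_carrier_def intro!: sup_least\<close>)

lemma meet_subframe: "x \<in> T \<Longrightarrow> y \<in> T \<Longrightarrow> x \<sqinter>\<^bsub>L\<lparr>carrier := T\<rparr>\<^esub> y = x \<sqinter> y"
  by (rule partial_order.meet_eqI[OF partial_order_subframe])
    (use T subframe_subset in \<open>auto simp: subframe_carrier_def intro: meet_left meet_right meet_le\<close>)

lemma top_subframe: "\<top>\<^bsub>L\<lparr>carrier := T\<rparr>\<^esub> = \<top>"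
  by (rule partial_order.top_eqI[OF partial_order_subframe])
    (use T subframe_subset in \<open>auto simp: subframe_carrier_def\<close>)

lemma complete_lattice_subframe: "complete_lattice (L\<lparr>carrier := T\<rparr>)"
proof (rule complete_latticeI_sup[OF partial_order_subframe])
  fix A assume "A \<subseteq> carrier (L\<lparr>carrier := T\<rparr>)"
  then have A: "A \<subseteq> T" by simp
  then have AL: "A \<subseteq> carrier L" using subframe_subset by auto
  show "\<exists>s\<in>carrier (L\<lparr>carrier := T\<rparr>). (\<forall>a\<in>A. le (L\<lparr>carrier := T\<rparr>) a s) \<and>
      (\<forall>y\<in>carrier (L\<lparr>carrier := T\<rparr>). (\<forall>a\<in>A. le (L\<lparr>carrier := T\<rparr>) a y) \<longrightarrow> le (L\<lparr>carrier := T\<rparr>) s y)"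
    using A T subframe_subset sup_upper[OF AL]
    by (intro bexI[of _ "\<Squnion>A"]) (auto simp: subframe_carrier_def intro!: sup_least)
qed

lemma frame_map_from_subframe: "frame_map L K h \<Longrightarrow> frame_map (L\<lparr>carrier := T\<rparr>) K h"
  by (intro frame_mapI) (auto simp: subsetD[OF subframe_subset] subset_trans[OF _ subframe_subset] top_subframe meet_subframe sup_subframe frame_map_closed
      frame_map_top frame_map_meet frame_map_sup)

lemma frame_map_into_subframe:
  assumes "frame_map K L h" "h ` carrier K \<subseteq> T"
  shows "frame_map K (L\<lparr>carrier := T\<rparr>) h"
proof (rule frame_mapI)
  show "h (\<Squnion>\<^bsub>K\<^esub>A) = \<Squnion>\<^bsub>L\<lparr>carrier := T\<rparr>\<^esub>(h ` A)" if "A \<subseteq> carrier K" for A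
    using that assms(2) by (subst sup_subframe) (auto simp: frame_map_sup[OF assms(1)])
  show "h (x \<sqinter>\<^bsub>K\<^esub> y) = h x \<sqinter>\<^bsub>L\<lparr>carrier := T\<rparr>\<^esub> h y" if "x \<in> carrier K" "y \<in> carrier K" for x y
    using that assms(2) by (subst meet_subframe) (auto simp: frame_map_meet[OF assms(1)])
qed (use assms(2) in \<open>auto simp: top_subframe frame_map_top[OF assms(1)]\<close>)

end

locale complete_gorder = complete_lattice L for L :: "'a gorder" (structure)
begin

lemma subframe_carrier_generated:
  assumes "S \<subseteq> carrier L"
  shows "subframe_carrier L (\<Inter>{T. subframe_carrier L T \<and> S \<subseteq> T})"
proof -
  let ?F = "{T. subframe_carrier L T \<and> S \<subseteq> T}"
  have full: "carrier L \<in> ?F" using assms by (auto simp: subframe_carrier_def)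
  show ?thesis
    unfolding subframe_carrier_def[of L "\<Inter>?F"]
  proof (intro conjI ballI allI impI)
    show "\<Inter>?F \<subseteq> carrier L" using full by blast
    show "\<top> \<in> \<Inter>?F" by (auto simp: subframe_carrier_def)
    show "x \<sqinter> y \<in> \<Inter>?F" if "x \<in> \<Inter>?F" "y \<in> \<Inter>?F" for x y
    proof
      fix U assume U: "U \<in> ?F"
      then have "x \<in> U" "y \<in> U" using that by blast+
      then show "x \<sqinter> y \<in> U" using U by (simp add: subframe_carrier_def)
    qed
    show "\<Squnion>A \<in> \<Inter>?F" if "A \<subseteq> \<Inter>?F" for A
    proof
      fix U assume U: "U \<in> ?F"
      then have "A \<subseteq> U" using that by blast
      then show "\<Squnion>A \<in> U" using U by (simp add: subframe_carrier_def)
    qed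
  qed
qed

text \<open>The members of the generated subframe with property \<open>Pr\<close> form a subframe
  that contains \<open>S\<close>, so by minimality they are all of it.\<close>

lemma subframe_generated_induct:
  assumes S: "S \<subseteq> carrier L" and x: "x \<in> carrier (subframe_generated L S)"
    and base: "\<And>s. s \<in> S \<Longrightarrow> Pr s" and top: "Pr \<top>"
    and meet: "\<And>x y. x \<in> carrier (subframe_generated L S) \<Longrightarrow> y \<in> carrier (subframe_generated L S) \<Longrightarrow>
      Pr x \<Longrightarrow> Pr y \<Longrightarrow> Pr (x \<sqinter> y)"
    and sup: "\<And>A. A \<subseteq> carrier (subframe_generated L S) \<Longrightarrow> (\<And>a. a \<in> A \<Longrightarrow> Pr a) \<Longrightarrow> Pr (\<Squnion>A)"
  shows "Pr x"
proof -
  let ?G = "carrier (subframe_generated L S)"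
  have G: "subframe_carrier L ?G"
    using subframe_carrier_generated[OF S] by (simp add: subframe_generated_def)
  have "S \<subseteq> ?G" by (auto simp: subframe_generated_def)
  then have "subframe_carrier L {x \<in> ?G. Pr x} \<and> S \<subseteq> {x \<in> ?G. Pr x}"
    using G base top meet sup by (auto simp: subframe_carrier_def subset_iff)
  then have "?G \<subseteq> {x \<in> ?G. Pr x}" by (auto simp: subframe_generated_def)
  then show ?thesis using x by blast
qed

lemma subframe_generated_subset: "S \<subseteq> carrier (subframe_generated L S)"
  by (auto simp: subframe_generated_def)

lemma subframe_generated_eq: "subframe_generated L S = L\<lparr>carrier := carrier (subframe_generated L S)\<rparr>"
  by (simp add: subframe_generated_def)

lemma subframe_carrier_generated':
  "S \<subseteq> carrier L \<Longrightarrow> subframe_carrier L (carrier (subframe_generated L S))"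
  using subframe_carrier_generated by (simp add: subframe_generated_def)

end

section \<open>Open and closed congruences, and points of the congruence frame\<close>

locale frame_gorder = frame L for L :: "'a gorder" (structure)

sublocale frame_cong \<subseteq> frame_gorder ..

lemma (in frame_cong) cong_join: "(x, x') \<in> C \<Longrightarrow> (y, y') \<in> C \<Longrightarrow> (x \<squnion> y, x' \<squnion> y') \<in> C"
proof -
  assume xy: "(x, x') \<in> C" "(y, y') \<in> C"
  \<comment> \<open>A binary join is treated as a join indexed by the two truth values.\<close>
  have "(\<Squnion>((\<lambda>b. if b then x else y) ` UNIV), \<Squnion>((\<lambda>b. if b then x' else y') ` UNIV)) \<in> C"
    by (rule cong_sup) (use xy in auto)
  then show ?thesis by (simp add: UNIV_bool join_def insert_commute)
qed

context frame_gorder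
begin

lemma nabla_iff:
  assumes "a \<in> carrier L" "x \<in> carrier L" "y \<in> carrier L"
  shows "(x, y) \<in> nabla L a \<longleftrightarrow> x \<sqsubseteq> y \<squnion> a \<and> y \<sqsubseteq> x \<squnion> a"
proof
  assume "(x, y) \<in> nabla L a"
  then have "x \<squnion> a = y \<squnion> a" by (simp add: nabla_def)
  then show "x \<sqsubseteq> y \<squnion> a \<and> y \<sqsubseteq> x \<squnion> a" using assms by (metis join_left)
next
  assume "x \<sqsubseteq> y \<squnion> a \<and> y \<sqsubseteq> x \<squnion> a"
  then have "x \<squnion> a \<sqsubseteq> y \<squnion> a" "y \<squnion> a \<sqsubseteq> x \<squnion> a" using assms by (auto simp: join_le_iff join_right)
  then show "(x, y) \<in> nabla L a" using assms by (simp add: nabla_def le_antisym)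
qed

lemma nabla_closed: "(x, y) \<in> nabla L a \<Longrightarrow> x \<in> carrier L \<and> y \<in> carrier L"
  by (simp add: nabla_def)

lemma frame_cong_nabla:
  assumes a: "a \<in> carrier L"
  shows "frame_cong L (nabla L a)"
proof (rule frame_congI[OF frame_axioms], unfold frame_congruence_def, intro conjI allI impI)
  show "equiv (carrier L) (nabla L a)"
    by (auto simp: nabla_def equiv_def refl_on_def sym_def trans_def)
  show "\<forall>(x, x')\<in>nabla L a. \<forall>(y, y')\<in>nabla L a. (x \<sqinter> y, x' \<sqinter> y') \<in> nabla L a"
  proof clarify
    fix x x' y y' assume "(x, x') \<in> nabla L a" "(y, y') \<in> nabla L a"
    then show "(x \<sqinter> y, x' \<sqinter> y') \<in> nabla L a"
      using a join_meet_distrib[of a x y] join_meet_distrib[of a x' y'] by (auto simp: nabla_def join_comm[of L _ a])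
  qed
  fix S assume S: "S \<subseteq> nabla L a"
  have cl: "fst ` S \<subseteq> carrier L" "snd ` S \<subseteq> carrier L" using S by (auto simp: nabla_def)
  \<comment> \<open>Joining with \<open>a\<close> does not commute with the empty join, so the two
    suprema are compared by inequalities rather than computed.\<close>
  have le: "x \<sqsubseteq> y \<squnion> a" "y \<sqsubseteq> x \<squnion> a" "x \<in> carrier L" "y \<in> carrier L" if "(x, y) \<in> S" for x y
    using that S nabla_iff[of a x y] nabla_closed[of x y a] a by auto
  have up: "x \<sqsubseteq> \<Squnion>(fst ` S)" "y \<sqsubseteq> \<Squnion>(snd ` S)" if "(x, y) \<in> S" for x y
    using that by (auto intro!: sup_upper cl intro: rev_image_eqI)
  have "x \<sqsubseteq> \<Squnion>(snd ` S) \<squnion> a" if "(x, y) \<in> S" for x y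
  proof -
    have "y \<squnion> a \<sqsubseteq> \<Squnion>(snd ` S) \<squnion> a"
      using le[OF that] up(2)[OF that] a cl by (auto simp: join_le_iff join_right intro: le_trans[OF _ join_left])
    then show ?thesis using le[OF that] a cl by (meson le_trans join_closed sup_closed)
  qed
  then have 1: "\<Squnion>(fst ` S) \<sqsubseteq> \<Squnion>(snd ` S) \<squnion> a" using cl a by (intro sup_least) auto
  have "y \<sqsubseteq> \<Squnion>(fst ` S) \<squnion> a" if "(x, y) \<in> S" for x y
  proof -
    have "x \<squnion> a \<sqsubseteq> \<Squnion>(fst ` S) \<squnion> a"
      using le[OF that] up(1)[OF that] a cl by (auto simp: join_le_iff join_right intro: le_trans[OF _ join_left])
    then show ?thesis using le[OF that] a cl by (meson le_trans join_closed sup_closed)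
  qed
  then have 2: "\<Squnion>(snd ` S) \<sqsubseteq> \<Squnion>(fst ` S) \<squnion> a" using cl a by (intro sup_least) auto
  show "(\<Squnion>(fst ` S), \<Squnion>(snd ` S)) \<in> nabla L a" using 1 2 cl a by (simp add: nabla_iff)
qed

lemma frame_cong_delta:
  assumes a: "a \<in> carrier L"
  shows "frame_cong L (delta L a)"
proof (rule frame_congI[OF frame_axioms], unfold frame_congruence_def, intro conjI allI impI)
  show "equiv (carrier L) (delta L a)"
    by (auto simp: delta_def equiv_def refl_on_def sym_def trans_def)
  show "\<forall>(x, x')\<in>delta L a. \<forall>(y, y')\<in>delta L a. (x \<sqinter> y, x' \<sqinter> y') \<in> delta L a"
  proof clarify
    fix x x' y y' assume xy: "(x, x') \<in> delta L a" "(y, y') \<in> delta L a"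
    have "x \<sqinter> y \<sqinter> a = (x \<sqinter> a) \<sqinter> (y \<sqinter> a)" if "x \<in> carrier L" "y \<in> carrier L" for x y
    proof -
      have "(x \<sqinter> a) \<sqinter> (y \<sqinter> a) = x \<sqinter> (y \<sqinter> (a \<sqinter> a))"
        using that a by (simp add: meet_assoc meet_left_comm del: meet_self)
      then show ?thesis using that a by (simp add: meet_self meet_assoc)
    qed
    then show "(x \<sqinter> y, x' \<sqinter> y') \<in> delta L a" using xy by (auto simp: delta_def)
  qed
  fix S assume S: "S \<subseteq> delta L a"
  have cl: "fst ` S \<subseteq> carrier L" "snd ` S \<subseteq> carrier L" using S by (auto simp: delta_def)
  have "(\<lambda>y. y \<sqinter> a) ` fst ` S = (\<lambda>y. y \<sqinter> a) ` snd ` S"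
    unfolding image_image using S by (intro image_cong) (auto simp: delta_def)
  then show "(\<Squnion>(fst ` S), \<Squnion>(snd ` S)) \<in> delta L a"
    using cl a by (simp add: delta_def Sup_inf_distrib)
qed

end

context frame_cong
begin

text \<open>\<open>nabla L a\<close> is the least congruence that collapses \<open>a\<close> to
  bottom: if \<open>C\<close> does so, then \<open>x\<close> is congruent to
  \<open>x \<squnion> a\<close> for every \<open>x\<close>. Inclusions thus reduce to one
  pair.\<close>

lemma nabla_subset_iff:
  assumes a: "a \<in> carrier L"
  shows "nabla L a \<subseteq> C \<longleftrightarrow> (\<bottom>, a) \<in> C"
proof
  have "(\<bottom>, a) \<in> nabla L a" using a by (simp add: nabla_iff join_right)
  then show "nabla L a \<subseteq> C \<Longrightarrow> (\<bottom>, a) \<in> C" by blast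
next
  assume ba: "(\<bottom>, a) \<in> C"
  show "nabla L a \<subseteq> C"
  proof clarify
    fix x y assume xy: "(x, y) \<in> nabla L a"
    then have c: "x \<in> carrier L" "y \<in> carrier L" "x \<squnion> a = y \<squnion> a" by (auto simp: nabla_def)
    have "(x, x \<squnion> a) \<in> C" using cong_join[OF cong_refl[OF c(1)] ba] c by (simp add: join_bottom_eq)
    moreover have "(y \<squnion> a, y) \<in> C"
      using cong_sym[OF cong_join[OF cong_refl[OF c(2)] ba]] c by (simp add: join_bottom_eq)
    ultimately show "(x, y) \<in> C" using c(3) cong_trans by metis
  qed
qed

text \<open>Dually, \<open>delta L a\<close> is the least congruence that collapses \<open>a\<close>
  to top, since \<open>x \<sqinter> a\<close> is then congruent to \<open>x\<close>.\<close>

lemma delta_subset_iff: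
  assumes a: "a \<in> carrier L"
  shows "delta L a \<subseteq> C \<longleftrightarrow> (a, \<top>) \<in> C"
proof
  have "(a, \<top>) \<in> delta L a" using a by (simp add: delta_def top_meet_eq meet_self)
  then show "delta L a \<subseteq> C \<Longrightarrow> (a, \<top>) \<in> C" by blast
next
  assume at: "(a, \<top>) \<in> C"
  show "delta L a \<subseteq> C"
  proof clarify
    fix x y assume xy: "(x, y) \<in> delta L a"
    then have c: "x \<in> carrier L" "y \<in> carrier L" "x \<sqinter> a = y \<sqinter> a" by (auto simp: delta_def)
    have "(x \<sqinter> a, x) \<in> C" using cong_meet[OF cong_refl[OF c(1)] at] c by (simp add: meet_top_eq)
    moreover have "(y \<sqinter> a, y) \<in> C" using cong_meet[OF cong_refl[OF c(2)] at] c by (simp add: meet_top_eq)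
    ultimately show "(x, y) \<in> C" using c(3) cong_trans cong_sym by metis
  qed
qed

end

context frame_gorder
begin

lemma carrier_congruence_frame: "C \<in> carrier (congruence_frame L) \<longleftrightarrow> frame_cong L C"
  using frame_congI[OF frame_axioms] frame_cong.congr by (auto simp: congruence_frame_def)

lemma le_congruence_frame: "le (congruence_frame L) = (\<subseteq>)"
  by (simp add: congruence_frame_def)

lemma frame_cong_subset: "frame_cong L C \<Longrightarrow> C \<subseteq> carrier L \<times> carrier L"
  using frame_cong.cong_closed by fastforce

lemma complete_lattice_congruence_frame: "complete_lattice (congruence_frame L)"
  unfolding congruence_frame_def
proof (rule complete_lattice_inclusion_order)
  show "carrier L \<times> carrier L \<in> {C. frame_congruence L C}"
    by (simp add: frame_congruence_full complete_lattice_axioms)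
  show "{C. frame_congruence L C} \<subseteq> Pow (carrier L \<times> carrier L)"
    using frame_cong_subset frame_congI[OF frame_axioms] by blast
  show "\<Inter>A \<in> {C. frame_congruence L C}" if "A \<subseteq> {C. frame_congruence L C}" "A \<noteq> {}" for A
    using that by (auto intro!: frame_congruence_INT complete_lattice_axioms)
qed

sublocale A: complete_gorder "congruence_frame L"
  by (intro complete_gorder.intro complete_lattice_congruence_frame)

lemma top_congruence_frame: "\<top>\<^bsub>congruence_frame L\<^esub> = carrier L \<times> carrier L"
  unfolding congruence_frame_def
proof (rule top_inclusion_order)
  show "carrier L \<times> carrier L \<in> {C. frame_congruence L C}"
    by (simp add: frame_congruence_full complete_lattice_axioms)
  show "{C. frame_congruence L C} \<subseteq> Pow (carrier L \<times> carrier L)"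
    using frame_cong_subset frame_congI[OF frame_axioms] by blast
qed

lemma meet_congruence_frame:
  assumes "frame_cong L C" "frame_cong L D"
  shows "C \<sqinter>\<^bsub>congruence_frame L\<^esub> D = C \<inter> D"
proof -
  have "frame_congruence L (\<Inter>{C, D})"
    by (rule frame_congruence_INT) (use assms in \<open>auto intro: complete_lattice_axioms frame_cong.congr\<close>)
  then show ?thesis
    unfolding congruence_frame_def using assms by (intro meet_inclusion_order) (auto intro: frame_cong.congr)
qed

text \<open>Binary meets reduce to distributivity of joins over meets. For joins, a congruence above
  all \<open>nabla L s\<close> identifies bottom with each \<open>s\<close>, hence with their
  supremum, and \<open>nabla_subset_iff\<close> turns this back into an inclusion.\<close>

lemma frame_map_nabla: "frame_map L (congruence_frame L) (nabla L)"
proof (rule frame_mapI)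
  show nc: "nabla L x \<in> carrier (congruence_frame L)" if "x \<in> carrier L" for x
    using that by (simp add: carrier_congruence_frame frame_cong_nabla)
  show "nabla L \<top> = \<top>\<^bsub>congruence_frame L\<^esub>"
  proof -
    have "x \<squnion> \<top> = \<top>" if "x \<in> carrier L" for x
      using that by (metis join_right le_antisym join_closed top_closed top_higher)
    then show ?thesis by (auto simp: top_congruence_frame nabla_def)
  qed
  show "nabla L (x \<sqinter> y) = nabla L x \<sqinter>\<^bsub>congruence_frame L\<^esub> nabla L y" if "x \<in> carrier L" "y \<in> carrier L" for x y
  proof -
    have "(u, v) \<in> nabla L (x \<sqinter> y) \<longleftrightarrow> (u, v) \<in> nabla L x \<and> (u, v) \<in> nabla L y"
      if "u \<in> carrier L" "v \<in> carrier L" for u v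
      using that \<open>x \<in> carrier L\<close> \<open>y \<in> carrier L\<close> by (auto simp: nabla_iff join_meet_distrib meet_le_iff)
    then have "nabla L (x \<sqinter> y) = nabla L x \<inter> nabla L y"
      using nabla_closed by (intro equalityI subrelI IntI) blast+
    then show ?thesis using that by (simp add: meet_congruence_frame frame_cong_nabla)
  qed
  show "nabla L (\<Squnion>S) = \<Squnion>\<^bsub>congruence_frame L\<^esub>(nabla L ` S)" if S: "S \<subseteq> carrier L" for S
  proof (rule A.sup_eqI[symmetric])
    show "nabla L (\<Squnion>S) \<in> carrier (congruence_frame L)" "nabla L ` S \<subseteq> carrier (congruence_frame L)"
      using S nc by auto
    fix D assume "D \<in> nabla L ` S"
    then obtain s where s: "s \<in> S" "D = nabla L s" by auto
    interpret n: frame_cong L "nabla L (\<Squnion>S)" using S by (intro frame_cong_nabla) simp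
    have "(\<bottom>, s) \<in> nabla L (\<Squnion>S)"
      using s S subsetD[OF S s(1)] sup_upper[OF S s(1)] by (simp add: nabla_iff bottom_join_eq)
    then show "D \<sqsubseteq>\<^bsub>congruence_frame L\<^esub> nabla L (\<Squnion>S)"
      unfolding s(2) le_congruence_frame n.nabla_subset_iff[OF subsetD[OF S s(1)]] .
  next
    fix D assume D: "D \<in> carrier (congruence_frame L)" "\<And>E. E \<in> nabla L ` S \<Longrightarrow> E \<sqsubseteq>\<^bsub>congruence_frame L\<^esub> D"
    interpret D: frame_cong L D using D(1) by (simp add: carrier_congruence_frame)
    have "(\<bottom>, s) \<in> D" if "s \<in> S" for s
      using D(2)[of "nabla L s"] that S by (auto simp: le_congruence_frame D.nabla_subset_iff)
    then have "(\<Squnion>((\<lambda>_. \<bottom>) ` S), \<Squnion>((\<lambda>s. s) ` S)) \<in> D" by (rule D.cong_sup)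
    moreover have "\<Squnion>((\<lambda>_. \<bottom>) ` S) = \<bottom>" by (rule sup_eqI) auto
    ultimately show "nabla L (\<Squnion>S) \<sqsubseteq>\<^bsub>congruence_frame L\<^esub> D"
      using S by (simp add: le_congruence_frame D.nabla_subset_iff)
  qed
qed

text \<open>The join identifies bottom with \<open>b\<close> and \<open>b\<close> with top, hence
  everything. The meet is equality because in a distributive lattice an element is determined by its
  join and its meet with \<open>b\<close>. Bottom is written as an empty join, the form that frame
  maps and subframes preserve directly.\<close>

lemma nabla_delta_complement:
  assumes b: "b \<in> carrier L"
  shows "\<Squnion>\<^bsub>congruence_frame L\<^esub>{nabla L b, delta L b} = \<top>\<^bsub>congruence_frame L\<^esub>"
    and "nabla L b \<sqinter>\<^bsub>congruence_frame L\<^esub> delta L b = \<Squnion>\<^bsub>congruence_frame L\<^esub>{}"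
proof -
  have nd: "{nabla L b, delta L b} \<subseteq> carrier (congruence_frame L)"
    using b by (simp add: carrier_congruence_frame frame_cong_nabla frame_cong_delta)
  let ?D = "\<Squnion>\<^bsub>congruence_frame L\<^esub>{nabla L b, delta L b}"
  have Dc: "?D \<in> carrier (congruence_frame L)" using A.sup_closed[OF nd] .
  interpret D: frame_cong L ?D using Dc by (simp only: carrier_congruence_frame)
  have "nabla L b \<subseteq> ?D" "delta L b \<subseteq> ?D" using A.sup_upper[OF nd] by (simp_all add: le_congruence_frame)
  then have "(\<bottom>, b) \<in> ?D" "(b, \<top>) \<in> ?D" using b by (simp_all add: D.nabla_subset_iff D.delta_subset_iff)
  then have bt: "(\<bottom>, \<top>) \<in> ?D" by (rule D.cong_trans)
  have xb: "(\<bottom>, x) \<in> ?D" if x: "x \<in> carrier L" for x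
    using D.cong_meet[OF D.cong_refl[OF x] bt] x by (simp add: meet_bottom_eq meet_top_eq)
  have "(x, y) \<in> ?D" if "x \<in> carrier L" "y \<in> carrier L" for x y
    using D.cong_trans[OF D.cong_sym[OF xb[OF that(1)]] xb[OF that(2)]] .
  then show "?D = \<top>\<^bsub>congruence_frame L\<^esub>"
    using frame_cong_subset[OF D.frame_cong_axioms] by (auto simp: top_congruence_frame)
  have id: "x = y" if "(x, y) \<in> nabla L b" "(x, y) \<in> delta L b" for x y
  proof -
    have c: "x \<in> carrier L" "y \<in> carrier L" "x \<squnion> b = y \<squnion> b" "x \<sqinter> b = y \<sqinter> b"
      using that by (auto simp: nabla_def delta_def)
    have "x = x \<sqinter> (y \<squnion> b)" using c b by (metis join_left meet_absorb_iff join_closed)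
    also have "\<dots> = (x \<sqinter> y) \<squnion> (y \<sqinter> b)" using c b by (simp add: meet_join_distrib)
    also have "\<dots> = y \<sqinter> (x \<squnion> b)" using c(1,2) b by (simp add: meet_join_distrib meet_comm[of L x y])
    also have "\<dots> = y" using c b by (metis join_left meet_absorb_iff join_closed)
    finally show ?thesis .
  qed
  show "nabla L b \<sqinter>\<^bsub>congruence_frame L\<^esub> delta L b = \<Squnion>\<^bsub>congruence_frame L\<^esub>{}"
    unfolding meet_congruence_frame[OF frame_cong_nabla[OF b] frame_cong_delta[OF b]]
  proof (rule A.sup_eqI[symmetric])
    show "nabla L b \<inter> delta L b \<in> carrier (congruence_frame L)"
      using A.meet_closed[of "nabla L b" "delta L b"] nd
      by (simp add: meet_congruence_frame[OF frame_cong_nabla[OF b] frame_cong_delta[OF b]])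
    fix E assume "E \<in> carrier (congruence_frame L)"
    then interpret E: frame_cong L E by (simp only: carrier_congruence_frame)
    show "nabla L b \<inter> delta L b \<sqsubseteq>\<^bsub>congruence_frame L\<^esub> E"
      unfolding le_congruence_frame
    proof clarify
      fix x y assume xy: "(x, y) \<in> nabla L b" "(x, y) \<in> delta L b"
      then show "(x, y) \<in> E" using id[OF xy] nabla_closed[OF xy(1)] E.cong_refl by simp
    qed
  qed auto
qed

text \<open>A complement of a principal down-set preserves joins automatically; preserving binary
  meets means that the kernel of a point is meet-prime. So from pairs separated by \<open>h\<close>
  in \<open>C\<close> and in \<open>D\<close>, a separated pair in the intersection has to be
  built.\<close>

lemma frame_map_not_subset_kernel:
  assumes h: "frame_map L two h"
  shows "frame_map (congruence_frame L) two (\<lambda>C. \<not> C \<subseteq> kernel_cong L h)"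
proof -
  have K: "kernel_cong L h \<in> carrier (congruence_frame L)"
    unfolding carrier_congruence_frame
    by (intro frame_congI frame_axioms frame_congruence_kernel[OF h] complete_lattice_axioms)
  have hb: "\<not> h \<bottom>" "h \<top>"
    using frame_map_bottom[OF h complete_lattice_axioms frame_imp_complete_lattice[OF frame_two]] frame_map_top[OF h]
    by auto
  \<comment> \<open>Symmetry of \<open>C\<close> allows a separated pair to be oriented so that
    \<open>h\<close> goes from false to true.\<close>
  have wit: "\<exists>x y. (x, y) \<in> C \<and> \<not> h x \<and> h y" if C: "frame_cong L C" "\<not> C \<subseteq> kernel_cong L h" for C
  proof -
    interpret frame_cong L C by (fact C(1))
    obtain x y where xy: "(x, y) \<in> C" "(x, y) \<notin> kernel_cong L h" using C(2) by auto
    then have "h x \<noteq> h y" using cong_closed[of x y] by (auto simp: kernel_cong_def)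
    then show ?thesis using xy(1) cong_sym[OF xy(1)] by metis
  qed
  have "\<not> C \<inter> D \<subseteq> kernel_cong L h"
    if CD: "frame_cong L C" "frame_cong L D" "\<not> C \<subseteq> kernel_cong L h" "\<not> D \<subseteq> kernel_cong L h" for C D
  proof -
    interpret C: frame_cong L C by (fact CD(1))
    interpret D: frame_cong L D by (fact CD(2))
    obtain x y where xy: "(x, y) \<in> C" "\<not> h x" "h y" using wit CD by blast
    obtain u v where uv: "(u, v) \<in> D" "\<not> h u" "h v" using wit CD by blast
    have c: "x \<in> carrier L" "y \<in> carrier L" "u \<in> carrier L" "v \<in> carrier L"
      using C.cong_closed[OF xy(1)] D.cong_closed[OF uv(1)] by auto
    let ?z = "y \<sqinter> v"
    have absorb: "z \<squnion> (z \<sqinter> w) = z" if "z \<in> carrier L" "w \<in> carrier L" for z w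
      using that meet_left[OF that] by (intro join_eqI) auto
    \<comment> \<open>Replacing \<open>x\<close> by \<open>y\<close>, or \<open>u\<close> by \<open>v\<close>, turns \<open>?p\<close> into \<open>?z\<close>.\<close>
    let ?p = "(x \<sqinter> ?z) \<squnion> (u \<sqinter> ?z)"
    have "((x \<sqinter> ?z) \<squnion> (u \<sqinter> ?z), (y \<sqinter> ?z) \<squnion> (u \<sqinter> ?z)) \<in> C"
      using c by (intro C.cong_join C.cong_meet C.cong_refl xy(1)) auto
    moreover have "y \<sqinter> ?z = ?z" using c by (simp add: meet_assoc[symmetric] meet_self)
    ultimately have 1: "(?p, ?z) \<in> C" using c absorb[of ?z u] by (simp add: meet_comm[of L u])
    have "((x \<sqinter> ?z) \<squnion> (u \<sqinter> ?z), (x \<sqinter> ?z) \<squnion> (v \<sqinter> ?z)) \<in> D"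
      using c by (intro D.cong_join D.cong_meet D.cong_refl uv(1)) auto
    moreover have "v \<sqinter> ?z = ?z" using c meet_left_comm[of v y v] by (simp add: meet_self)
    ultimately have 2: "(?p, ?z) \<in> D"
      using c absorb[of ?z x] by (simp add: meet_comm[of L x] join_comm[of L _ ?z])
    have "\<not> h ?p" "h ?z"
      using c xy uv by (simp_all add: frame_map_join[OF h] frame_map_meet[OF h])
    then have "(?p, ?z) \<notin> kernel_cong L h" by (simp add: kernel_cong_def)
    then show ?thesis using 1 2 by blast
  qed
  note meet = this
  show ?thesis
  proof (rule frame_mapI)
    have "(\<bottom>, \<top>) \<in> carrier L \<times> carrier L" "(\<bottom>, \<top>) \<notin> kernel_cong L h" using hb by (auto simp: kernel_cong_def)
    then show "(\<not> \<top>\<^bsub>congruence_frame L\<^esub> \<subseteq> kernel_cong L h) = \<top>\<^bsub>two\<^esub>"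
      unfolding top_congruence_frame by auto
    show "(\<not> C \<sqinter>\<^bsub>congruence_frame L\<^esub> D \<subseteq> kernel_cong L h) = (\<not> C \<subseteq> kernel_cong L h) \<sqinter>\<^bsub>two\<^esub> (\<not> D \<subseteq> kernel_cong L h)"
      if "C \<in> carrier (congruence_frame L)" "D \<in> carrier (congruence_frame L)" for C D
      using that meet[of C D] unfolding carrier_congruence_frame by (auto simp: meet_congruence_frame)
    show "(\<not> \<Squnion>\<^bsub>congruence_frame L\<^esub>F \<subseteq> kernel_cong L h) = \<Squnion>\<^bsub>two\<^esub>((\<lambda>C. \<not> C \<subseteq> kernel_cong L h) ` F)"
      if "F \<subseteq> carrier (congruence_frame L)" for F
      using A.sup_le_iff[OF that K] by (auto simp: le_congruence_frame image_iff)
  qed simp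
qed

end

section \<open>Bipoints of the assembly\<close>

sublocale fin_biframe \<subseteq> MG: frame_gorder "main L"
  by (intro frame_gorder.intro frame_main)

context fin_biframe
begin

abbreviation cf where "cf \<equiv> congruence_frame (main L)"
abbreviation AL where "AL \<equiv> assembly L"

definition gen_pos where
  "gen_pos = (\<lambda>a. nabla (main L) (epos L a)) ` carrier (pos L) \<union> (\<lambda>b. delta (main L) (eneg L b)) ` carrier (neg L)"
definition gen_neg where
  "gen_neg = (\<lambda>b. nabla (main L) (eneg L b)) ` carrier (neg L) \<union> (\<lambda>a. delta (main L) (epos L a)) ` carrier (pos L)"
definition gen_main where
  "gen_main = nabla (main L) ` carrier (main L) \<union> delta (main L) ` fin L"

lemma assembly_sel:
  "pos AL = subframe_generated cf gen_pos" "neg AL = subframe_generated cf gen_neg"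
  "main AL = subframe_generated cf gen_main" "epos AL = id" "eneg AL = id"
  by (simp_all add: assembly_def gen_pos_def gen_neg_def gen_main_def Let_def)

lemma gen_closed: "gen_pos \<subseteq> carrier cf" "gen_neg \<subseteq> carrier cf" "gen_main \<subseteq> carrier cf"
  using fin_closed
  by (auto simp: gen_pos_def gen_neg_def gen_main_def MG.carrier_congruence_frame subset_iff
      intro!: MG.frame_cong_nabla MG.frame_cong_delta)

lemma gen_sub: "gen_pos \<subseteq> carrier (pos AL)" "gen_neg \<subseteq> carrier (neg AL)" "gen_main \<subseteq> carrier (main AL)"
  unfolding assembly_sel by (rule MG.A.subframe_generated_subset)+

lemma gen_mem:
  "a \<in> carrier (pos L) \<Longrightarrow> nabla (main L) (epos L a) \<in> gen_pos"
  "b \<in> carrier (neg L) \<Longrightarrow> delta (main L) (eneg L b) \<in> gen_pos"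
  "b \<in> carrier (neg L) \<Longrightarrow> nabla (main L) (eneg L b) \<in> gen_neg"
  "a \<in> carrier (pos L) \<Longrightarrow> delta (main L) (epos L a) \<in> gen_neg"
  "x \<in> carrier (main L) \<Longrightarrow> nabla (main L) x \<in> gen_main"
  "x \<in> fin L \<Longrightarrow> delta (main L) x \<in> gen_main"
  by (auto simp: gen_pos_def gen_neg_def gen_main_def)

lemma subframe_AL:
  "subframe cf (carrier (pos AL))" "subframe cf (carrier (neg AL))" "subframe cf (carrier (main AL))"
  unfolding assembly_sel
  by (intro subframe.intro subframe_axioms.intro MG.complete_lattice_congruence_frame
      MG.A.subframe_carrier_generated' gen_closed)+

lemma AL_eq:
  "pos AL = cf\<lparr>carrier := carrier (pos AL)\<rparr>" "neg AL = cf\<lparr>carrier := carrier (neg AL)\<rparr>"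
  "main AL = cf\<lparr>carrier := carrier (main AL)\<rparr>"
  unfolding assembly_sel by (rule MG.A.subframe_generated_eq)+

lemma complete_lattice_AL: "complete_lattice (pos AL)" "complete_lattice (neg AL)" "complete_lattice (main AL)"
  by (subst AL_eq, rule subframe.complete_lattice_subframe subframe_AL; rule subframe_AL)+

text \<open>The value of the extension of \<open>f\<close> to the assembly: the congruence that \<open>C\<close> generates on
  \<open>2\<close> along the point \<open>f\<close> is either trivial or everything, and it is everything iff \<open>C\<close> is not
  contained in the kernel.\<close>

definition off where
  "off f C \<longleftrightarrow> \<not> C \<subseteq> kernel_cong (main L) (ext_point L f)"

lemma frame_map_off:
  assumes "f \<in> bipoints L"
  shows "frame_map cf two (off f)" "frame_map (pos AL) two (off f)" "frame_map (neg AL) two (off f)"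
    "frame_map (main AL) two (off f)"
proof -
  show *: "frame_map cf two (off f)"
    using MG.frame_map_not_subset_kernel[OF frame_map_ext_point[OF assms]] unfolding off_def .
  show "frame_map (pos AL) two (off f)" "frame_map (neg AL) two (off f)" "frame_map (main AL) two (off f)"
    by (subst AL_eq, rule subframe.frame_map_from_subframe[OF _ *], rule subframe_AL)+
qed

lemma off_nabla:
  assumes f: "f \<in> bipoints L" and x: "x \<in> carrier (main L)"
  shows "off f (nabla (main L) x) \<longleftrightarrow> ext_point L f x"
proof -
  interpret frame_cong "main L" "kernel_cong (main L) (ext_point L f)" by (rule frame_cong_point[OF f])
  have "\<not> ext_point L f \<bottom>\<^bsub>main L\<^esub>"
    using frame_map_bottom[OF frame_map_ext_point[OF f] M.complete_lattice_axioms frame_imp_complete_lattice[OF frame_two]]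
    by simp
  then show ?thesis unfolding off_def nabla_subset_iff[OF x] using x by (simp add: kernel_cong_def)
qed

lemma off_delta:
  assumes f: "f \<in> bipoints L" and x: "x \<in> carrier (main L)"
  shows "off f (delta (main L) x) \<longleftrightarrow> \<not> ext_point L f x"
proof -
  interpret frame_cong "main L" "kernel_cong (main L) (ext_point L f)" by (rule frame_cong_point[OF f])
  have "ext_point L f \<top>\<^bsub>main L\<^esub>" using frame_map_top[OF frame_map_ext_point[OF f]] by simp
  then show ?thesis unfolding off_def delta_subset_iff[OF x] using x by (simp add: kernel_cong_def)
qed

lemma off_gen:
  assumes f: "f \<in> bipoints L"
  shows "a \<in> carrier (pos L) \<Longrightarrow> off f (nabla (main L) (epos L a)) \<longleftrightarrow> fst f a"
    "b \<in> carrier (neg L) \<Longrightarrow> off f (nabla (main L) (eneg L b)) \<longleftrightarrow> snd f b"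
    "a \<in> carrier (pos L) \<Longrightarrow> off f (delta (main L) (epos L a)) \<longleftrightarrow> \<not> fst f a"
    "b \<in> carrier (neg L) \<Longrightarrow> off f (delta (main L) (eneg L b)) \<longleftrightarrow> \<not> snd f b"
  using ext_point[OF f] by (simp_all add: off_nabla[OF f] off_delta[OF f])

definition asm where
  "asm f = (restrict (off f) (carrier (pos AL)), restrict (off f) (carrier (neg AL)))"

lemma asm_bipoint:
  assumes "f \<in> bipoints L"
  shows "asm f \<in> bipoints AL"
  unfolding asm_def
  by (rule bipointI[OF frame_map_off(4) complete_lattice_AL(1,2) frame_map_off(2,3)])
    (use assms in \<open>simp_all add: assembly_sel(4,5)\<close>)

lemma asm_simps:
  "C \<in> carrier (pos AL) \<Longrightarrow> fst (asm f) C = off f C" "C \<in> carrier (neg AL) \<Longrightarrow> snd (asm f) C = off f C"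
  by (simp_all add: asm_def)

lemma asm_extends:
  assumes "f \<in> bipoints L"
  shows "extends_to_assembly L f (asm f)"
  using gen_sub gen_mem by (auto simp: extends_to_assembly_def asm_simps off_gen[OF assms] subset_iff)

text \<open>On the main component of the assembly, \<open>nabla\<close> and \<open>delta\<close> of
  a finite element are complements, and a frame map to \<open>two\<close> gives opposite values on
  complements. The two generators lie in different parts; the extension to the main component links
  the two functions of a bipoint.\<close>

lemma bipoint_AL_complement:
  assumes g: "g \<in> bipoints AL"
  shows "a \<in> carrier (pos L) \<Longrightarrow> snd g (delta (main L) (epos L a)) \<longleftrightarrow> \<not> fst g (nabla (main L) (epos L a))"
    and "b \<in> carrier (neg L) \<Longrightarrow> fst g (delta (main L) (eneg L b)) \<longleftrightarrow> \<not> snd g (nabla (main L) (eneg L b))"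
proof -
  define k where "k = ext_point AL g"
  have k: "frame_map (main AL) two k" "\<And>C. C \<in> carrier (pos AL) \<Longrightarrow> k C = fst g C"
    "\<And>C. C \<in> carrier (neg AL) \<Longrightarrow> k C = snd g C"
    using ext_point[OF g] by (simp_all add: k_def assembly_sel(4,5))
  \<comment> \<open>Only for elements of \<open>fin L\<close> is \<open>delta\<close> among the
    generators of the main component; the embedded positive and negative elements are such.\<close>
  have compl: "k (delta (main L) x) \<longleftrightarrow> \<not> k (nabla (main L) x)" if x: "x \<in> fin L" for x
  proof -
    have xm: "x \<in> carrier (main L)" using x fin_closed by auto
    let ?n = "nabla (main L) x" and ?d = "delta (main L) x"
    have nd: "?n \<in> carrier (main AL)" "?d \<in> carrier (main AL)"
      using gen_sub(3) gen_mem(5)[OF xm] gen_mem(6)[OF x] by auto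
    have "\<Squnion>\<^bsub>main AL\<^esub>{?n, ?d} = \<Squnion>\<^bsub>cf\<^esub>{?n, ?d}"
      using subframe.sup_subframe[OF subframe_AL(3), of "{?n, ?d}"] nd by (simp flip: AL_eq(3))
    also have "\<dots> = \<top>\<^bsub>main AL\<^esub>"
      using MG.nabla_delta_complement(1)[OF xm] subframe.top_subframe[OF subframe_AL(3)] by (simp flip: AL_eq(3))
    finally have "k ?n \<or> k ?d"
      using frame_map_sup[OF k(1), of "{?n, ?d}"] nd frame_map_top[OF k(1)] by auto
    moreover have "?n \<sqinter>\<^bsub>main AL\<^esub> ?d = \<Squnion>\<^bsub>main AL\<^esub>{}"
      using subframe.meet_subframe[OF subframe_AL(3) nd] MG.nabla_delta_complement(2)[OF xm]
        subframe.sup_subframe[OF subframe_AL(3), of "{}"] by (simp flip: AL_eq(3))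
    then have "\<not> (k ?n \<and> k ?d)"
      using frame_map_meet[OF k(1) nd] frame_map_sup[OF k(1), of "{}"] by simp
    ultimately show ?thesis by blast
  qed
  show "snd g (delta (main L) (epos L a)) \<longleftrightarrow> \<not> fst g (nabla (main L) (epos L a))" if a: "a \<in> carrier (pos L)"
    using compl[OF epos_in_fin[OF a]] k(2,3) gen_sub gen_mem(1,4)[OF a] by (metis subsetD)
  show "fst g (delta (main L) (eneg L b)) \<longleftrightarrow> \<not> snd g (nabla (main L) (eneg L b))" if b: "b \<in> carrier (neg L)"
    using compl[OF eneg_in_fin[OF b]] k(2,3) gen_sub gen_mem(2,3)[OF b] by (metis subsetD)
qed

lemma frame_maps_subframe_eq:
  assumes S: "S \<subseteq> carrier cf" and u: "frame_map (subframe_generated cf S) two u"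
    and v: "frame_map (subframe_generated cf S) two v"
    and eq: "\<And>s. s \<in> S \<Longrightarrow> u s = v s" and C: "C \<in> carrier (subframe_generated cf S)"
  shows "u C = v C"
proof (rule MG.A.subframe_generated_induct[OF S C, where Pr = "\<lambda>C. u C = v C"])
  let ?G = "carrier (subframe_generated cf S)"
  interpret sub: subframe cf ?G
    by (intro subframe.intro subframe_axioms.intro MG.complete_lattice_congruence_frame
        MG.A.subframe_carrier_generated' S)
  note [simp] = MG.A.subframe_generated_eq[of S, symmetric]
  show "u \<top>\<^bsub>cf\<^esub> = v \<top>\<^bsub>cf\<^esub>"
    using frame_map_top[OF u] frame_map_top[OF v] sub.top_subframe by simp
  show "u (x \<sqinter>\<^bsub>cf\<^esub> y) = v (x \<sqinter>\<^bsub>cf\<^esub> y)" if "x \<in> ?G" "y \<in> ?G" "u x = v x" "u y = v y" for x y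
    using frame_map_meet[OF u that(1,2)] frame_map_meet[OF v that(1,2)] sub.meet_subframe[OF that(1,2)] that by simp
  show "u (\<Squnion>\<^bsub>cf\<^esub>A) = v (\<Squnion>\<^bsub>cf\<^esub>A)" if A: "A \<subseteq> ?G" "\<And>a. a \<in> A \<Longrightarrow> u a = v a" for A
    using frame_map_sup[OF u A(1)] frame_map_sup[OF v A(1)] sub.sup_subframe[OF A(1)] A(2) by auto
qed (rule eq)

text \<open>Extending \<open>f\<close> prescribes the values on the generators \<open>nabla\<close>,
  and complementation prescribes those on \<open>delta\<close>. A frame map is determined by its
  values on the generators of a subframe.\<close>

lemma asm_unique:
  assumes f: "f \<in> bipoints L" and g: "g \<in> bipoints AL" and ext: "extends_to_assembly L f g"
  shows "g = asm f"
proof (rule bipoint_eqI[OF g asm_bipoint[OF f]])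
  note e = asm_extends[OF f]
  have p: "fst g s = fst (asm f) s" if "s \<in> gen_pos" for s
    using that ext e bipoint_AL_complement(2)[OF g] bipoint_AL_complement(2)[OF asm_bipoint[OF f]]
    by (auto simp: gen_pos_def extends_to_assembly_def)
  have n: "snd g s = snd (asm f) s" if "s \<in> gen_neg" for s
    using that ext e bipoint_AL_complement(1)[OF g] bipoint_AL_complement(1)[OF asm_bipoint[OF f]]
    by (auto simp: gen_neg_def extends_to_assembly_def)
  show "fst g C = fst (asm f) C" if "C \<in> carrier (pos AL)" for C
    by (rule frame_maps_subframe_eq[OF gen_closed(1)])
      (use that p bipoint_frame_maps(1)[OF g] bipoint_frame_maps(1)[OF asm_bipoint[OF f]] in \<open>simp_all add: assembly_sel(1)\<close>)
  show "snd g C = snd (asm f) C" if "C \<in> carrier (neg AL)" for C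
    by (rule frame_maps_subframe_eq[OF gen_closed(2)])
      (use that n bipoint_frame_maps(2)[OF g] bipoint_frame_maps(2)[OF asm_bipoint[OF f]] in \<open>simp_all add: assembly_sel(2)\<close>)
qed

text \<open>Composing the extension of \<open>g\<close> with \<open>nabla (main L)\<close>, a frame
  map from \<open>main L\<close> to the main component of the assembly, gives a point
  \<open>f\<close> of \<open>L\<close>. By construction \<open>g\<close> extends this
  \<open>f\<close>, so uniqueness identifies it with \<open>asm f\<close>.\<close>

lemma bipoint_AL_is_asm:
  assumes g: "g \<in> bipoints AL"
  obtains f where "f \<in> bipoints L" "g = asm f"
proof -
  have k: "frame_map (main AL) two (ext_point AL g)" "\<And>C. C \<in> carrier (pos AL) \<Longrightarrow> ext_point AL g C = fst g C"
    "\<And>C. C \<in> carrier (neg AL) \<Longrightarrow> ext_point AL g C = snd g C"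
    using ext_point[OF g] by (simp_all add: assembly_sel(4,5))
  have "frame_map (main L) (main AL) (nabla (main L))"
    by (subst AL_eq(3), rule subframe.frame_map_into_subframe[OF subframe_AL(3) MG.frame_map_nabla])
      (use gen_sub(3) gen_mem(5) in auto)
  from frame_map_comp[OF this k(1)]
  obtain f where f: "f \<in> bipoints L"
    "\<And>a. a \<in> carrier (pos L) \<Longrightarrow> fst f a = ext_point AL g (nabla (main L) (epos L a))"
    "\<And>b. b \<in> carrier (neg L) \<Longrightarrow> snd f b = ext_point AL g (nabla (main L) (eneg L b))"
    by (rule point_of_main) blast
  have "extends_to_assembly L f g"
    using f(2,3) k(2,3) gen_sub gen_mem(1,3) by (auto simp: extends_to_assembly_def subset_iff)
  then show thesis using that f(1) asm_unique[OF f(1) g] by blast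
qed

lemma ex1_assembly:
  assumes f: "f \<in> bipoints L"
  shows "\<exists>!g. g \<in> bipoints AL \<and> extends_to_assembly L f g"
  using asm_bipoint[OF f] asm_extends[OF f] asm_unique[OF f] by blast

lemma assembly_point_eq: "f \<in> bipoints L \<Longrightarrow> assembly_point L f = asm f"
  unfolding assembly_point_def using asm_bipoint asm_extends asm_unique by (intro the_equality) auto

lemma bij_asm: "bij_betw asm (bipoints L) (bipoints AL)"
  unfolding bij_betw_def
proof
  show "inj_on asm (bipoints L)"
  proof (rule inj_onI)
    fix f f' assume f: "f \<in> bipoints L" "f' \<in> bipoints L" "asm f = asm f'"
    then have "extends_to_assembly L f' (asm f)" using asm_extends by metis
    then show "f = f'"
      using asm_extends[OF f(1)] by (intro bipoint_eqI[OF f(1,2)]) (auto simp: extends_to_assembly_def)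
  qed
  show "asm ` bipoints L = bipoints AL" using asm_bipoint bipoint_AL_is_asm by blast
qed

section \<open>The topologies on the bipoints of the assembly\<close>

definition off_set where "off_set C = {f \<in> bipoints L. off f C}"

lemma asm_phi:
  "C \<in> carrier (pos AL) \<Longrightarrow> f \<in> bipoints L \<Longrightarrow> asm f \<in> phi_pos AL C \<longleftrightarrow> f \<in> off_set C"
  "C \<in> carrier (neg AL) \<Longrightarrow> f \<in> bipoints L \<Longrightarrow> asm f \<in> phi_neg AL C \<longleftrightarrow> f \<in> off_set C"
  by (simp_all add: phi_pos_def phi_neg_def asm_bipoint asm_simps off_set_def)

lemma off_set_gen:
  "a \<in> carrier (pos L) \<Longrightarrow> off_set (nabla (main L) (epos L a)) = phi_pos L a"
  "b \<in> carrier (neg L) \<Longrightarrow> off_set (nabla (main L) (eneg L b)) = phi_neg L b"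
  "a \<in> carrier (pos L) \<Longrightarrow> off_set (delta (main L) (epos L a)) = bipoints L - phi_pos L a"
  "b \<in> carrier (neg L) \<Longrightarrow> off_set (delta (main L) (eneg L b)) = bipoints L - phi_neg L b"
  by (auto simp: off_set_def off_gen phi_pos_def phi_neg_def)

text \<open>Since each \<open>off f\<close> is a frame map, \<open>off_set\<close> turns finite
  meets and all joins of congruences into intersections and unions. Properties of open sets pass
  from the generators to the whole generated subframe.\<close>

lemma off_set_induct:
  assumes S: "S \<subseteq> carrier cf" and C: "C \<in> carrier (subframe_generated cf S)"
    and base: "\<And>s. s \<in> S \<Longrightarrow> Pr (off_set s)" and top: "Pr (bipoints L)"
    and Int: "\<And>U V. Pr U \<Longrightarrow> Pr V \<Longrightarrow> Pr (U \<inter> V)"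
    and Un: "\<And>\<U>. (\<And>U. U \<in> \<U> \<Longrightarrow> Pr U) \<Longrightarrow> Pr (\<Union>\<U>)"
  shows "Pr (off_set C)"
proof (rule MG.A.subframe_generated_induct[OF S C, where Pr = "\<lambda>C. Pr (off_set C)"])
  let ?G = "carrier (subframe_generated cf S)"
  have G: "?G \<subseteq> carrier cf"
    using MG.A.subframe_carrier_generated'[OF S] by (simp add: subframe_carrier_def)
  have "off_set \<top>\<^bsub>cf\<^esub> = bipoints L"
    using frame_map_top[OF frame_map_off(1)] by (auto simp: off_set_def)
  then show "Pr (off_set \<top>\<^bsub>cf\<^esub>)" using top by simp
  show "Pr (off_set (x \<sqinter>\<^bsub>cf\<^esub> y))" if "x \<in> ?G" "y \<in> ?G" "Pr (off_set x)" "Pr (off_set y)" for x y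
  proof -
    have "off_set (x \<sqinter>\<^bsub>cf\<^esub> y) = off_set x \<inter> off_set y"
      using frame_map_meet[OF frame_map_off(1)] that G by (auto simp: off_set_def subset_iff)
    then show ?thesis using Int that by simp
  qed
  show "Pr (off_set (\<Squnion>\<^bsub>cf\<^esub>A))" if A: "A \<subseteq> ?G" "\<And>a. a \<in> A \<Longrightarrow> Pr (off_set a)" for A
  proof -
    have "A \<subseteq> carrier cf" using A(1) G by blast
    then have "off_set (\<Squnion>\<^bsub>cf\<^esub>A) = \<Union>(off_set ` A)"
      using frame_map_sup[OF frame_map_off(1)] by (auto simp: off_set_def image_iff)
    then show ?thesis using Un[of "off_set ` A"] A(2) by auto
  qed
qed (rule base)

end

text \<open>For the inverse it suffices to test the subbasis, whose preimages under the inverse are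
  the direct images under \<open>j\<close>.\<close>

lemma homeomorphic_map_generated:
  assumes bij: "bij_betw j X Y" and X: "\<Union>\<S> = X" and Y: "topspace T = Y"
    and pre: "\<And>V. openin T V \<Longrightarrow> openin (topology_generated_by \<S>) {x \<in> X. j x \<in> V}"
    and img: "\<And>U. U \<in> \<S> \<Longrightarrow> openin T (j ` U)"
  shows "homeomorphic_map (topology_generated_by \<S>) T j"
proof -
  let ?i = "inv_into X j"
  have ts: "topspace (topology_generated_by \<S>) = X" by (simp add: X)
  have "continuous_map (topology_generated_by \<S>) T j"
    unfolding continuous_map_def ts Y using bij_betw_apply[OF bij] pre by auto
  moreover have "continuous_map T (topology_generated_by \<S>) ?i"
  proof (rule continuous_on_generated_topo)
    fix U assume U: "U \<in> \<S>"
    then have "U \<subseteq> X" using X by blast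
    then have "?i -` U \<inter> topspace T = j ` U"
      using bij unfolding Y by (auto simp: bij_betw_inv_into_left bij_betw_inv_into_right bij_betw_apply subset_iff
          intro: rev_image_eqI)
    then show "openin T (?i -` U \<inter> topspace T)" using img[OF U] by simp
  next
    show "?i ` topspace T \<subseteq> \<Union>\<S>"
      using bij_betw_imp_surj_on[OF bij_betw_inv_into[OF bij]] by (simp add: X Y)
  qed
  ultimately have "homeomorphic_maps (topology_generated_by \<S>) T j ?i"
    unfolding homeomorphic_maps_def ts Y
    using bij by (auto simp: bij_betw_inv_into_left bij_betw_inv_into_right)
  then show ?thesis by (rule homeomorphic_maps_imp_map)
qed

context fin_biframe
begin

lemmas phi_pos_AL = openin_phi_pos[OF complete_lattice_AL(1)]
lemmas phi_neg_AL = openin_phi_neg[OF complete_lattice_AL(2)]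

lemma asm_image:
  "C \<in> carrier (pos AL) \<Longrightarrow> asm ` off_set C = phi_pos AL C"
  "C \<in> carrier (neg AL) \<Longrightarrow> asm ` off_set C = phi_neg AL C"
proof -
  have *: "asm ` off_set C = V"
    if iff: "\<And>f. f \<in> bipoints L \<Longrightarrow> asm f \<in> V \<longleftrightarrow> f \<in> off_set C" and V: "V \<subseteq> bipoints AL" for C V
  proof
    show "asm ` off_set C \<subseteq> V" using iff by (auto simp: off_set_def)
    show "V \<subseteq> asm ` off_set C"
    proof
      fix g assume g: "g \<in> V"
      then obtain f where "f \<in> bipoints L" "g = asm f" using V bipoint_AL_is_asm by blast
      then show "g \<in> asm ` off_set C" using iff g by blast
    qed
  qed
  show "C \<in> carrier (pos AL) \<Longrightarrow> asm ` off_set C = phi_pos AL C"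
    by (rule *) (auto simp: asm_phi, auto simp: phi_pos_def)
  show "C \<in> carrier (neg AL) \<Longrightarrow> asm ` off_set C = phi_neg AL C"
    by (rule *) (auto simp: asm_phi, auto simp: phi_neg_def)
qed

lemma off_set_generated_open:
  assumes S: "S \<subseteq> carrier cf" and C: "C \<in> carrier (subframe_generated cf S)"
    and base: "\<And>s. s \<in> S \<Longrightarrow> openin T (off_set s)" and top: "openin T (bipoints L)"
  shows "openin T (off_set C)"
  by (rule off_set_induct[OF S C]) (use base top in auto)

lemma closed_phi:
  "closedin (ptop (bpt L)) K \<longleftrightarrow> (\<exists>a\<in>carrier (pos L). K = bipoints L - phi_pos L a)"
  "closedin (ntop (bpt L)) K \<longleftrightarrow> (\<exists>b\<in>carrier (neg L). K = bipoints L - phi_neg L b)"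
proof -
  have c: "K \<subseteq> X \<and> X - K = U \<longleftrightarrow> K = X - U" if "U \<subseteq> X" for K X U :: "'x set" using that by auto
  have "phi_pos L a \<subseteq> bipoints L" "phi_neg L b \<subseteq> bipoints L" for a b by (auto simp: phi_pos_def phi_neg_def)
  then show "closedin (ptop (bpt L)) K \<longleftrightarrow> (\<exists>a\<in>carrier (pos L). K = bipoints L - phi_pos L a)"
    "closedin (ntop (bpt L)) K \<longleftrightarrow> (\<exists>b\<in>carrier (neg L). K = bipoints L - phi_neg L b)"
    unfolding closedin_def phi_pos_simps(1,6) phi_neg_simps(1,6) using c by metis+
qed

lemma homeomorphic_asm:
  assumes S: "S \<subseteq> carrier cf" and basis: "\<S> = off_set ` S" and US: "\<Union>\<S> = bipoints L"
    and ts: "topspace T = bipoints AL"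
    and op: "\<And>V. openin T V \<longleftrightarrow> (\<exists>C\<in>carrier (subframe_generated cf S). V = asm ` off_set C)"
  shows "homeomorphic_map (topology_generated_by \<S>) T asm"
proof (rule homeomorphic_map_generated[OF bij_asm US ts])
  fix V assume "openin T V"
  then obtain C where C: "C \<in> carrier (subframe_generated cf S)" "V = asm ` off_set C" unfolding op by blast
  have "off_set C \<subseteq> bipoints L" by (auto simp: off_set_def)
  then have "{x \<in> bipoints L. asm x \<in> V} = off_set C"
    using bij_asm unfolding C(2) by (auto simp: bij_betw_def dest: inj_onD)
  moreover have "openin (topology_generated_by \<S>) (off_set C)"
  proof (rule off_set_generated_open[OF S C(1)])
    show "openin (topology_generated_by \<S>) (off_set s)" if "s \<in> S" for s
      using that basis by (intro topology_generated_by_Basis) simp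
    show "openin (topology_generated_by \<S>) (bipoints L)"
      using openin_topspace[of "topology_generated_by \<S>"] US by simp
  qed
  ultimately show "openin (topology_generated_by \<S>) {x \<in> bipoints L. asm x \<in> V}" by simp
next
  fix U assume "U \<in> \<S>"
  then show "openin T (asm ` U)"
    using MG.A.subframe_generated_subset[of S] unfolding op basis by blast
qed

text \<open>Under \<open>off_set\<close>, the generators \<open>nabla\<close> become open sets and
  the generators \<open>delta\<close> become their complements. Mixing the two signs in the
  components of the assembly matches the mixing of open and closed sets in
  \<open>Sk\<close>.\<close>

lemma Sk_basis:
  "{U. openin (ptop (bpt L)) U} \<union> {K. closedin (ntop (bpt L)) K} = off_set ` gen_pos"
  "{U. openin (ntop (bpt L)) U} \<union> {K. closedin (ptop (bpt L)) K} = off_set ` gen_neg"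
proof -
  have "off_set ` gen_pos = phi_pos L ` carrier (pos L) \<union> (\<lambda>b. bipoints L - phi_neg L b) ` carrier (neg L)"
    by (simp add: gen_pos_def image_Un image_image off_set_gen cong: image_cong_simp)
  then show "{U. openin (ptop (bpt L)) U} \<union> {K. closedin (ntop (bpt L)) K} = off_set ` gen_pos"
    unfolding phi_pos_simps(1) closed_phi by auto
  have "off_set ` gen_neg = phi_neg L ` carrier (neg L) \<union> (\<lambda>a. bipoints L - phi_pos L a) ` carrier (pos L)"
    by (simp add: gen_neg_def image_Un image_image off_set_gen cong: image_cong_simp)
  then show "{U. openin (ntop (bpt L)) U} \<union> {K. closedin (ptop (bpt L)) K} = off_set ` gen_neg"
    unfolding phi_neg_simps(1) closed_phi by auto
qed

lemma topspace_Sk: "topspace (ptop (Sk (bpt L))) = bipoints L" "topspace (ntop (Sk (bpt L))) = bipoints L"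
  using phi_pos_simps(6) phi_neg_simps(6) openin_subset closedin_subset
    openin_topspace[of "ptop (bpt L)"] openin_topspace[of "ntop (bpt L)"]
  by (simp_all add: Sk_def) blast+

lemma homeomorphic_asm_pos: "homeomorphic_map (ptop (Sk (bpt L))) (ptop (bpt AL)) asm"
  and homeomorphic_asm_neg: "homeomorphic_map (ntop (Sk (bpt L))) (ntop (bpt AL)) asm"
proof -
  have "openin (ptop (bpt AL)) V \<longleftrightarrow> (\<exists>C\<in>carrier (subframe_generated cf gen_pos). V = asm ` off_set C)" for V
    unfolding phi_pos_AL(1) unfolding assembly_sel(1)[symmetric] using asm_image(1) by auto
  then show "homeomorphic_map (ptop (Sk (bpt L))) (ptop (bpt AL)) asm"
    using homeomorphic_asm[OF gen_closed(1) Sk_basis(1) _ phi_pos_AL(6)] topspace_Sk(1) by (simp add: Sk_def)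
  have "openin (ntop (bpt AL)) V \<longleftrightarrow> (\<exists>C\<in>carrier (subframe_generated cf gen_neg). V = asm ` off_set C)" for V
    unfolding phi_neg_AL(1) unfolding assembly_sel(2)[symmetric] using asm_image(2) by auto
  then show "homeomorphic_map (ntop (Sk (bpt L))) (ntop (bpt AL)) asm"
    using homeomorphic_asm[OF gen_closed(2) Sk_basis(2) _ phi_neg_AL(6)] topspace_Sk(2) by (simp add: Sk_def)
qed

lemma bihomeomorphism_assembly_point: "bihomeomorphism (Sk (bpt L)) (bpt AL) (assembly_point L)"
  unfolding bihomeomorphism_def
  using homeomorphic_map_eq[OF homeomorphic_asm_pos] homeomorphic_map_eq[OF homeomorphic_asm_neg]
  by (simp add: topspace_Sk assembly_point_eq)

text \<open>Each set or complement is defined by one inequality with the element in one place and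
  top or bottom in the others, for instance \<open>\<top> \<sqsubseteq> a\<close> for the closed set
  \<open>phi_pos L a\<close>. The closure satisfies the same inequality.\<close>

lemma phi_open_sets:
  "a \<in> carrier (pos L) \<Longrightarrow> phi_pos L a \<in> open_sets"
  "a \<in> carrier (pos L) \<Longrightarrow> bipoints L - phi_pos L a \<in> open_sets"
  "b \<in> carrier (neg L) \<Longrightarrow> phi_neg L b \<in> open_sets"
  "b \<in> carrier (neg L) \<Longrightarrow> bipoints L - phi_neg L b \<in> open_sets"
proof -
  have clI: "pclosure S = S"
    if "S \<subseteq> bipoints L" "\<And>f. f \<in> pclosure S \<Longrightarrow> f \<in> bipoints L \<Longrightarrow> f \<in> S" for S
    using that subset_pclosure[OF that(1)] pclosure_subset[of S] by blast
  have sub: "phi_pos L a \<subseteq> bipoints L" "phi_neg L b \<subseteq> bipoints L" for a b by (auto simp: phi_pos_def phi_neg_def)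
  have dd: "bipoints L - (bipoints L - phi_pos L a) = phi_pos L a" "bipoints L - (bipoints L - phi_neg L b) = phi_neg L b" for a b
    using sub(1)[of a] sub(2)[of b] by auto
  {
    assume a: "a \<in> carrier (pos L)"
    have "pclosure (bipoints L - phi_pos L a) = bipoints L - phi_pos L a"
    proof (rule clI)
      fix f assume f: "f \<in> pclosure (bipoints L - phi_pos L a)" "f \<in> bipoints L"
      have "covers (bipoints L - phi_pos L a) a \<top>\<^bsub>neg L\<^esub> \<bottom>\<^bsub>pos L\<^esub> \<bottom>\<^bsub>neg L\<^esub>" using a by (auto simp: covers_def)
      then show "f \<in> bipoints L - phi_pos L a"
        using pclosureD[OF f(1)] f(2) bipoint_top_bot[OF f(2)] by (auto simp: phi_pos_def)
    qed auto
    then show "phi_pos L a \<in> open_sets" using sub by simp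
    have "pclosure (phi_pos L a) = phi_pos L a"
    proof (rule clI[OF sub(1)])
      fix f assume f: "f \<in> pclosure (phi_pos L a)" "f \<in> bipoints L"
      have "covers (phi_pos L a) \<top>\<^bsub>pos L\<^esub> \<top>\<^bsub>neg L\<^esub> a \<bottom>\<^bsub>neg L\<^esub>" using a by (auto simp: covers_def)
      then show "f \<in> phi_pos L a"
        using pclosureD[OF f(1)] f(2) bipoint_top_bot[OF f(2)] by (auto simp: phi_pos_def)
    qed
    then show "bipoints L - phi_pos L a \<in> open_sets" by (simp only: mem_Collect_eq dd) auto
  }
  {
    assume b: "b \<in> carrier (neg L)"
    have "pclosure (bipoints L - phi_neg L b) = bipoints L - phi_neg L b"
    proof (rule clI)
      fix f assume f: "f \<in> pclosure (bipoints L - phi_neg L b)" "f \<in> bipoints L"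
      have "covers (bipoints L - phi_neg L b) \<top>\<^bsub>pos L\<^esub> b \<bottom>\<^bsub>pos L\<^esub> \<bottom>\<^bsub>neg L\<^esub>" using b by (auto simp: covers_def)
      then show "f \<in> bipoints L - phi_neg L b"
        using pclosureD[OF f(1)] f(2) bipoint_top_bot[OF f(2)] by (auto simp: phi_neg_def)
    qed auto
    then show "phi_neg L b \<in> open_sets" using sub by simp
    have "pclosure (phi_neg L b) = phi_neg L b"
    proof (rule clI[OF sub(2)])
      fix f assume f: "f \<in> pclosure (phi_neg L b)" "f \<in> bipoints L"
      have "covers (phi_neg L b) \<top>\<^bsub>pos L\<^esub> \<top>\<^bsub>neg L\<^esub> \<bottom>\<^bsub>pos L\<^esub> b" using b by (auto simp: covers_def)
      then show "f \<in> phi_neg L b"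
        using pclosureD[OF f(1)] f(2) bipoint_top_bot[OF f(2)] by (auto simp: phi_neg_def)
    qed
    then show "bipoints L - phi_neg L b \<in> open_sets" by (simp only: mem_Collect_eq dd) auto
  }
qed

lemma off_set_open_sets:
  assumes "C \<in> carrier (pos AL) \<union> carrier (neg AL)"
  shows "off_set C \<in> open_sets"
proof -
  have top: "bipoints L \<in> open_sets" by (simp add: pclosure_empty)
  have "off_set C \<in> open_sets" if S: "S \<subseteq> gen_pos \<union> gen_neg" "C \<in> carrier (subframe_generated cf S)" for S
  proof (rule off_set_induct[where Pr = "\<lambda>U. U \<in> open_sets", OF _ S(2)])
    show "S \<subseteq> carrier cf" using S(1) gen_closed by blast
    show "off_set s \<in> open_sets" if "s \<in> S" for s
    proof -
      have "s \<in> gen_pos \<union> gen_neg" using S(1) that by blast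
      then show ?thesis
        using phi_open_sets unfolding gen_pos_def gen_neg_def by (elim UnE imageE) (simp_all only: off_set_gen)
    qed
    show "\<Union>\<U> \<in> open_sets" if "\<And>U. U \<in> \<U> \<Longrightarrow> U \<in> open_sets" for \<U>
      by (rule open_sets_Union) (use that in blast)
  qed (fact top, rule open_sets_Int)
  from this[of gen_pos] this[of gen_neg] show ?thesis using assms by (auto simp: assembly_sel(1,2))
qed

text \<open>Patch-open sets of the assembly pull back along the bijection \<open>asm\<close> to
  complements of closed sets, so an open singleton yields an isolated point. Conversely, an
  inequality isolating \<open>f\<close> provides patch-open sets whose intersection is the singleton
  of \<open>asm f\<close>, and unions of singletons are arbitrary sets.\<close>

lemma patch_discrete_iff: "patch_discrete (bpt AL) \<longleftrightarrow> bi_TD (bpt L)"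
proof -
  let ?G = "{U. openin (ptop (bpt AL)) U} \<union> {U. openin (ntop (bpt AL)) U}"
  have pts: "points (bpt AL) = bipoints AL" by (simp add: points_def phi_pos_AL(6))
  have UG: "\<Union>?G = bipoints AL"
    using phi_pos_AL(6) phi_neg_AL(6) openin_subset openin_topspace[of "ptop (bpt AL)"] by blast
  show ?thesis
  proof
    assume "patch_discrete (bpt AL)"
    then have disc: "openin (topology_generated_by ?G) W" if "W \<subseteq> bipoints AL" for W
      using that by (simp add: patch_discrete_def patch_def pts)
    \<comment> \<open>Induction over the generation of the patch topology; on the subbasis the
      pullback of a basic open set given by \<open>C\<close> is \<open>off_set C\<close>.\<close>
    have op: "{f \<in> bipoints L. asm f \<in> W} \<in> open_sets" if "generate_topology_on ?G W" for W
      using that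
    proof induction
      case Empty
      show ?case using open_sets_Union[of "{}"] by simp
    next
      case (Int a b)
      have "{f \<in> bipoints L. asm f \<in> a \<inter> b} = {f \<in> bipoints L. asm f \<in> a} \<inter> {f \<in> bipoints L. asm f \<in> b}" by auto
      then show ?case using open_sets_Int[OF Int.IH] by simp
    next
      case (UN K)
      have "{f \<in> bipoints L. asm f \<in> \<Union>K} = \<Union>((\<lambda>k. {f \<in> bipoints L. asm f \<in> k}) ` K)" by auto
      moreover have "\<Union>((\<lambda>k. {f \<in> bipoints L. asm f \<in> k}) ` K) \<in> open_sets"
        by (rule open_sets_Union) (use UN.IH in blast)
      ultimately show ?case by simp
    next
      case (Basis W)
      then obtain C where C: "C \<in> carrier (pos AL) \<and> W = phi_pos AL C \<or> C \<in> carrier (neg AL) \<and> W = phi_neg AL C"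
        unfolding Un_iff mem_Collect_eq phi_pos_AL(1) phi_neg_AL(1) by blast
      then have "{f \<in> bipoints L. asm f \<in> W} = off_set C" using asm_phi by (auto simp: off_set_def)
      then show ?case using off_set_open_sets[of C] C by auto
    qed
    show "bi_TD (bpt L)"
      unfolding bi_TD_iff_isolated
    proof
      fix f assume f: "f \<in> bipoints L"
      have "{h \<in> bipoints L. asm h \<in> {asm f}} = {f}"
        using f bij_asm by (auto simp: bij_betw_def inj_on_eq_iff)
      moreover have "{h \<in> bipoints L. asm h \<in> {asm f}} \<in> open_sets"
        using disc[of "{asm f}"] asm_bipoint[OF f] by (intro op) (simp add: openin_topology_generated_by)
      ultimately show "pclosure (bipoints L - {f}) = bipoints L - {f}" by simp
    qed
  next
    assume td: "bi_TD (bpt L)"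
    have single: "openin (topology_generated_by ?G) {g}" if g: "g \<in> bipoints AL" for g
    proof -
      obtain f where f: "f \<in> bipoints L" "g = asm f" using g by (rule bipoint_AL_is_asm)
      then have "f \<notin> pclosure (bipoints L - {f})" using td by (simp add: bi_TD_iff_isolated)
      then obtain a b c d where 1: "covers (bipoints L - {f}) a b c d" "fst f a" "snd f b" "\<not> fst f c" "\<not> snd f d"
        by (rule not_in_pclosure[OF f(1)])
      note cl = covers_closed[OF 1(1)]
      \<comment> \<open>The conditions on \<open>a\<close> and \<open>b\<close> are open already,
        those on \<open>c\<close> and \<open>d\<close> are negated. In the assembly the negations
        become open sets of \<open>delta\<close>, each in the component of opposite sign.\<close>
      let ?Ca = "nabla (main L) (epos L a)" and ?Cb = "nabla (main L) (eneg L b)"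
        and ?Cc = "delta (main L) (epos L c)" and ?Cd = "delta (main L) (eneg L d)"
      note mem = subsetD[OF gen_sub(1) gen_mem(1)[OF cl(1)]] subsetD[OF gen_sub(2) gen_mem(3)[OF cl(2)]]
        subsetD[OF gen_sub(2) gen_mem(4)[OF cl(3)]] subsetD[OF gen_sub(1) gen_mem(2)[OF cl(4)]]
      have "{f} = off_set ?Ca \<inter> off_set ?Cb \<inter> (off_set ?Cc \<inter> off_set ?Cd)"
      proof
        show "{f} \<subseteq> off_set ?Ca \<inter> off_set ?Cb \<inter> (off_set ?Cc \<inter> off_set ?Cd)"
          using 1 cl f(1) by (simp add: off_set_gen phi_pos_def phi_neg_def)
        show "off_set ?Ca \<inter> off_set ?Cb \<inter> (off_set ?Cc \<inter> off_set ?Cd) \<subseteq> {f}"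
          using 1(1) cl unfolding covers_def by (simp only: off_set_gen) blast
      qed
      then have Z: "asm ` {f} = asm ` (off_set ?Ca \<inter> off_set ?Cb \<inter> (off_set ?Cc \<inter> off_set ?Cd))" by simp
      have inj: "asm ` (U \<inter> V) = asm ` U \<inter> asm ` V" if "U \<subseteq> bipoints L" "V \<subseteq> bipoints L" for U V
        using bij_asm that by (intro inj_on_image_Int) (auto simp: bij_betw_def)
      have sub: "off_set C \<subseteq> bipoints L" for C by (auto simp: off_set_def)
      have "{g} = phi_pos AL ?Ca \<inter> phi_neg AL ?Cb \<inter> (phi_neg AL ?Cc \<inter> phi_pos AL ?Cd)"
        using Z by (simp add: inj sub le_infI1 asm_image mem f(2))
      moreover have "openin (topology_generated_by ?G) (phi_pos AL C)" if "C \<in> carrier (pos AL)" for C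
        using that phi_pos_AL(1) by (intro topology_generated_by_Basis) auto
      moreover have "openin (topology_generated_by ?G) (phi_neg AL C)" if "C \<in> carrier (neg AL)" for C
        using that phi_neg_AL(1) by (intro topology_generated_by_Basis) auto
      ultimately show ?thesis using mem by (simp add: openin_Int)
    qed
    show "patch_discrete (bpt AL)"
      unfolding patch_discrete_def patch_def pts topology_eq openin_discrete_topology
    proof (intro allI iffI)
      fix W assume "openin (topology_generated_by ?G) W"
      then show "W \<subseteq> bipoints AL" using openin_subset UG topology_generated_by_topspace by metis
    next
      fix W assume W: "W \<subseteq> bipoints AL"
      have "openin (topology_generated_by ?G) (\<Union>((\<lambda>g. {g}) ` W))"
        by (rule openin_Union) (use single W in blast)
      then show "openin (topology_generated_by ?G) W" by simp
    qed
  qed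
qed

end

theorem theorem5p12:
  fixes L :: "('p, 'n, 'a) biframe"
  assumes "finitary_biframe L"
  shows "(\<forall>f\<in>bipoints L. \<exists>!g. g \<in> bipoints (assembly L) \<and> extends_to_assembly L f g) \<and>
    bihomeomorphism (Sk (bpt L)) (bpt (assembly L)) (assembly_point L) \<and>
    coframe (bisp_biquotients L) \<and>
    (bi_TD (bpt L) \<longleftrightarrow> patch_discrete (bpt (assembly L))) \<and>
    (bi_TD (bpt L) \<longleftrightarrow> is_boolean_algebra (bisp_biquotients L)) \<and>
    (bi_TD (bpt L) \<longleftrightarrow> (\<forall>A \<subseteq> points (bpt L). bisober (bisubspace (bpt L) A))) \<and>
    (bi_TD (bpt L) \<longleftrightarrow>
      order_iso (bisp_biquotients L) (inclusion_order (Pow (points (bpt L)))) (bpt_biquotient L))"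
proof -
  interpret fin_biframe L by unfold_locales (fact assms)
  show ?thesis
    by (intro conjI ballI ex1_assembly bihomeomorphism_assembly_point coframe_bisp patch_discrete_iff[symmetric]
      bi_TD_iff_boolean bi_TD_iff_bisober bi_TD_iff_iso)
qed

end
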